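(* Let $(X,\mu,T)$ be a measure-preserving system, where $(X,\mu)$ is a standard Borel probability space and $T:X\to X$ is invertible and preserves $\mu$, and let $x\mapsto\mu_x$ be the ergodic decomposition of $\mu$. There exists a countably generated sub-$\sigma$-algebra $\mathcal C\subset\mathcal B_X$ such that - $\Pi(X,\mu,T)=\mathcal C$ mod $\mu$; - for almost every ergodic component $\mu_x$, $\Pi(X,\mu_x,T)=\mathcal C$ mod $\mu_x$. Moreover, for all $f\in L^1(\mu)$, we have for $\mu$-almost every $x$ $$\mathbb E_\mu[f\mid\mathcal C](x)=\mathbb E_{\mu_x}[f\mid\mathcal C](x).$$
   Context: $\mathcal B_X$ is the Borel $\sigma$-algebra of $X$. The ergodic decomposition of $\mu$ is the measurable map $x\mapsto\mu_x$ from $X$ to the space of ergodic $T$-invariant probability measures on $X$ such that, for all $f\in L^1(\mu)$, $\mathbb E_\mu[f\mid\mathcal I_T](x)=\int_Xf\,d\mu_x$ for $\mu$-a.e. $x$, where $\mathcal I_T$ is the $\sigma$-algebra of $T$-invariant Borel sets. For a $T$-invariant probability measure $\eta$, $\Pi(X,\eta,T)$ is the Pinsker $\sigma$-algebra: all Borel sets $A$ with $h_\eta(\{A,X\setminus A\},T)=0$ (Kolmogorov–Sinai entropy of the partition). *)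

theory Defs
  imports "HOL-Probability.Probability"
begin

section \<open>Measure-preserving systems\<close>

definition standard_borel :: "'a measure \<Rightarrow> bool" where
  "standard_borel M \<longleftrightarrow>
     (\<exists>S. completely_metrizable_space S \<and> second_countable S \<and> topspace S = space M \<and>
          sets M = sigma_sets (topspace S) {U. openin S U})"

definition invariant_under :: "('a \<Rightarrow> 'a) \<Rightarrow> 'a measure \<Rightarrow> bool" where
  "invariant_under T M \<longleftrightarrow> T \<in> M \<rightarrow>\<^sub>M M \<and> distr M M T = M"

text \<open>
  Invertibility is meant in the category of measurable spaces. On a standard Borel space the
  measurability of the inverse follows from that of the map (Lusin--Souslin).
\<close>

definition invertible_mps :: "'a measure \<Rightarrow> ('a \<Rightarrow> 'a) \<Rightarrow> bool" where
  "invertible_mps M T \<longleftrightarrow>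
     prob_space M \<and> standard_borel M \<and> invariant_under T M \<and>
     bij_betw T (space M) (space M) \<and> the_inv_into (space M) T \<in> M \<rightarrow>\<^sub>M M"

definition invariant_sets :: "'a measure \<Rightarrow> ('a \<Rightarrow> 'a) \<Rightarrow> 'a set set" where
  "invariant_sets M T = {A \<in> sets M. T -` A \<inter> space M = A}"

definition ergodic_under :: "('a \<Rightarrow> 'a) \<Rightarrow> 'a measure \<Rightarrow> bool" where
  "ergodic_under T M \<longleftrightarrow>
     prob_space M \<and> invariant_under T M \<and>
     (\<forall>A \<in> invariant_sets M T. measure M A = 0 \<or> measure M A = 1)"

text \<open>
  Members of \<open>space (prob_algebra M)\<close> are the probability measures on \<open>sets M\<close>; its
  measurable structure is generated by the evaluations \<open>\<nu> \<mapsto> \<nu> A\<close>.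
\<close>

definition ergodic_decomposition ::
    "'a measure \<Rightarrow> ('a \<Rightarrow> 'a) \<Rightarrow> ('a \<Rightarrow> 'a measure) \<Rightarrow> bool" where
  "ergodic_decomposition M T \<kappa> \<longleftrightarrow>
     \<kappa> \<in> M \<rightarrow>\<^sub>M prob_algebra M \<and>
     (\<forall>x \<in> space M. ergodic_under T (\<kappa> x)) \<and>
     (\<forall>f :: 'a \<Rightarrow> real. integrable M f \<longrightarrow>
        (AE x in M. real_cond_exp M (sigma (space M) (invariant_sets M T)) f x
                    = (\<integral>y. f y \<partial>\<kappa> x)))"


section \<open>Entropy and the Pinsker algebra\<close>

text \<open>
  A finite partition is represented by the set of its cells. Empty cells are allowed and
  contribute \<open>0 * ln 0 = 0\<close> to the entropy.
\<close>

definition partition_entropy :: "'a measure \<Rightarrow> 'a set set \<Rightarrow> real" where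
  "partition_entropy M \<xi> = - (\<Sum>A\<in>\<xi>. measure M A * ln (measure M A))"

definition partition_join :: "'a set set \<Rightarrow> 'a set set \<Rightarrow> 'a set set" where
  "partition_join \<xi> \<zeta> = {A \<inter> B | A B. A \<in> \<xi> \<and> B \<in> \<zeta>}"

definition partition_pullback ::
    "'a measure \<Rightarrow> ('a \<Rightarrow> 'a) \<Rightarrow> nat \<Rightarrow> 'a set set \<Rightarrow> 'a set set" where
  "partition_pullback M T i \<xi> = (\<lambda>A. (T ^^ i) -` A \<inter> space M) ` \<xi>"

primrec iterated_join ::
    "'a measure \<Rightarrow> ('a \<Rightarrow> 'a) \<Rightarrow> 'a set set \<Rightarrow> nat \<Rightarrow> 'a set set" where
  "iterated_join M T \<xi> 0 = {space M}"
| "iterated_join M T \<xi> (Suc n) =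
     partition_join (iterated_join M T \<xi> n) (partition_pullback M T n \<xi>)"

text \<open>For invariant probability measures and finite measurable partitions the limit exists,
  by subadditivity.\<close>

definition ks_entropy :: "'a measure \<Rightarrow> ('a \<Rightarrow> 'a) \<Rightarrow> 'a set set \<Rightarrow> real" where
  "ks_entropy M T \<xi> = lim (\<lambda>n. partition_entropy M (iterated_join M T \<xi> n) / real n)"

definition pinsker :: "'a measure \<Rightarrow> ('a \<Rightarrow> 'a) \<Rightarrow> 'a set set" where
  "pinsker M T = {A \<in> sets M. ks_entropy M T {A, space M - A} = 0}"


section \<open>Sub-sigma-algebras\<close>

text \<open>
  As in the library's theory of conditional expectations, a sub-sigma-algebra is given as a
  measure of which only \<open>space\<close> and \<open>sets\<close> matter.
\<close>

definition countably_generated :: "'a measure \<Rightarrow> bool" where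
  "countably_generated C \<longleftrightarrow>
     (\<exists>G. countable G \<and> G \<subseteq> Pow (space C) \<and> sets C = sigma_sets (space C) G)"

definition eq_mod :: "'a measure \<Rightarrow> 'a set set \<Rightarrow> 'a set set \<Rightarrow> bool" where
  "eq_mod M \<A> \<B> \<longleftrightarrow>
     (\<forall>A\<in>\<A>. \<exists>B\<in>\<B>. sym_diff A B \<in> null_sets M) \<and>
     (\<forall>B\<in>\<B>. \<exists>A\<in>\<A>. sym_diff A B \<in> null_sets M)"

text \<open>
  The conditional expectation of \<open>f\<close> with respect to \<open>\<kappa> x\<close> is a class modulo \<open>\<kappa> x\<close>, and single
  points may be null for \<open>\<kappa> x\<close>. The constant \<open>real_cond_exp\<close> picks a representative for each
  measure separately, without any measurability in the measure, so its value at the point \<open>x\<close>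
  itself is arbitrary. Evaluating at \<open>x\<close> requires representatives \<open>G \<nu>\<close> chosen jointly measurably
  in the measure \<open>\<nu>\<close> and the point.
\<close>

definition cond_exp_versions ::
    "'a measure \<Rightarrow> ('a \<Rightarrow> 'a measure) \<Rightarrow> 'a measure \<Rightarrow> ('a \<Rightarrow> real) \<Rightarrow>
     ('a measure \<Rightarrow> 'a \<Rightarrow> real) \<Rightarrow> bool" where
  "cond_exp_versions M \<kappa> C f G \<longleftrightarrow>
     (\<lambda>(\<nu>, y). G \<nu> y) \<in> borel_measurable (prob_algebra M \<Otimes>\<^sub>M M) \<and>
     (AE x in M. AE y in \<kappa> x. G (\<kappa> x) y = real_cond_exp (\<kappa> x) C f y)"

end

theory Submission
  imports Defs
begin

text \<open>
  The proof describes the Pinsker algebra by tails of processes, because conditional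
  probabilities given the tail of a process can be computed by a formula that depends measurably
  on the measure.

  For a function \<open>X\<close> with finitely many values and an invariant probability measure
  \<open>\<nu>\<close>, let \<open>X_i = X \<circ> T^i\<close>. The conditional probability of a
  set \<open>B\<close> given \<open>X_n, ..., X_(m-1)\<close> is an explicit quotient. Letting
  first \<open>m\<close> and then \<open>n\<close> tend to infinity gives the conditional
  probability of \<open>B\<close> given the tail of the process. Two facts on entropy connect
  the tail with the Pinsker algebra. Events of the tail have entropy zero
  (\<open>tail_subset_pinsker\<close>). Conversely, conditioning a Pinsker set on \<open>X_0,
  X_1, ...\<close> or on \<open>X_n, X_(n+1), ...\<close> gives the same result
  (\<open>pinsker_conditional_on_future\<close>), so that a Pinsker set which is nearly
  determined by \<open>X\<close> is nearly determined by the tail of \<open>X\<close>.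

  Take for \<open>X\<close> the itineraries with respect to the first \<open>k\<close> members
  of a countable generator. Since \<open>\<kappa> y = \<kappa> x\<close> for \<open>\<kappa>
  x\<close>-almost every \<open>y\<close> (\<open>kernel_constant\<close>), the tail conditional
  probability of \<open>B\<close> computed at \<open>y\<close> with the measure \<open>\<kappa>
  y\<close> is one measurable function that serves almost every component
  (\<open>tail_density_exists\<close>). The sigma-algebra \<open>\<C>\<close> is generated by
  the sets where such a function exceeds \<open>1/2\<close>, for \<open>k\<close> and
  \<open>B\<close> in countable families, and by the functions \<open>y \<mapsto> measure
  (\<kappa> y) B\<close>. The two facts above show that \<open>\<C>\<close> is the Pinsker
  algebra of almost every component (\<open>\<C>_subset_pinsker_\<kappa>\<close>,
  \<open>pinsker_\<kappa>_subset_\<C>\<close>).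

  For the system itself, a set is a Pinsker set if and only if it is one for almost every
  component. One direction is concavity of the entropy
  (\<open>pinsker_imp_pinsker_\<kappa>\<close>), the other expresses that invariant sets carry
  no entropy (\<open>pinsker_\<kappa>_imp_pinsker\<close>). Finally, \<open>\<kappa>\<close> is
  \<open>\<C>\<close>-measurable, so \<open>\<C>\<close> contains the invariant sets up to null
  sets, and a conditional expectation given \<open>\<C>\<close> in the system is one in almost
  every component (\<open>cond_exp_fibre\<close>).
\<close>

section \<open>Entropy and conditional probabilities of finite-valued functions\<close>

definition eta :: "real \<Rightarrow> real" where
  "eta t = - (t * ln t)"

lemma eta_0 [simp]: "eta 0 = 0" and eta_1 [simp]: "eta 1 = 0"
  by (simp_all add: eta_def)

lemma eta_ge: "0 \<le> t \<Longrightarrow> t * (1 - t) \<le> eta t"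
proof (cases "t = 0")
  case False
  assume "0 \<le> t"
  with False have "ln t \<le> t - 1" by (intro ln_le_minus_one) auto
  then have "t * ln t \<le> t * (t - 1)" using \<open>0 \<le> t\<close> by (intro mult_left_mono)
  then show ?thesis by (simp add: eta_def algebra_simps)
qed simp

lemma eta_nonneg: "0 \<le> t \<Longrightarrow> t \<le> 1 \<Longrightarrow> 0 \<le> eta t"
  using eta_ge[of t] mult_nonneg_nonneg[of t "1 - t"] by linarith

lemma eta_le_1: "0 \<le> t \<Longrightarrow> eta t \<le> 1"
proof (cases "t = 0")
  case False
  assume "0 \<le> t"
  with False have t: "0 < t" by simp
  have "ln (1 / t) \<le> 1 / t - 1" using t by (intro ln_le_minus_one) simp
  then have "t * ln (1 / t) \<le> t * (1 / t - 1)" using t by (intro mult_left_mono) auto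
  then show ?thesis using t by (simp add: eta_def ln_div algebra_simps)
qed simp

lemma eta_measurable [measurable]: "eta \<in> borel_measurable borel"
  unfolding eta_def[abs_def] by measurable

text \<open>
  Quantitative concavity: \<open>eta\<close> lies below its tangent line at \<open>s\<close> by
  at least \<open>(t - s)^2 / 4\<close>. The gap equals \<open>t ln (t / s) - t + s\<close>,
  which \<open>ln u \<le> u - 1\<close> at \<open>u = sqrt (s / t)\<close> bounds below by
  \<open>(sqrt t - sqrt s)^2\<close>. This quadratic term is what turns equalities of entropies
  into equalities of conditional probabilities.
\<close>

lemma eta_tangent:
  assumes "0 < s" "s \<le> 1" "0 \<le> t" "t \<le> 1"
  shows "eta t \<le> eta s - (ln s + 1) * (t - s) - (t - s)\<^sup>2 / 4"
proof -
  have key: "(t - s)\<^sup>2 / 4 \<le> t + s - 2 * sqrt (t * s)"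
  proof -
    define a where "a = sqrt t"
    define b where "b = sqrt s"
    have ab: "0 \<le> a" "a \<le> 1" "0 \<le> b" "b \<le> 1" and t: "t = a\<^sup>2" and s: "s = b\<^sup>2"
      using assms by (auto simp: a_def b_def)
    have "(t - s)\<^sup>2 = (a + b)\<^sup>2 * (a - b)\<^sup>2"
      unfolding t s by (simp add: power2_eq_square algebra_simps)
    also have "\<dots> \<le> 2\<^sup>2 * (a - b)\<^sup>2"
      using ab by (intro mult_right_mono power_mono) auto
    also have "(a - b)\<^sup>2 = t + s - 2 * sqrt (t * s)"
      unfolding t s using ab by (simp add: power2_eq_square real_sqrt_mult algebra_simps)
    finally show ?thesis by simp
  qed
  have "t * ln t \<ge> t * ln s + 2 * t - 2 * sqrt (t * s)"
  proof (cases "t = 0")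
    case False
    then have t: "t > 0" using assms by simp
    have "ln (sqrt (s / t)) \<le> sqrt (s / t) - 1"
      using assms t by (intro ln_le_minus_one) auto
    then have "(ln s - ln t) / 2 \<le> sqrt (s / t) - 1"
      using assms t by (simp add: ln_sqrt ln_div)
    then have "t * (ln s - ln t) \<le> t * (2 * sqrt (s / t) - 2)"
      using t by (intro mult_left_mono) auto
    moreover have "t * sqrt (s / t) = sqrt (t * s)"
      using t by (simp add: real_sqrt_divide real_sqrt_mult field_simps)
    ultimately show ?thesis by (simp add: algebra_simps)
  qed simp
  with key show ?thesis by (simp add: eta_def algebra_simps)
qed

text \<open>
  The entropy of a two-cell partition with a small cell is small; it controls the change of
  entropy when a set is replaced by one at small distance.
\<close>

lemma binary_entropy_small:
  assumes "0 < \<epsilon>"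
  shows "\<exists>\<delta>>0. \<forall>t\<ge>0. t < \<delta> \<longrightarrow> eta t + eta (1 - t) < \<epsilon>"
proof -
  have "((\<lambda>t. eta t + eta (1 - t)) \<longlongrightarrow> 0) (at_right 0)"
    unfolding eta_def by real_asymp
  then have "\<forall>\<^sub>F t in at_right 0. \<bar>eta t + eta (1 - t)\<bar> < \<epsilon>"
    using assms unfolding tendsto_iff dist_real_def by simp
  then obtain \<delta> where \<delta>: "0 < \<delta>" "\<And>t. 0 < t \<Longrightarrow> t < \<delta> \<Longrightarrow> \<bar>eta t + eta (1 - t)\<bar> < \<epsilon>"
    unfolding eventually_at_right_field by auto
  have "eta t + eta (1 - t) < \<epsilon>" if "0 \<le> t" "t < \<delta>" for t
    using \<delta>(2)[of t] that assms by (cases "t = 0") auto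
  with \<delta>(1) show ?thesis by blast
qed

text \<open>
  Finite partitions are treated as the level sets of a function with finitely many values, so
  that joins are pairs and refinement is the following relation, which compares the partitions
  into level sets and ignores the values.
\<close>

definition coarser :: "'a measure \<Rightarrow> ('a \<Rightarrow> 'b) \<Rightarrow> ('a \<Rightarrow> 'c) \<Rightarrow> bool" where
  "coarser M Y' Y \<longleftrightarrow> (\<forall>y\<in>space M. \<forall>z\<in>space M. Y y = Y z \<longrightarrow> Y' y = Y' z)"

definition ent :: "'a measure \<Rightarrow> ('a \<Rightarrow> 'b) \<Rightarrow> real" where
  "ent M X = (\<Sum>v\<in>X ` space M. eta (measure M {y \<in> space M. X y = v}))"

text \<open>
  The conditional probability of \<open>B\<close> given \<open>Y = w\<close>. As an explicit
  quotient it depends measurably on the measure, unlike an abstractly chosen conditional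
  expectation; on a null cell it is \<open>0\<close> because of \<open>x / 0 = 0\<close>, and
  this is consistent with all identities below.
\<close>

definition cprob :: "'a measure \<Rightarrow> ('a \<Rightarrow> 'b) \<Rightarrow> 'a set \<Rightarrow> 'b \<Rightarrow> real" where
  "cprob M Y B w = measure M (B \<inter> {z \<in> space M. Y z = w}) / measure M {z \<in> space M. Y z = w}"

definition cent :: "'a measure \<Rightarrow> ('a \<Rightarrow> 'b) \<Rightarrow> ('a \<Rightarrow> 'c) \<Rightarrow> real" where
  "cent M X Y = ent M (\<lambda>y. (X y, Y y)) - ent M Y"

lemma simple_function_cell:
  "simple_function M Y \<Longrightarrow> {z \<in> space M. Y z = w} \<in> sets M"
proof -
  assume a: "simple_function M Y"
  have "{z \<in> space M. Y z = w} = Y -` {w} \<inter> space M" by auto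
  then show ?thesis using simple_functionD(2)[OF a] by simp
qed

lemma coarserD: "coarser M X Y \<Longrightarrow> y \<in> space M \<Longrightarrow> z \<in> space M \<Longrightarrow> Y y = Y z \<Longrightarrow> X y = X z"
  unfolding coarser_def by blast

lemma coarser_refl [simp]: "coarser M X X"
  by (simp add: coarser_def)

lemma coarser_const [simp]: "coarser M (\<lambda>_. c) X"
  by (simp add: coarser_def)

lemma coarser_Pair_iff [simp]: "coarser M (\<lambda>y. (X y, W y)) Y \<longleftrightarrow> coarser M X Y \<and> coarser M W Y"
  unfolding coarser_def by blast

lemma coarser_PairI1: "coarser M X Y \<Longrightarrow> coarser M X (\<lambda>y. (Y y, W y))"
  and coarser_PairI2: "coarser M X W \<Longrightarrow> coarser M X (\<lambda>y. (Y y, W y))"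
  unfolding coarser_def by blast+

lemma coarser_trans: "coarser M X Y \<Longrightarrow> coarser M Y Z \<Longrightarrow> coarser M X Z"
  unfolding coarser_def by blast

lemmas coarser_intros = coarser_refl coarser_PairI1 coarser_PairI2

lemma coarser_factor:
  assumes "coarser M Y' Y"
  obtains f where "\<And>y. y \<in> space M \<Longrightarrow> Y' y = f (Y y)"
proof
  fix y assume y: "y \<in> space M"
  have "\<exists>z. z \<in> space M \<and> Y z = Y y" using y by auto
  then have "(SOME z. z \<in> space M \<and> Y z = Y y) \<in> space M \<and> Y (SOME z. z \<in> space M \<and> Y z = Y y) = Y y"
    by (rule someI_ex)
  then show "Y' y = (\<lambda>w. Y' (SOME z. z \<in> space M \<and> Y z = w)) (Y y)"
    using assms y unfolding coarser_def by metis
qed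

context prob_space begin

lemma integrable_simple_comp:
  fixes \<phi> :: "'b \<Rightarrow> real"
  assumes "simple_function M Y"
  shows "integrable M (\<lambda>y. \<phi> (Y y))"
proof -
  have sf: "simple_function M (\<lambda>y. \<phi> (Y y))"
    using simple_function_compose[OF assms, of \<phi>] by (simp add: comp_def)
  have fin: "finite ((\<lambda>y. norm (\<phi> (Y y))) ` space M)"
    using finite_imageI[OF simple_functionD(1)[OF sf], of norm] by (simp add: image_image)
  show ?thesis
    by (rule integrable_const_bound[where B="Max (insert 0 ((\<lambda>y. norm (\<phi> (Y y))) ` space M))"])
      (use fin sf in \<open>auto intro!: AE_I2 Max_ge borel_measurable_simple_function\<close>)
qed

lemma integral_indicator_simple_comp:
  fixes \<phi> :: "'b \<Rightarrow> real"
  assumes Y: "simple_function M Y" and B: "B \<in> sets M"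
  shows "(\<integral>y. indicator B y * \<phi> (Y y) \<partial>M) =
    (\<Sum>w\<in>Y ` space M. \<phi> w * prob (B \<inter> {z \<in> space M. Y z = w}))"
proof -
  have "(\<integral>y. indicator B y * \<phi> (Y y) \<partial>M) =
    (\<integral>y. (\<Sum>w\<in>Y ` space M. \<phi> w * indicator (B \<inter> {z \<in> space M. Y z = w}) y) \<partial>M)"
  proof (rule Bochner_Integration.integral_cong[OF refl])
    fix y assume y: "y \<in> space M"
    have "(\<Sum>w\<in>Y ` space M. \<phi> w * indicator (B \<inter> {z \<in> space M. Y z = w}) y) =
      (\<Sum>w\<in>Y ` space M. if w = Y y then indicator B y * \<phi> (Y y) else (0::real))"
      using y by (intro sum.cong) (auto simp: indicator_def)
    also have "\<dots> = indicator B y * \<phi> (Y y)"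
      using y simple_functionD(1)[OF Y] by (subst sum.delta) auto
    finally show "indicator B y * \<phi> (Y y) = (\<Sum>w\<in>Y ` space M. \<phi> w * indicator (B \<inter> {z \<in> space M. Y z = w}) y)"
      by simp
  qed
  also have "\<dots> = (\<Sum>w\<in>Y ` space M. \<phi> w * prob (B \<inter> {z \<in> space M. Y z = w}))"
    using simple_function_cell[OF Y] B by (subst Bochner_Integration.integral_sum) (auto intro!: sum.cong simp: less_top[symmetric])
  finally show ?thesis .
qed

lemma integral_simple_comp:
  fixes \<phi> :: "'b \<Rightarrow> real"
  assumes Y: "simple_function M Y"
  shows "(\<integral>y. \<phi> (Y y) \<partial>M) = (\<Sum>w\<in>Y ` space M. \<phi> w * prob {z \<in> space M. Y z = w})"
proof -
  have "(\<integral>y. \<phi> (Y y) \<partial>M) = (\<integral>y. indicator (space M) y * \<phi> (Y y) \<partial>M)"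
    by (rule Bochner_Integration.integral_cong) auto
  also have "\<dots> = (\<Sum>w\<in>Y ` space M. \<phi> w * prob (space M \<inter> {z \<in> space M. Y z = w}))"
    by (rule integral_indicator_simple_comp[OF Y]) auto
  also have "\<dots> = (\<Sum>w\<in>Y ` space M. \<phi> w * prob {z \<in> space M. Y z = w})"
    by (intro sum.cong arg_cong2[where f="(*)"] arg_cong[where f=prob]) auto
  finally show ?thesis .
qed

lemma cprob_nonneg: "0 \<le> cprob M Y B w"
  by (simp add: cprob_def)

lemma cprob_le_1: "simple_function M Y \<Longrightarrow> cprob M Y B w \<le> 1"
  unfolding cprob_def
  by (intro divide_le_eq_1[THEN iffD2])
    (auto simp: zero_less_measure_iff simple_function_cell intro!: finite_measure_mono)

lemma cprob_mult:
  assumes "simple_function M Y"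
  shows "cprob M Y B w * prob {z \<in> space M. Y z = w} = prob (B \<inter> {z \<in> space M. Y z = w})"
proof (cases "prob {z \<in> space M. Y z = w} = 0")
  case True
  have "prob (B \<inter> {z \<in> space M. Y z = w}) \<le> prob {z \<in> space M. Y z = w}"
    by (intro finite_measure_mono) (auto simp: simple_function_cell assms)
  with True have "prob (B \<inter> {z \<in> space M. Y z = w}) = 0"
    using measure_nonneg[of M "B \<inter> {z \<in> space M. Y z = w}"] by linarith
  with True show ?thesis by simp
qed (simp add: cprob_def)

lemma integrable_indicator_simple_comp:
  fixes \<phi> :: "'b \<Rightarrow> real"
  assumes Y: "simple_function M Y" and B: "B \<in> sets M"
  shows "integrable M (\<lambda>y. indicator B y * \<phi> (Y y))"
  using integrable_mult_indicator[OF B integrable_simple_comp[OF Y, of \<phi>]] by simp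

text \<open>
  The orthogonality relation: \<open>cprob M Y B \<circ> Y\<close> is the projection of the
  indicator of \<open>B\<close> to the functions of \<open>Y\<close>.
\<close>

lemma integral_cprob:
  fixes \<phi> :: "'b \<Rightarrow> real"
  assumes Y: "simple_function M Y" and B: "B \<in> sets M"
  shows "(\<integral>y. cprob M Y B (Y y) * \<phi> (Y y) \<partial>M) = (\<integral>y. indicator B y * \<phi> (Y y) \<partial>M)"
  unfolding integral_indicator_simple_comp[OF Y B]
    integral_simple_comp[OF Y, of "\<lambda>w. cprob M Y B w * \<phi> w"]
  by (intro sum.cong refl) (simp add: cprob_mult[OF Y, symmetric])

lemma integral_cprob_coarser:
  fixes \<phi> :: "'b \<Rightarrow> real"
  assumes Y: "simple_function M Y" and Y': "simple_function M Y'" and B: "B \<in> sets M"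
    and co: "coarser M Y' Y"
  shows "(\<integral>y. cprob M Y B (Y y) * \<phi> (Y' y) \<partial>M) = (\<integral>y. cprob M Y' B (Y' y) * \<phi> (Y' y) \<partial>M)"
proof -
  obtain f where f: "\<And>y. y \<in> space M \<Longrightarrow> Y' y = f (Y y)" using coarser_factor[OF co] by blast
  have "(\<integral>y. cprob M Y B (Y y) * \<phi> (Y' y) \<partial>M) = (\<integral>y. cprob M Y B (Y y) * \<phi> (f (Y y)) \<partial>M)"
    using f by (intro Bochner_Integration.integral_cong) auto
  also have "\<dots> = (\<integral>y. indicator B y * \<phi> (f (Y y)) \<partial>M)"
    by (rule integral_cprob[OF Y B, of "\<lambda>w. \<phi> (f w)"])
  also have "\<dots> = (\<integral>y. indicator B y * \<phi> (Y' y) \<partial>M)"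
    using f by (intro Bochner_Integration.integral_cong) auto
  also have "\<dots> = (\<integral>y. cprob M Y' B (Y' y) * \<phi> (Y' y) \<partial>M)"
    by (rule integral_cprob[OF Y' B, symmetric])
  finally show ?thesis .
qed

lemma integrable_simple_comp2:
  fixes \<phi> :: "'b \<Rightarrow> 'c \<Rightarrow> real"
  assumes "simple_function M Y" "simple_function M Z"
  shows "integrable M (\<lambda>y. \<phi> (Y y) (Z y))"
  using integrable_simple_comp[OF simple_function_Pair[OF assms], of "\<lambda>(a, b). \<phi> a b"] by simp

text \<open>
  Two projections onto nested spaces, so their difference is orthogonal to the smaller one.
\<close>

lemma cprob_pythagoras:
  assumes Y: "simple_function M Y" and Y': "simple_function M Y'" and B: "B \<in> sets M"
    and co: "coarser M Y' Y"
  shows "(\<integral>y. (cprob M Y B (Y y) - cprob M Y' B (Y' y))\<^sup>2 \<partial>M) =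
    (\<integral>y. (cprob M Y B (Y y))\<^sup>2 \<partial>M) - (\<integral>y. (cprob M Y' B (Y' y))\<^sup>2 \<partial>M)"
proof -
  have "(\<integral>y. (cprob M Y B (Y y) - cprob M Y' B (Y' y))\<^sup>2 \<partial>M) =
    (\<integral>y. (cprob M Y B (Y y))\<^sup>2 - 2 * (cprob M Y B (Y y) * cprob M Y' B (Y' y))
        + (cprob M Y' B (Y' y))\<^sup>2 \<partial>M)"
    by (simp add: power2_eq_square algebra_simps)
  also have "\<dots> = (\<integral>y. (cprob M Y B (Y y))\<^sup>2 \<partial>M) - 2 * (\<integral>y. cprob M Y B (Y y) * cprob M Y' B (Y' y) \<partial>M)
    + (\<integral>y. (cprob M Y' B (Y' y))\<^sup>2 \<partial>M)"
    using integrable_simple_comp[OF Y, of "\<lambda>w. (cprob M Y B w)\<^sup>2"]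
      integrable_simple_comp[OF Y', of "\<lambda>w. (cprob M Y' B w)\<^sup>2"]
      integrable_simple_comp2[OF Y Y', of "\<lambda>v w. cprob M Y B v * cprob M Y' B w"]
    by simp
  also have "(\<integral>y. cprob M Y B (Y y) * cprob M Y' B (Y' y) \<partial>M) = (\<integral>y. (cprob M Y' B (Y' y))\<^sup>2 \<partial>M)"
    using integral_cprob_coarser[OF Y Y' B co, of "cprob M Y' B"] by (simp add: power2_eq_square)
  finally show ?thesis by simp
qed

lemma cprob_residual:
  assumes Y: "simple_function M Y" and B: "B \<in> sets M"
  shows "(\<integral>y. (indicator B y - cprob M Y B (Y y))\<^sup>2 \<partial>M) =
    (\<integral>y. cprob M Y B (Y y) * (1 - cprob M Y B (Y y)) \<partial>M)"
proof -
  have "(\<integral>y. (indicator B y - cprob M Y B (Y y))\<^sup>2 \<partial>M) =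
    (\<integral>y. indicator B y * (1 - 2 * cprob M Y B (Y y)) + (cprob M Y B (Y y))\<^sup>2 \<partial>M)"
    by (intro Bochner_Integration.integral_cong refl) (auto simp: power2_eq_square algebra_simps indicator_def)
  also have "\<dots> = (\<integral>y. indicator B y * (1 - 2 * cprob M Y B (Y y)) \<partial>M) + (\<integral>y. (cprob M Y B (Y y))\<^sup>2 \<partial>M)"
    by (intro Bochner_Integration.integral_add integrable_indicator_simple_comp[OF Y B, of "\<lambda>w. 1 - 2 * cprob M Y B w"]
         integrable_simple_comp[OF Y, of "\<lambda>w. (cprob M Y B w)\<^sup>2"])
  also have "\<dots> = (\<integral>y. cprob M Y B (Y y) * (1 - 2 * cprob M Y B (Y y)) \<partial>M) + (\<integral>y. (cprob M Y B (Y y))\<^sup>2 \<partial>M)"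
    using integral_cprob[OF Y B, of "\<lambda>w. 1 - 2 * cprob M Y B w"] by simp
  also have "\<dots> = (\<integral>y. cprob M Y B (Y y) * (1 - 2 * cprob M Y B (Y y)) + (cprob M Y B (Y y))\<^sup>2 \<partial>M)"
    by (intro Bochner_Integration.integral_add[symmetric] integrable_simple_comp[OF Y, of "\<lambda>w. cprob M Y B w * (1 - 2 * cprob M Y B w)"]
         integrable_simple_comp[OF Y, of "\<lambda>w. (cprob M Y B w)\<^sup>2"])
  also have "\<dots> = (\<integral>y. cprob M Y B (Y y) * (1 - cprob M Y B (Y y)) \<partial>M)"
    by (simp add: power2_eq_square algebra_simps)
  finally show ?thesis .
qed

lemma cprob_contraction:
  assumes Y: "simple_function M Y" and A: "A \<in> sets M" and B: "B \<in> sets M"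
  shows "(\<integral>y. \<bar>cprob M Y A (Y y) - cprob M Y B (Y y)\<bar> \<partial>M) \<le> prob (sym_diff A B)"
proof -
  have "(\<integral>y. \<bar>cprob M Y A (Y y) - cprob M Y B (Y y)\<bar> \<partial>M) \<le> (\<integral>y. cprob M Y (sym_diff A B) (Y y) \<partial>M)"
  proof (rule integral_mono)
    fix y
    let ?c = "{z \<in> space M. Y z = Y y}"
    have c: "?c \<in> sets M" by (rule simple_function_cell[OF Y])
    have "prob (A \<inter> ?c) \<le> prob (B \<inter> ?c) + prob (sym_diff A B \<inter> ?c)"
      by (rule order_trans[OF finite_measure_mono measure_Un_le]) (use A B c in auto)
    moreover have "prob (B \<inter> ?c) \<le> prob (A \<inter> ?c) + prob (sym_diff A B \<inter> ?c)"
      by (rule order_trans[OF finite_measure_mono measure_Un_le]) (use A B c in auto)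
    ultimately have "\<bar>prob (A \<inter> ?c) - prob (B \<inter> ?c)\<bar> \<le> prob (sym_diff A B \<inter> ?c)" by linarith
    then show "\<bar>cprob M Y A (Y y) - cprob M Y B (Y y)\<bar> \<le> cprob M Y (sym_diff A B) (Y y)"
      unfolding cprob_def diff_divide_distrib[symmetric] abs_divide
      by (simp add: divide_right_mono)
  qed (auto intro!: integrable_simple_comp[OF Y, of "\<lambda>w. \<bar>cprob M Y A w - cprob M Y B w\<bar>"]
       integrable_simple_comp[OF Y, of "\<lambda>w. cprob M Y (sym_diff A B) w"])
  also have "\<dots> = prob (sym_diff A B)"
    using integral_cprob[OF Y, of "sym_diff A B" "\<lambda>_. 1"] A B by simp
  finally show ?thesis .
qed

text \<open>
  The chain rule in its integral form: the difference of two entropies is the mean of the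
  entropy of the conditional distribution of \<open>X\<close>.
\<close>

lemma cent_eq_integral:
  assumes X: "simple_function M X" and Y: "simple_function M Y"
  shows "cent M X Y = (\<Sum>v\<in>X ` space M. \<integral>y. eta (cprob M Y {z \<in> space M. X z = v} (Y y)) \<partial>M)"
proof -
  let ?p = "\<lambda>v w. prob ({z \<in> space M. X z = v} \<inter> {z \<in> space M. Y z = w})"
  let ?q = "\<lambda>w. prob {z \<in> space M. Y z = w}"
  have fX: "finite (X ` space M)" and fY: "finite (Y ` space M)"
    using X Y by (auto dest: simple_functionD)
  have cX: "{z \<in> space M. X z = v} \<in> sets M" and cY: "{z \<in> space M. Y z = w} \<in> sets M" for v w
    by (auto intro: simple_function_cell X Y)
  have "ent M (\<lambda>y. (X y, Y y)) = (\<Sum>(v, w)\<in>X ` space M \<times> Y ` space M. eta (?p v w))"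
    unfolding ent_def
  proof (rule sum.mono_neutral_cong_left)
    show "\<forall>i\<in>X ` space M \<times> Y ` space M - (\<lambda>y. (X y, Y y)) ` space M. (case i of (v, w) \<Rightarrow> eta (?p v w)) = 0"
    proof safe
      fix a b assume "(X a, Y b) \<notin> (\<lambda>y. (X y, Y y)) ` space M"
      then have "{z \<in> space M. X z = X a} \<inter> {z \<in> space M. Y z = Y b} = {}" by (auto simp: image_iff)
      then show "eta (?p (X a) (Y b)) = 0" by simp
    qed
  qed (use fX fY in \<open>auto intro!: arg_cong[where f=eta] arg_cong[where f=prob]\<close>)
  also have "\<dots> = (\<Sum>w\<in>Y ` space M. \<Sum>v\<in>X ` space M. eta (?p v w))"
    by (subst sum.swap) (simp add: sum.cartesian_product)
  finally have 1: "ent M (\<lambda>y. (X y, Y y)) = \<dots>" .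
  have sum_p: "(\<Sum>v\<in>X ` space M. ?p v w) = ?q w" for w
  proof -
    have "(\<Sum>v\<in>X ` space M. ?p v w) = prob (\<Union>v\<in>X ` space M. {z \<in> space M. X z = v} \<inter> {z \<in> space M. Y z = w})"
      using fX cX cY by (intro finite_measure_finite_Union[symmetric]) (auto simp: disjoint_family_on_def)
    also have "(\<Union>v\<in>X ` space M. {z \<in> space M. X z = v} \<inter> {z \<in> space M. Y z = w}) = {z \<in> space M. Y z = w}"
      by auto
    finally show ?thesis .
  qed
  have one: "(\<Sum>v\<in>X ` space M. eta (cprob M Y {z \<in> space M. X z = v} w) * ?q w) =
     (\<Sum>v\<in>X ` space M. eta (?p v w)) - eta (?q w)" for w
  proof (cases "?q w = 0")
    case True
    have "?p v w = 0" for v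
      using cprob_mult[OF Y, of "{z \<in> space M. X z = v}" w] True by simp
    with True show ?thesis by simp
  next
    case False
    then have q: "?q w > 0" by (simp add: zero_less_measure_iff)
    have "eta (cprob M Y {z \<in> space M. X z = v} w) * ?q w = eta (?p v w) + ?p v w * ln (?q w)" for v
    proof (cases "?p v w = 0")
      case False
      then have "?p v w > 0" by (simp add: zero_less_measure_iff)
      with q show ?thesis by (simp add: cprob_def eta_def ln_div field_simps)
    qed (simp add: cprob_def)
    then show ?thesis
      by (simp add: sum.distrib sum_distrib_right[symmetric] sum_p) (simp add: eta_def)
  qed
  have "(\<Sum>v\<in>X ` space M. \<integral>y. eta (cprob M Y {z \<in> space M. X z = v} (Y y)) \<partial>M) =
    (\<Sum>v\<in>X ` space M. \<Sum>w\<in>Y ` space M. eta (cprob M Y {z \<in> space M. X z = v} w) * ?q w)"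
    by (intro sum.cong refl integral_simple_comp[OF Y, of "\<lambda>w. eta (cprob M Y {z \<in> space M. X z = _} w)"])
  also have "\<dots> = (\<Sum>w\<in>Y ` space M. (\<Sum>v\<in>X ` space M. eta (?p v w)) - eta (?q w))"
    by (subst sum.swap) (simp add: one)
  also have "\<dots> = cent M X Y"
    unfolding cent_def 1 by (simp add: sum_subtractf ent_def)
  finally show ?thesis by simp
qed

lemma cent_nonneg:
  assumes X: "simple_function M X" and Y: "simple_function M Y"
  shows "0 \<le> cent M X Y"
  unfolding cent_eq_integral[OF assms]
  by (intro sum_nonneg Bochner_Integration.integral_nonneg eta_nonneg cprob_nonneg cprob_le_1 Y)

text \<open>
  Strong subadditivity with a remainder. Apply the tangent inequality at the coarser conditional
  probability \<open>s\<close>; its linear term is a function of \<open>Y'\<close> times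
  \<open>t - s\<close> and has mean zero by orthogonality, and only the quadratic term survives.
\<close>

lemma cent_gain:
  assumes X: "simple_function M X" and Y: "simple_function M Y" and Y': "simple_function M Y'"
    and co: "coarser M Y' Y"
  shows "(\<Sum>v\<in>X ` space M. \<integral>y. (cprob M Y {z \<in> space M. X z = v} (Y y)
      - cprob M Y' {z \<in> space M. X z = v} (Y' y))\<^sup>2 \<partial>M) / 4 \<le> cent M X Y' - cent M X Y"
proof -
  have "(\<integral>y. (cprob M Y B (Y y) - cprob M Y' B (Y' y))\<^sup>2 \<partial>M) / 4 \<le>
    (\<integral>y. eta (cprob M Y' B (Y' y)) \<partial>M) - (\<integral>y. eta (cprob M Y B (Y y)) \<partial>M)" if B: "B \<in> sets M" for B
  proof -
    let ?t = "\<lambda>y. cprob M Y B (Y y)" and ?s = "\<lambda>y. cprob M Y' B (Y' y)"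
    have iY: "integrable M (\<lambda>y. \<phi> (Y y))" for \<phi> :: "_ \<Rightarrow> real"
      by (rule integrable_simple_comp[OF Y])
    have iY': "integrable M (\<lambda>y. \<phi> (Y' y))" for \<phi> :: "_ \<Rightarrow> real"
      by (rule integrable_simple_comp[OF Y'])
    have i2: "integrable M (\<lambda>y. \<phi> (Y y) (Y' y))" for \<phi> :: "_ \<Rightarrow> _ \<Rightarrow> real"
      by (rule integrable_simple_comp2[OF Y Y'])
    have i: "integrable M (\<lambda>y. (?t y - ?s y)\<^sup>2 / 4)" "integrable M (\<lambda>y. (ln (?s y) + 1) * (?t y - ?s y))"
      "integrable M (\<lambda>y. eta (?t y))" "integrable M (\<lambda>y. eta (?s y))"
      by (rule i2[of "\<lambda>v w. (cprob M Y B v - cprob M Y' B w)\<^sup>2 / 4"]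
        i2[of "\<lambda>v w. (ln (cprob M Y' B w) + 1) * (cprob M Y B v - cprob M Y' B w)"]
        iY[of "\<lambda>v. eta (cprob M Y B v)"] iY'[of "\<lambda>v. eta (cprob M Y' B v)"])+
    \<comment> \<open>At \<open>s = 0\<close> there is no tangent, but then also \<open>t = 0\<close>: refining a cell cannot create mass.\<close>
    have pw: "(?t y - ?s y)\<^sup>2 / 4 \<le> eta (?s y) - eta (?t y) - (ln (?s y) + 1) * (?t y - ?s y)" if y: "y \<in> space M" for y
    proof (cases "?s y = 0")
      case True
      then have "prob (B \<inter> {z \<in> space M. Y' z = Y' y}) = 0"
        using cprob_mult[OF Y', of B "Y' y"] by simp
      moreover have "prob (B \<inter> {z \<in> space M. Y z = Y y}) \<le> prob (B \<inter> {z \<in> space M. Y' z = Y' y})"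
      proof (intro finite_measure_mono sets.Int B simple_function_cell[OF Y'])
        have "Y' z = Y' y" if "z \<in> space M" "Y z = Y y" for z
          using co that y unfolding coarser_def by blast
        then show "B \<inter> {z \<in> space M. Y z = Y y} \<subseteq> B \<inter> {z \<in> space M. Y' z = Y' y}" by blast
      qed
      ultimately have "prob (B \<inter> {z \<in> space M. Y z = Y y}) = 0"
        using measure_nonneg[of M "B \<inter> {z \<in> space M. Y z = Y y}"] by linarith
      then have "?t y = 0" by (simp add: cprob_def)
      with True show ?thesis by simp
    next
      case False
      with cprob_nonneg[of Y' B "Y' y"] have "?s y > 0" by linarith
      have "eta (?t y) \<le> eta (?s y) - (ln (?s y) + 1) * (?t y - ?s y) - (?t y - ?s y)\<^sup>2 / 4"
        by (rule eta_tangent[OF \<open>?s y > 0\<close> cprob_le_1[OF Y'] cprob_nonneg cprob_le_1[OF Y]])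
      then show ?thesis by linarith
    qed
    have zero: "(\<integral>y. (ln (?s y) + 1) * (?t y - ?s y) \<partial>M) = 0"
    proof -
      have "(\<integral>y. (ln (?s y) + 1) * (?t y - ?s y) \<partial>M) =
        (\<integral>y. ?t y * (ln (?s y) + 1) - ?s y * (ln (?s y) + 1) \<partial>M)"
        by (intro Bochner_Integration.integral_cong refl) (simp add: algebra_simps)
      also have "\<dots> = (\<integral>y. ?t y * (ln (?s y) + 1) \<partial>M) - (\<integral>y. ?s y * (ln (?s y) + 1) \<partial>M)"
        by (intro Bochner_Integration.integral_diff
            i2[of "\<lambda>v w. cprob M Y B v * (ln (cprob M Y' B w) + 1)"]
            iY'[of "\<lambda>w. cprob M Y' B w * (ln (cprob M Y' B w) + 1)"])
      finally have "(\<integral>y. (ln (?s y) + 1) * (?t y - ?s y) \<partial>M) = \<dots>" .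
      then show ?thesis
        using integral_cprob_coarser[OF Y Y' B co, of "\<lambda>w. ln (cprob M Y' B w) + 1"] by simp
    qed
    have "(\<integral>y. (?t y - ?s y)\<^sup>2 / 4 \<partial>M) \<le>
      (\<integral>y. eta (?s y) - eta (?t y) - (ln (?s y) + 1) * (?t y - ?s y) \<partial>M)"
      by (intro integral_mono pw i Bochner_Integration.integrable_diff)
    also have "\<dots> = (\<integral>y. eta (?s y) \<partial>M) - (\<integral>y. eta (?t y) \<partial>M) - (\<integral>y. (ln (?s y) + 1) * (?t y - ?s y) \<partial>M)"
      by (subst Bochner_Integration.integral_diff, (intro i Bochner_Integration.integrable_diff)+)+ (rule refl)
    finally show ?thesis using zero by simp
  qed
  note gain = this
  show ?thesis
    unfolding cent_eq_integral[OF X Y] cent_eq_integral[OF X Y'] sum_subtractf[symmetric] sum_divide_distrib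
    by (intro sum_mono gain simple_function_cell X)
qed

lemma cent_mono_right:
  assumes "simple_function M X" "simple_function M Y" "simple_function M Y'" "coarser M Y' Y"
  shows "cent M X Y \<le> cent M X Y'"
proof -
  have "0 \<le> (\<Sum>v\<in>X ` space M. \<integral>y. (cprob M Y {z \<in> space M. X z = v} (Y y)
      - cprob M Y' {z \<in> space M. X z = v} (Y' y))\<^sup>2 \<partial>M) / 4"
    by (intro divide_nonneg_nonneg sum_nonneg) auto
  with cent_gain[OF assms] show ?thesis by linarith
qed

end

lemma ent_cong:
  assumes "coarser M X Y" "coarser M Y X"
  shows "ent M X = ent M Y"
proof -
  obtain f where f: "\<And>y. y \<in> space M \<Longrightarrow> X y = f (Y y)" using coarser_factor[OF assms(1)] by blast
  obtain g where g: "\<And>y. y \<in> space M \<Longrightarrow> Y y = g (X y)" using coarser_factor[OF assms(2)] by blast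
  show ?thesis unfolding ent_def
  proof (rule sum.reindex_bij_witness[where i=f and j=g])
    fix a assume "a \<in> X ` space M"
    then obtain x where x: "x \<in> space M" "a = X x" by blast
    have "{y \<in> space M. Y y = g a} = {y \<in> space M. X y = a}"
    proof (intro Collect_cong conj_cong refl)
      fix y assume y: "y \<in> space M"
      have "Y x = g a" using g[OF x(1)] x(2) by simp
      then show "(Y y = g a) = (X y = a)"
        using f[OF y] f[OF x(1)] g[OF y] x(2) by metis
    qed
    then show "eta (measure M {y \<in> space M. Y y = g a}) = eta (measure M {y \<in> space M. X y = a})"
      by simp
  next
    fix a assume "a \<in> X ` space M"
    then obtain x where x: "x \<in> space M" "a = X x" by blast
    show "f (g a) = a" unfolding x(2) using f[OF x(1)] g[OF x(1)] by simp
    show "g a \<in> Y ` space M" unfolding x(2) g[OF x(1), symmetric] using x(1) by (rule imageI)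
  next
    fix b assume "b \<in> Y ` space M"
    then obtain x where x: "x \<in> space M" "b = Y x" by blast
    show "g (f b) = b" unfolding x(2) using f[OF x(1)] g[OF x(1)] by simp
    show "f b \<in> X ` space M" unfolding x(2) f[OF x(1), symmetric] using x(1) by (rule imageI)
  qed
qed

lemma cent_cong:
  assumes "coarser M (\<lambda>y. (X y, Y y)) (\<lambda>y. (X' y, Y' y))" "coarser M (\<lambda>y. (X' y, Y' y)) (\<lambda>y. (X y, Y y))"
    "coarser M Y Y'" "coarser M Y' Y"
  shows "cent M X Y = cent M X' Y'"
  unfolding cent_def using ent_cong[OF assms(1,2)] ent_cong[OF assms(3,4)] by simp

lemma ent_eq_sum:
  assumes "finite S" "X ` space M \<subseteq> S"
  shows "ent M X = (\<Sum>v\<in>S. eta (measure M {y \<in> space M. X y = v}))"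
  unfolding ent_def
proof (rule sum.mono_neutral_left[OF assms])
  show "\<forall>i\<in>S - X ` space M. eta (measure M {y \<in> space M. X y = i}) = 0"
  proof
    fix i assume "i \<in> S - X ` space M"
    then have "{y \<in> space M. X y = i} = {}" by auto
    then show "eta (measure M {y \<in> space M. X y = i}) = 0" by (simp only: measure_empty eta_0)
  qed
qed

lemma simple_function_mem: "A \<in> sets M \<Longrightarrow> simple_function M (\<lambda>y. y \<in> A)"
  unfolding simple_function_def
proof safe
  assume A: "A \<in> sets M"
  show "finite ((\<lambda>y. y \<in> A) ` space M)" by (rule finite_subset[of _ "{True, False}"]) auto
  fix y
  have "(\<lambda>y. y \<in> A) -` {b} \<inter> space M = (if b then A else space M - A)" for b
    using sets.sets_into_space[OF A] by auto
  then show "(\<lambda>y. y \<in> A) -` {y \<in> A} \<inter> space M \<in> sets M" using A by auto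
qed

context prob_space begin

lemma ent_mono:
  assumes "simple_function M X" "simple_function M Y" "coarser M X Y"
  shows "ent M X \<le> ent M Y"
proof -
  have "ent M (\<lambda>y. (Y y, X y)) = ent M Y"
    by (rule ent_cong) (use assms(3) in \<open>auto intro: coarser_intros\<close>)
  with cent_nonneg[OF assms(2,1)] show ?thesis by (simp add: cent_def)
qed

lemma cent_mono_left:
  assumes "simple_function M X" "simple_function M X'" "simple_function M Y" "coarser M X (\<lambda>y. (X' y, Y y))"
  shows "cent M X Y \<le> cent M X' Y"
proof -
  have "ent M (\<lambda>y. (X y, Y y)) \<le> ent M (\<lambda>y. (X' y, Y y))"
    by (intro ent_mono simple_function_Pair assms(1-3)) (use assms(4) in \<open>auto intro: coarser_intros\<close>)
  then show ?thesis by (simp add: cent_def)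
qed

lemma cent_le_ent:
  assumes X: "simple_function M X" and Y: "simple_function M Y"
  shows "cent M X Y \<le> ent M X"
proof -
  have "cent M X Y \<le> cent M X (\<lambda>_. ())"
    by (rule cent_mono_right[OF X Y]) (auto simp: coarser_def)
  also have "\<dots> = ent M X"
  proof -
    have "ent M (\<lambda>_. ()) = 0"
      by (subst ent_eq_sum[of "{()}"]) (auto simp: prob_space)
    moreover have "ent M (\<lambda>y. (X y, ())) = ent M X" by (rule ent_cong) (auto simp: coarser_def)
    ultimately show ?thesis by (simp add: cent_def)
  qed
  finally show ?thesis .
qed

lemma ent_Pair_le:
  "simple_function M X \<Longrightarrow> simple_function M Y \<Longrightarrow> ent M (\<lambda>y. (X y, Y y)) \<le> ent M X + ent M Y"
  using cent_le_ent[of X Y] by (simp add: cent_def)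

lemma cent_Pair: "cent M (\<lambda>y. (X y, W y)) Y = cent M W Y + cent M X (\<lambda>y. (W y, Y y))"
  unfolding cent_def
  using ent_cong[of M "\<lambda>y. ((X y, W y), Y y)" "\<lambda>y. (X y, (W y, Y y))"] by (simp add: coarser_def)

lemma cent_Pair_le:
  assumes "simple_function M X" "simple_function M W" "simple_function M Y"
  shows "cent M (\<lambda>y. (X y, W y)) Y \<le> cent M X Y + cent M W Y"
proof -
  have "cent M X (\<lambda>y. (W y, Y y)) \<le> cent M X Y"
    by (rule cent_mono_right) (use assms in \<open>auto intro: coarser_intros\<close>)
  then show ?thesis unfolding cent_Pair by simp
qed

lemma ent_mem:
  assumes A: "A \<in> sets M"
  shows "ent M (\<lambda>y. y \<in> A) = eta (prob A) + eta (1 - prob A)"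
proof -
  have e: "{y \<in> space M. (y \<in> A) = True} = A" "{y \<in> space M. (y \<in> A) = False} = space M - A"
    using sets.sets_into_space[OF A] by auto
  have "ent M (\<lambda>y. y \<in> A) = (\<Sum>v\<in>{True, False}. eta (prob {y \<in> space M. (y \<in> A) = v}))"
    by (rule ent_eq_sum) auto
  also have "\<dots> = eta (prob {y \<in> space M. (y \<in> A) = True}) + eta (prob {y \<in> space M. (y \<in> A) = False})"
    by (simp del: eq_True eq_False)
  finally show ?thesis unfolding e by (simp add: prob_compl[OF A])
qed

lemma coarser_mem_sym_diff:
  "coarser M (\<lambda>y. y \<in> B) Y \<Longrightarrow> coarser M (\<lambda>y. y \<in> A) (\<lambda>y. (y \<in> sym_diff A B, Y y))"
  unfolding coarser_def by blast

text \<open>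
  Given \<open>B\<close>, knowing \<open>A\<close> amounts to knowing \<open>sym_diff A
  B\<close>, whose entropy is a function of its probability alone.
\<close>

lemma cent_mem_le_sym_diff:
  assumes A: "A \<in> sets M" and B: "B \<in> sets M" and Y: "simple_function M Y"
    and co: "coarser M (\<lambda>y. y \<in> B) Y"
  shows "cent M (\<lambda>y. y \<in> A) Y \<le> eta (prob (sym_diff A B)) + eta (1 - prob (sym_diff A B))"
proof -
  have "cent M (\<lambda>y. y \<in> A) Y \<le> cent M (\<lambda>y. y \<in> sym_diff A B) Y"
    by (rule cent_mono_left)
      (use A B Y coarser_mem_sym_diff[OF co] in \<open>auto intro!: simple_function_mem simp del: Un_iff Diff_iff\<close>)
  also have "\<dots> \<le> ent M (\<lambda>y. y \<in> sym_diff A B)"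
    by (intro cent_le_ent simple_function_mem Y) (use A B in auto)
  also have "\<dots> = eta (prob (sym_diff A B)) + eta (1 - prob (sym_diff A B))"
    by (rule ent_mem) (use A B in auto)
  finally show ?thesis .
qed

text \<open>
  Since \<open>t (1 - t) \<le> eta t\<close>, small conditional entropy of \<open>A\<close>
  makes the indicator of \<open>A\<close> nearly a function of \<open>Y\<close>.
\<close>

lemma cent_mem_ge_residual:
  assumes A: "A \<in> sets M" and Y: "simple_function M Y"
  shows "(\<integral>y. (indicator A y - cprob M Y A (Y y))\<^sup>2 \<partial>M) \<le> cent M (\<lambda>y. y \<in> A) Y"
proof (cases "A = {}")
  case True
  then show ?thesis
    using cent_nonneg[OF simple_function_mem[OF A] Y] by (simp add: cprob_def)
next
  case False
  let ?X = "\<lambda>y. y \<in> A"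
  let ?I = "\<lambda>v. \<integral>y. eta (cprob M Y {z \<in> space M. (z \<in> A) = v} (Y y)) \<partial>M"
  have e: "{y \<in> space M. (y \<in> A) = True} = A"
    using sets.sets_into_space[OF A] by auto
  have "True \<in> ?X ` space M" using False sets.sets_into_space[OF A] by auto
  moreover have "0 \<le> ?I v" for v
    by (intro Bochner_Integration.integral_nonneg eta_nonneg cprob_nonneg cprob_le_1 Y)
  ultimately have "?I True \<le> (\<Sum>v\<in>?X ` space M. ?I v)"
    by (intro member_le_sum simple_functionD(1)[OF simple_function_mem[OF A]])
  then have "(\<integral>y. eta (cprob M Y A (Y y)) \<partial>M) \<le> cent M ?X Y"
    unfolding cent_eq_integral[OF simple_function_mem[OF A] Y] e .
  moreover have "(\<integral>y. (indicator A y - cprob M Y A (Y y))\<^sup>2 \<partial>M) \<le> (\<integral>y. eta (cprob M Y A (Y y)) \<partial>M)"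
    unfolding cprob_residual[OF Y A]
    by (intro integral_mono eta_ge cprob_nonneg integrable_simple_comp[OF Y, of "\<lambda>w. eta (cprob M Y A w)"]
       integrable_simple_comp[OF Y, of "\<lambda>w. cprob M Y A w * (1 - cprob M Y A w)"])
  ultimately show ?thesis by linarith
qed

lemma cent_mem_gain:
  assumes A: "A \<in> sets M" and Y: "simple_function M Y" and Y': "simple_function M Y'"
    and co: "coarser M Y' Y"
  shows "(\<integral>y. (cprob M Y A (Y y) - cprob M Y' A (Y' y))\<^sup>2 \<partial>M)
    \<le> 4 * (cent M (\<lambda>y. y \<in> A) Y' - cent M (\<lambda>y. y \<in> A) Y)"
proof (cases "A = {}")
  case True
  then show ?thesis
    using cent_mono_right[OF simple_function_mem[OF A] Y Y' co] by (simp add: cprob_def)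
next
  case False
  let ?X = "\<lambda>y. y \<in> A"
  let ?I = "\<lambda>v. \<integral>y. (cprob M Y {z \<in> space M. (z \<in> A) = v} (Y y) - cprob M Y' {z \<in> space M. (z \<in> A) = v} (Y' y))\<^sup>2 \<partial>M"
  have e: "{y \<in> space M. (y \<in> A) = True} = A"
    using sets.sets_into_space[OF A] by auto
  have "True \<in> ?X ` space M" using False sets.sets_into_space[OF A] by auto
  then have "?I True \<le> (\<Sum>v\<in>?X ` space M. ?I v)"
    by (intro member_le_sum) (use simple_functionD(1)[OF simple_function_mem[OF A]] in auto)
  then have "?I True / 4 \<le> (\<Sum>v\<in>?X ` space M. ?I v) / 4"
    by (rule divide_right_mono) simp
  also note cent_gain[OF simple_function_mem[OF A] Y Y' co]
  finally show ?thesis unfolding e by simp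
qed

end

section \<open>Sets approximable by an algebra\<close>

text \<open>
  The closure of \<open>\<A>\<close> in the measure algebra, i.e. the sigma-algebra generated by
  \<open>\<A>\<close>, completed by the null sets, when \<open>\<A>\<close> is an algebra.
\<close>

definition approximable :: "'a measure \<Rightarrow> 'a set set \<Rightarrow> 'a set set" where
  "approximable M \<A> = {A \<in> sets M. \<forall>\<epsilon>>0. \<exists>B\<in>\<A>. measure M (sym_diff A B) < \<epsilon>}"

text \<open>
  A countable union is approximated by a finite subunion, and the latter member by member.
\<close>

lemma (in prob_space) sigma_algebra_approximable:
  assumes alg: "algebra (space M) \<A>" and sub: "\<A> \<subseteq> sets M"
  shows "sigma_algebra (space M) (approximable M \<A>)"
proof -
  interpret algebra "space M" \<A> by fact
  have UN: "(\<Union>i. A i) \<in> approximable M \<A>" if A: "range A \<subseteq> approximable M \<A>" for A :: "nat \<Rightarrow> 'a set"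
    unfolding approximable_def
  proof (safe)
    have Am: "A i \<in> sets M" for i using A by (auto simp: approximable_def)
    then show "(\<Union>i. A i) \<in> sets M" by auto
    fix \<epsilon> :: real assume "0 < \<epsilon>"
    have "(\<lambda>n. prob (\<Union>i\<le>n. A i)) \<longlonglongrightarrow> prob (\<Union>n. \<Union>i\<le>n. A i)"
      using Am by (intro finite_Lim_measure_incseq) (auto simp: incseq_def intro: order.trans)
    moreover have "(\<Union>n. \<Union>i\<le>n. A i) = (\<Union>i. A i)" by auto
    ultimately have "\<forall>\<^sub>F n in sequentially. \<bar>prob (\<Union>i\<le>n. A i) - prob (\<Union>i. A i)\<bar> < \<epsilon> / 2"
      using \<open>0 < \<epsilon>\<close> unfolding tendsto_iff dist_real_def by (metis half_gt_zero)
    then obtain n where n: "\<bar>prob (\<Union>i\<le>n. A i) - prob (\<Union>i. A i)\<bar> < \<epsilon> / 2"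
      by (auto simp: eventually_sequentially)
    have "\<exists>B\<in>\<A>. prob (sym_diff (A i) B) < \<epsilon> / (2 * real (Suc n))" for i
    proof -
      have "A i \<in> approximable M \<A>" "0 < \<epsilon> / (2 * real (Suc n))" using A \<open>0 < \<epsilon>\<close> by auto
      then show ?thesis unfolding approximable_def by blast
    qed
    then obtain B where B: "\<And>i. B i \<in> \<A>" "\<And>i. prob (sym_diff (A i) (B i)) < \<epsilon> / (2 * real (Suc n))"
      by metis
    have Bm: "B i \<in> sets M" for i using B(1) sub by auto
    have UB: "(\<Union>i\<le>n. B i) \<in> \<A>" using B(1) by (intro finite_UN) auto
    have "prob (sym_diff (\<Union>i. A i) (\<Union>i\<le>n. B i)) \<le>
      prob (((\<Union>i. A i) - (\<Union>i\<le>n. A i)) \<union> (\<Union>i\<le>n. sym_diff (A i) (B i)))"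
      using Am Bm by (intro finite_measure_mono) auto
    also have "\<dots> \<le> prob ((\<Union>i. A i) - (\<Union>i\<le>n. A i)) + prob (\<Union>i\<le>n. sym_diff (A i) (B i))"
      using Am Bm by (intro measure_Un_le) auto
    also have "prob ((\<Union>i. A i) - (\<Union>i\<le>n. A i)) = prob (\<Union>i. A i) - prob (\<Union>i\<le>n. A i)"
      using Am by (intro finite_measure_Diff) auto
    also have "prob (\<Union>i\<le>n. sym_diff (A i) (B i)) \<le> (\<Sum>i\<le>n. prob (sym_diff (A i) (B i)))"
      using Am Bm by (intro finite_measure_subadditive_finite) auto
    also have "\<dots> \<le> (\<Sum>i\<le>n. \<epsilon> / (2 * real (Suc n)))"
      using B(2) by (intro sum_mono less_imp_le)
    also have "\<dots> = \<epsilon> / 2" by (simp add: field_simps)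
    finally have "prob (sym_diff (\<Union>i. A i) (\<Union>i\<le>n. B i)) < \<epsilon>"
      using n by linarith
    with UB show "\<exists>B\<in>\<A>. prob (sym_diff (\<Union>i. A i) B) < \<epsilon>" by blast
  qed
  have Un: "A \<union> B \<in> approximable M \<A>" if AB: "A \<in> approximable M \<A>" "B \<in> approximable M \<A>" for A B
  proof -
    have "(\<Union>i::nat. if i = 0 then A else B) = A \<union> B" by (auto split: if_splits)
    with UN[of "\<lambda>i. if i = 0 then A else B"] AB show ?thesis by auto
  qed
  show ?thesis
  proof (rule sigma_algebra_iff2[THEN iffD2], intro conjI ballI allI impI)
    show "approximable M \<A> \<subseteq> Pow (space M)"
      using sets.sets_into_space by (auto simp: approximable_def)
    show "{} \<in> approximable M \<A>" by (auto simp: approximable_def intro!: bexI[of _ "{}"])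
    fix A assume A: "A \<in> approximable M \<A>"
    show "space M - A \<in> approximable M \<A>" unfolding approximable_def
    proof safe
      show "space M - A \<in> sets M" using A by (auto simp: approximable_def)
      fix \<epsilon> :: real assume "0 < \<epsilon>"
      then obtain B where B: "B \<in> \<A>" "prob (sym_diff A B) < \<epsilon>" using A unfolding approximable_def by blast
      have "sym_diff (space M - A) (space M - B) = sym_diff A B"
        using A B(1) sub sets.sets_into_space[of _ M] unfolding approximable_def by blast
      with B show "\<exists>B\<in>\<A>. prob (sym_diff (space M - A) B) < \<epsilon>"
        by (intro bexI[of _ "space M - B"]) auto
    qed
  qed (use UN in auto)
qed

text \<open>
  The upper limit of a sequence of approximations with summable errors is an exact one, by
  Borel--Cantelli.
\<close>

lemma (in prob_space) approximable_imp_eq_mod_null: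
  assumes C: "subalgebra M C" and A: "A \<in> sets M"
    and ap: "\<And>\<epsilon>. 0 < \<epsilon> \<Longrightarrow> \<exists>D\<in>sets C. prob (sym_diff A D) < \<epsilon>"
  shows "\<exists>D\<in>sets C. sym_diff A D \<in> null_sets M"
proof -
  have "\<exists>D\<in>sets C. prob (sym_diff A D) < (1/2) ^ j" for j :: nat by (rule ap) simp
  then obtain D where D: "\<And>j :: nat. D j \<in> sets C" "\<And>j. prob (sym_diff A (D j)) < (1/2) ^ j" by metis
  have DM: "D j \<in> sets M" for j using D(1) C unfolding subalgebra_def by blast
  define L where "L = (\<Inter>n. \<Union>j\<in>{n..}. D j)"
  have LC: "L \<in> sets C" unfolding L_def using D(1) by auto
  then have LM: "L \<in> sets M" using C unfolding subalgebra_def by blast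
  have "AE y in M. \<forall>\<^sub>F j in sequentially. y \<in> space M - sym_diff A (D j)"
  proof (rule borel_cantelli_AE1)
    show "summable (\<lambda>j. prob (sym_diff A (D j)))"
      by (rule summable_comparison_test'[of "\<lambda>j. (1/2) ^ j" 0]) (use D(2) in \<open>auto intro: less_imp_le\<close>)
  qed (use A DM in \<open>auto simp: less_top[symmetric]\<close>)
  then have "AE y in M. y \<notin> sym_diff A L"
  proof eventually_elim
    case (elim y)
    then obtain N where N: "\<And>j. j \<ge> N \<Longrightarrow> y \<in> A \<longleftrightarrow> y \<in> D j" by (auto simp: eventually_sequentially)
    have "y \<in> L \<longleftrightarrow> y \<in> A"
    proof
      assume "y \<in> L"
      then obtain j where "j \<ge> N" "y \<in> D j" unfolding L_def by blast
      then show "y \<in> A" using N by blast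
    next
      assume "y \<in> A"
      show "y \<in> L" unfolding L_def
      proof safe
        fix n
        have "y \<in> D (max n N)" using N[of "max n N"] \<open>y \<in> A\<close> by simp
        then show "y \<in> (\<Union>j\<in>{n..}. D j)" by (intro UN_I[of "max n N"]) auto
      qed
    qed
    then show ?case by blast
  qed
  then have "sym_diff A L \<in> null_sets M"
    using A LM by (subst AE_iff_null_sets) auto
  with LC show ?thesis by blast
qed

section \<open>The entropy rate of a stationary process\<close>

definition block :: "('a \<Rightarrow> 'a) \<Rightarrow> ('a \<Rightarrow> 'b) \<Rightarrow> nat \<Rightarrow> nat \<Rightarrow> 'a \<Rightarrow> 'b list" where
  "block T X n m y = map (\<lambda>i. X ((T ^^ i) y)) [n..<m]"

lemma block_eq_iff:
  "block T X n m y = block T X n m z \<longleftrightarrow> (\<forall>i. n \<le> i \<longrightarrow> i < m \<longrightarrow> X ((T ^^ i) y) = X ((T ^^ i) z))"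
  by (auto simp: block_def)

lemma coarser_block_iff:
  "coarser M (block T X n m) W \<longleftrightarrow> (\<forall>i. n \<le> i \<longrightarrow> i < m \<longrightarrow> coarser M (\<lambda>y. X ((T ^^ i) y)) W)"
  unfolding coarser_def block_eq_iff by blast

lemma coarser_block: "n \<le> i \<Longrightarrow> i < m \<Longrightarrow> coarser M (\<lambda>y. X ((T ^^ i) y)) (block T X n m)"
  unfolding coarser_def block_eq_iff by blast

lemma coarser_block_mono: "n' \<le> n \<Longrightarrow> m \<le> m' \<Longrightarrow> coarser M (block T X n m) (block T X n' m')"
  unfolding coarser_block_iff by (auto intro: coarser_block)

lemma block_shift: "block T X (n + i) (m + i) y = block T X n m ((T ^^ i) y)"
proof -
  have "[n + i..<m + i] = map (\<lambda>j. j + i) [n..<m]" by (induction m) auto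
  then show ?thesis by (simp add: block_def funpow_add)
qed

lemma block_empty [simp]: "m \<le> n \<Longrightarrow> block T X n m = (\<lambda>_. [])"
  by (simp add: block_def fun_eq_iff)

locale stationary = prob_space M for M :: "'a measure" +
  fixes T :: "'a \<Rightarrow> 'a"
  assumes T_meas: "T \<in> M \<rightarrow>\<^sub>M M" and T_inv: "distr M M T = M"
begin

lemma funpow_meas: "(T ^^ i) \<in> M \<rightarrow>\<^sub>M M"
proof (induction i)
  case (Suc i)
  then show ?case using measurable_comp[OF Suc T_meas] by (simp add: comp_def)
qed simp

lemma funpow_inv: "distr M M (T ^^ i) = M"
proof (induction i)
  case 0 then show ?case by (simp add: distr_id)
next
  case (Suc i)
  have "distr M M (T ^^ Suc i) = distr (distr M M (T ^^ i)) M T"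
    by (simp only: distr_distr[OF T_meas funpow_meas] funpow.simps)
  then show ?case by (simp only: Suc T_inv)
qed

lemma funpow_space: "y \<in> space M \<Longrightarrow> (T ^^ i) y \<in> space M"
  using measurable_space[OF funpow_meas] .

lemma measure_funpow_vimage:
  "A \<in> sets M \<Longrightarrow> measure M {y \<in> space M. (T ^^ i) y \<in> A} = measure M A"
  using measure_distr[OF funpow_meas, of A i] funpow_inv[of i]
  by (simp add: vimage_def Int_def conj_commute)

lemma simple_function_funpow:
  assumes "simple_function M X" shows "simple_function M (\<lambda>y. X ((T ^^ i) y))"
  unfolding simple_function_def
proof safe
  show "finite ((\<lambda>y. X ((T ^^ i) y)) ` space M)"
    by (rule finite_subset[OF _ simple_functionD(1)[OF assms]]) (auto simp: funpow_space)
  fix x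
  have "(\<lambda>y. X ((T ^^ i) y)) -` {X ((T ^^ i) x)} \<inter> space M =
    (T ^^ i) -` (X -` {X ((T ^^ i) x)} \<inter> space M) \<inter> space M" by (auto simp: funpow_space)
  then show "(\<lambda>y. X ((T ^^ i) y)) -` {X ((T ^^ i) x)} \<inter> space M \<in> sets M"
    using measurable_sets[OF funpow_meas simple_functionD(2)[OF assms]] by simp
qed

lemma simple_function_block [intro, simp]:
  assumes "simple_function M X" shows "simple_function M (block T X n m)"
proof -
  have "simple_function M (\<lambda>y. map (\<lambda>i. X ((T ^^ i) y)) is)" for "is"
  proof (induction "is")
    case (Cons i "is")
    from simple_function_compose2[OF simple_function_funpow[OF assms, of i] Cons, of "(#)"] show ?case by simp
  qed simp
  then show ?thesis unfolding block_def .
qed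

lemma ent_funpow:
  assumes X: "simple_function M X" shows "ent M (\<lambda>y. X ((T ^^ i) y)) = ent M X"
proof -
  have "ent M (\<lambda>y. X ((T ^^ i) y)) = (\<Sum>v\<in>X ` space M. eta (prob {y \<in> space M. X ((T ^^ i) y) = v}))"
    by (rule ent_eq_sum) (use X in \<open>auto simp: funpow_space simple_functionD\<close>)
  also have "\<dots> = ent M X" unfolding ent_def
  proof (intro sum.cong refl arg_cong[where f=eta])
    fix v
    have "{y \<in> space M. X ((T ^^ i) y) = v} = {y \<in> space M. (T ^^ i) y \<in> {z \<in> space M. X z = v}}"
      by (auto simp: funpow_space)
    then show "prob {y \<in> space M. X ((T ^^ i) y) = v} = prob {z \<in> space M. X z = v}"
      by (simp only: measure_funpow_vimage[OF simple_function_cell[OF X]])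
  qed
  finally show ?thesis .
qed

lemma cent_funpow:
  assumes X: "simple_function M X" and Y: "simple_function M Y"
  shows "cent M (\<lambda>y. X ((T ^^ i) y)) (\<lambda>y. Y ((T ^^ i) y)) = cent M X Y"
  unfolding cent_def
  using ent_funpow[OF Y, of i] ent_funpow[OF simple_function_Pair[OF X Y], of i] by simp

lemma ent_block_shift:
  "simple_function M X \<Longrightarrow> ent M (block T X (n + i) (m + i)) = ent M (block T X n m)"
  unfolding block_shift using ent_funpow[of "block T X n m" i] by simp

lemma ent_Nil [simp]: "ent M (\<lambda>_. []) = 0"
  by (subst ent_eq_sum[of "{[]}"]) (auto simp: prob_space)

text \<open>
  Conditional entropies of initial blocks reduce to increments of the single sequence \<open>m
  \<mapsto> ent M (block T X 0 m)\<close>, because the law of a block depends only on its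
  length.
\<close>

lemma cent_block_split:
  assumes X: "simple_function M X"
  shows "cent M (block T X 0 n) (block T X n (m + n)) = ent M (block T X 0 (m + n)) - ent M (block T X 0 m)"
proof -
  have "ent M (\<lambda>y. (block T X 0 n y, block T X n (m + n) y)) = ent M (block T X 0 (m + n))"
  proof (rule ent_cong)
    show "coarser M (\<lambda>y. (block T X 0 n y, block T X n (m + n) y)) (block T X 0 (m + n))"
      by (auto intro: coarser_block_mono)
    show "coarser M (block T X 0 (m + n)) (\<lambda>y. (block T X 0 n y, block T X n (m + n) y))"
      unfolding coarser_block_iff
    proof safe
      fix i assume "i < m + n"
      then show "coarser M (\<lambda>y. X ((T ^^ i) y)) (\<lambda>y. (block T X 0 n y, block T X n (m + n) y))"
        by (cases "i < n") (auto intro!: coarser_block intro: coarser_PairI1 coarser_PairI2)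
    qed
  qed
  moreover have "ent M (block T X n (m + n)) = ent M (block T X 0 m)"
    using ent_block_shift[OF X, of 0 n m] by simp
  ultimately show ?thesis by (simp add: cent_def)
qed

lemma cent_block_le:
  assumes X: "simple_function M X" and W: "simple_function M W"
  shows "cent M (block T X n m) W \<le> (\<Sum>i\<in>{n..<m}. cent M (\<lambda>y. X ((T ^^ i) y)) W)"
proof (induction m)
  case 0
  have "cent M (\<lambda>_. ([]::'b list)) W = 0"
    unfolding cent_def by (subst ent_cong[of M "\<lambda>y. ([]::'b list, W y)" W]) (auto intro: coarser_intros)
  then show ?case by simp
next
  case (Suc m)
  show ?case
  proof (cases "n \<le> m")
    case True
    have "cent M (block T X n (Suc m)) W \<le> cent M (\<lambda>y. (block T X n m y, X ((T ^^ m) y))) W"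
    proof (intro cent_mono_left W simple_function_Pair simple_function_block simple_function_funpow X)
      show "coarser M (block T X n (Suc m)) (\<lambda>y. ((block T X n m y, X ((T ^^ m) y)), W y))"
        unfolding coarser_block_iff
      proof safe
        fix i assume "n \<le> i" "i < Suc m"
        then show "coarser M (\<lambda>y. X ((T ^^ i) y)) (\<lambda>y. ((block T X n m y, X ((T ^^ m) y)), W y))"
        proof (cases "i < m")
          case True
          then show ?thesis using \<open>n \<le> i\<close> by (intro coarser_PairI1 coarser_block)
        next
          case False
          with \<open>i < Suc m\<close> have "i = m" by simp
          show ?thesis unfolding \<open>i = m\<close> by (intro coarser_PairI1 coarser_PairI2 coarser_refl)
        qed
      qed
    qed
    also have "\<dots> \<le> cent M (block T X n m) W + cent M (\<lambda>y. X ((T ^^ m) y)) W"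
      by (intro cent_Pair_le W simple_function_block simple_function_funpow X)
    finally show ?thesis using Suc True by simp
  qed (use Suc in simp)
qed

text \<open>
  The increments of the block entropies decrease, so their infimum is their limit; it is the
  Kolmogorov--Sinai entropy of the partition into level sets of \<open>X\<close>
  (\<open>entropy_rate_tendsto\<close>).
\<close>

definition entropy_rate :: "('a \<Rightarrow> 'b) \<Rightarrow> real" where
  "entropy_rate X = (INF m. ent M (block T X 0 (Suc m)) - ent M (block T X 0 m))"

lemma
  assumes X: "simple_function M X"
  shows entropy_increment_tendsto:
      "(\<lambda>m. ent M (block T X 0 (m + n)) - ent M (block T X 0 m)) \<longlonglongrightarrow> real n * entropy_rate X"
    and entropy_increment_ge:
      "real n * entropy_rate X \<le> ent M (block T X 0 (m + n)) - ent M (block T X 0 m)"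
    and entropy_increment_decreasing:
      "m \<le> m' \<Longrightarrow> ent M (block T X 0 (Suc m')) - ent M (block T X 0 m') \<le>
        ent M (block T X 0 (Suc m)) - ent M (block T X 0 m)"
    and entropy_rate_nonneg: "0 \<le> entropy_rate X"
proof -
  let ?a = "\<lambda>m. ent M (block T X 0 m)"
  let ?d = "\<lambda>m. ?a (Suc m) - ?a m"
  have d: "?d m = cent M (block T X 0 1) (block T X 1 (Suc m))" for m
    using cent_block_split[OF X, of 1 m] by simp
  have dec: "?d m' \<le> ?d m" if "m \<le> m'" for m m'
    unfolding d using that by (intro cent_mono_right simple_function_block X coarser_block_mono) auto
  then show "m \<le> m' \<Longrightarrow> ?d m' \<le> ?d m" .
  have nonneg: "0 \<le> ?d m" for m
    unfolding d by (intro cent_nonneg simple_function_block X)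
  have bdd: "bdd_below (range ?d)" using nonneg by (intro bdd_belowI[of _ 0]) auto
  then have lim: "?d \<longlonglongrightarrow> entropy_rate X"
    unfolding entropy_rate_def using dec by (intro LIMSEQ_decseq_INF) (auto simp: decseq_def)
  have ge: "entropy_rate X \<le> ?d m" for m
    unfolding entropy_rate_def using bdd by (intro cINF_lower) auto
  show "0 \<le> entropy_rate X" unfolding entropy_rate_def by (intro cINF_greatest nonneg) auto
  have tel: "?a (m + n) - ?a m = (\<Sum>j<n. ?d (m + j))" for m n
    by (induction n) auto
  have "(\<lambda>m. \<Sum>j<n. ?d (m + j)) \<longlonglongrightarrow> (\<Sum>j<n. entropy_rate X)"
    by (intro tendsto_sum LIMSEQ_ignore_initial_segment[OF lim])
  then show "(\<lambda>m. ?a (m + n) - ?a m) \<longlonglongrightarrow> real n * entropy_rate X"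
    unfolding tel by simp
  have "(\<Sum>j<n. entropy_rate X) \<le> (\<Sum>j<n. ?d (m + j))" by (intro sum_mono ge)
  then show "real n * entropy_rate X \<le> ?a (m + n) - ?a m" unfolding tel by simp
qed

lemma entropy_rate_le:
  "simple_function M X \<Longrightarrow> entropy_rate X \<le> ent M (block T X 0 (Suc m)) - ent M (block T X 0 m)"
  using entropy_increment_ge[of X 1 m] by simp

text \<open>
  Averages of a decreasing sequence have the same limit: beyond \<open>N\<close> the block
  entropy grows at most linearly with slope the \<open>N\<close>-th increment.
\<close>

lemma entropy_rate_tendsto:
  assumes X: "simple_function M X"
  shows "(\<lambda>m. ent M (block T X 0 m) / real m) \<longlonglongrightarrow> entropy_rate X"
proof (rule LIMSEQ_I)
  let ?a = "\<lambda>m. ent M (block T X 0 m)"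
  fix r :: real assume "0 < r"
  have "(\<lambda>m. ?a (m + 1) - ?a m) \<longlonglongrightarrow> entropy_rate X"
    using entropy_increment_tendsto[OF X, of 1] by simp
  from LIMSEQ_D[OF this, of "r / 2"] \<open>0 < r\<close>
  obtain N where "\<bar>?a (N + 1) - ?a N - entropy_rate X\<bar> < r / 2" by auto
  then have N: "?a (Suc N) - ?a N < entropy_rate X + r / 2"
    unfolding Suc_eq_plus1 by linarith
  have up: "?a m \<le> ?a N + real m * (?a (Suc N) - ?a N)" if "N \<le> m" for m
    using that
  proof (induction m rule: dec_induct)
    case base
    have "0 \<le> ?a (Suc N) - ?a N" using entropy_rate_le[OF X, of N] entropy_rate_nonneg[OF X] by linarith
    then show ?case by simp
  next
    case (step m)
    then show ?case
      using entropy_increment_decreasing[OF X \<open>N \<le> m\<close>] by (simp add: algebra_simps)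
  qed
  have "(\<lambda>m. ?a N / real m) \<longlonglongrightarrow> 0" by (rule lim_const_over_n)
  from LIMSEQ_D[OF this, of "r / 2"] \<open>0 < r\<close>
  obtain K where K: "\<And>m. K \<le> m \<Longrightarrow> \<bar>?a N / real m\<bar> < r / 2" by auto
  show "\<exists>no. \<forall>n\<ge>no. norm (?a n / real n - entropy_rate X) < r"
  proof (intro exI allI impI)
    fix m assume m: "max (max K N) 1 \<le> m"
    have "?a m / real m \<le> (?a N + real m * (?a (Suc N) - ?a N)) / real m"
      using up[of m] m by (intro divide_right_mono) auto
    also have "\<dots> = ?a N / real m + (?a (Suc N) - ?a N)"
      using m by (simp add: field_simps)
    also have "\<dots> < r / 2 + (entropy_rate X + r / 2)" using K[of m] N m by linarith
    finally have "?a m / real m < entropy_rate X + r" by simp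
    moreover have "entropy_rate X \<le> ?a m / real m"
      using entropy_increment_ge[OF X, of m 0] m by (simp add: pos_le_divide_eq mult.commute)
    ultimately show "norm (?a m / real m - entropy_rate X) < r" by simp
  qed
qed

lemma entropy_rate_mono:
  assumes X: "simple_function M X" and Y: "simple_function M Y" and co: "coarser M X Y"
  shows "entropy_rate X \<le> entropy_rate Y"
proof (rule LIMSEQ_le[OF entropy_rate_tendsto[OF X] entropy_rate_tendsto[OF Y]], intro exI allI impI)
  fix m
  have "coarser M (\<lambda>y. X ((T ^^ i) y)) (\<lambda>y. Y ((T ^^ i) y))" for i
    using co unfolding coarser_def by (auto simp: funpow_space)
  then have "coarser M (block T X 0 m) (block T Y 0 m)"
    unfolding coarser_block_iff by (blast intro: coarser_trans coarser_block)
  then show "ent M (block T X 0 m) / real m \<le> ent M (block T Y 0 m) / real m"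
    by (intro divide_right_mono ent_mono simple_function_block X Y) auto
qed

lemma coarser_block_Pair1: "coarser M (block T X n m) (block T (\<lambda>y. (X y, Y y)) n m)"
  and coarser_block_Pair2: "coarser M (block T Y n m) (block T (\<lambda>y. (X y, Y y)) n m)"
  unfolding coarser_def block_eq_iff by auto

lemma coarser_block_Pair: "coarser M (block T (\<lambda>y. (X y, Y y)) n m) (\<lambda>y. (block T X n m y, block T Y n m y))"
  by (auto simp: coarser_def block_eq_iff)

lemma entropy_rate_Pair_le:
  assumes X: "simple_function M X" and Y: "simple_function M Y"
  shows "entropy_rate (\<lambda>y. (X y, Y y)) \<le> entropy_rate X + entropy_rate Y"
proof (rule LIMSEQ_le[OF entropy_rate_tendsto[OF simple_function_Pair[OF X Y]]
      tendsto_add[OF entropy_rate_tendsto[OF X] entropy_rate_tendsto[OF Y]]], intro exI allI impI)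
  fix m
  have "ent M (block T (\<lambda>y. (X y, Y y)) 0 m) \<le> ent M (\<lambda>y. (block T X 0 m y, block T Y 0 m y))"
    by (intro ent_mono simple_function_block simple_function_Pair X Y coarser_block_Pair)
  also have "\<dots> \<le> ent M (block T X 0 m) + ent M (block T Y 0 m)"
    by (intro ent_Pair_le simple_function_block X Y)
  finally show "ent M (block T (\<lambda>y. (X y, Y y)) 0 m) / real m \<le>
      ent M (block T X 0 m) / real m + ent M (block T Y 0 m) / real m"
    by (simp add: add_divide_distrib[symmetric] divide_right_mono)
qed

text \<open>
  Continuity of the entropy rate in the partition: each of the \<open>m\<close> coordinates of
  the process \<open>X\<close> costs at most \<open>cent M X Y\<close> once the process
  \<open>Y\<close> is known.
\<close>

lemma entropy_rate_le_cent:
  assumes X: "simple_function M X" and Y: "simple_function M Y"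
  shows "entropy_rate X \<le> entropy_rate Y + cent M X Y"
proof (rule LIMSEQ_le[OF entropy_rate_tendsto[OF X]
      tendsto_add[OF entropy_rate_tendsto[OF Y] tendsto_const]], intro exI allI impI)
  fix m :: nat assume m: "1 \<le> m"
  let ?bX = "block T X 0 m" and ?bY = "block T Y 0 m"
  have "ent M ?bX \<le> ent M (\<lambda>y. (?bX y, ?bY y))"
    by (intro ent_mono simple_function_block simple_function_Pair X Y) (auto intro: coarser_intros)
  also have "\<dots> = ent M ?bY + cent M ?bX ?bY" by (simp add: cent_def)
  also have "cent M ?bX ?bY \<le> (\<Sum>i\<in>{0..<m}. cent M (\<lambda>y. X ((T ^^ i) y)) ?bY)"
    by (intro cent_block_le simple_function_block X Y)
  also have "\<dots> \<le> (\<Sum>i\<in>{0..<m}. cent M X Y)"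
  proof (rule sum_mono)
    fix i assume "i \<in> {0..<m}"
    then have "cent M (\<lambda>y. X ((T ^^ i) y)) ?bY \<le> cent M (\<lambda>y. X ((T ^^ i) y)) (\<lambda>y. Y ((T ^^ i) y))"
      by (intro cent_mono_right simple_function_block simple_function_funpow X Y coarser_block) auto
    then show "cent M (\<lambda>y. X ((T ^^ i) y)) ?bY \<le> cent M X Y" unfolding cent_funpow[OF X Y] .
  qed
  finally have "ent M ?bX \<le> ent M ?bY + real m * cent M X Y" by simp
  then have "ent M ?bX / real m \<le> (ent M ?bY + real m * cent M X Y) / real m"
    by (rule divide_right_mono) simp
  then show "ent M ?bX / real m \<le> ent M ?bY / real m + cent M X Y"
    using m by (simp add: add_divide_distrib)
qed

section \<open>The Pinsker algebra and the tail of a process\<close>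

lemma iterated_join_eq:
  "iterated_join M T {A, space M - A} n =
    (\<lambda>v. {y \<in> space M. block T (\<lambda>y. y \<in> A) 0 n y = v}) ` {v. length v = n}" if A: "A \<in> sets M"
proof (induction n)
  case (Suc n)
  let ?E = "\<lambda>y. y \<in> A"
  have pull: "partition_pullback M T n {A, space M - A} = (\<lambda>b. {y \<in> space M. ?E ((T ^^ n) y) = b}) ` UNIV"
    unfolding partition_pullback_def UNIV_bool by (auto simp: funpow_space)
  have blk: "{y \<in> space M. block T ?E 0 n y = v} \<inter> {y \<in> space M. ?E ((T ^^ n) y) = b} =
    {y \<in> space M. block T ?E 0 (Suc n) y = v @ [b]}" for v b
    by (auto simp: block_def)
  have "iterated_join M T {A, space M - A} (Suc n) =
    (\<lambda>(v, b). {y \<in> space M. block T ?E 0 (Suc n) y = v @ [b]}) ` ({v. length v = n} \<times> UNIV)"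
    unfolding iterated_join.simps Suc.IH pull partition_join_def blk[symmetric] by (auto simp: image_iff)
  also have "\<dots> = (\<lambda>v. {y \<in> space M. block T ?E 0 (Suc n) y = v}) ` ((\<lambda>(v, b). v @ [b]) ` ({v. length v = n} \<times> UNIV))"
    by (simp add: image_image case_prod_unfold)
  also have "(\<lambda>(v, b). v @ [b]) ` ({v. length v = n} \<times> UNIV) = {v :: bool list. length v = Suc n}"
    by (auto simp: length_Suc_conv_rev image_iff)
  finally show ?case .
qed (auto simp: block_def)

lemma partition_entropy_iterated_join:
  assumes A: "A \<in> sets M"
  shows "partition_entropy M (iterated_join M T {A, space M - A} n) = ent M (block T (\<lambda>y. y \<in> A) 0 n)"
proof -
  let ?b = "block T (\<lambda>y. y \<in> A) 0 n"
  let ?c = "\<lambda>v. {y \<in> space M. ?b y = v}"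
  have fin: "finite {v :: bool list. length v = n}"
    using finite_lists_length_eq[of "UNIV :: bool set" n] by simp
  have len: "?b ` space M \<subseteq> {v. length v = n}" by (auto simp: block_def)
  have "partition_entropy M (?c ` {v. length v = n}) = (\<Sum>C\<in>?c ` {v. length v = n}. eta (prob C))"
    unfolding partition_entropy_def eta_def by (simp add: sum_negf)
  also have "\<dots> = (\<Sum>C\<in>?c ` (?b ` space M). eta (prob C))"
  proof (rule sum.mono_neutral_right)
    show "\<forall>i\<in>?c ` {v. length v = n} - ?c ` ?b ` space M. eta (prob i) = 0"
    proof
      fix C assume "C \<in> ?c ` {v. length v = n} - ?c ` ?b ` space M"
      then obtain v where "C = ?c v" "C \<notin> ?c ` ?b ` space M" by blast
      then have "C = {}" by blast
      then show "eta (prob C) = 0" by simp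
    qed
  qed (use fin len in auto)
  also have "\<dots> = (\<Sum>v\<in>?b ` space M. eta (prob (?c v)))"
    by (rule sum.reindex_cong[of ?c]) (auto simp: inj_on_def)
  finally show ?thesis unfolding iterated_join_eq[OF A] ent_def .
qed

lemma pinsker_eq: "pinsker M T = {A \<in> sets M. entropy_rate (\<lambda>y. y \<in> A) = 0}"
  unfolding pinsker_def ks_entropy_def
  using limI[OF entropy_rate_tendsto[OF simple_function_mem]]
  by (auto simp: partition_entropy_iterated_join)

lemma approximable_pinsker: "approximable M (pinsker M T) \<subseteq> pinsker M T"
proof
  fix A assume "A \<in> approximable M (pinsker M T)"
  then have A: "A \<in> sets M" and ap: "\<And>\<epsilon>. 0 < \<epsilon> \<Longrightarrow> \<exists>B\<in>pinsker M T. prob (sym_diff A B) < \<epsilon>"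
    by (auto simp: approximable_def)
  have "entropy_rate (\<lambda>y. y \<in> A) \<le> 0"
  proof (rule field_le_epsilon)
    fix e :: real assume "0 < e"
    then obtain \<delta> where \<delta>: "0 < \<delta>" "\<And>t. 0 \<le> t \<Longrightarrow> t < \<delta> \<Longrightarrow> eta t + eta (1 - t) < e"
      using binary_entropy_small[of e] by auto
    obtain B where B: "B \<in> pinsker M T" "prob (sym_diff A B) < \<delta>" using ap[OF \<delta>(1)] by blast
    then have Bm: "B \<in> sets M" and B0: "entropy_rate (\<lambda>y. y \<in> B) = 0" by (auto simp: pinsker_eq)
    have "entropy_rate (\<lambda>y. y \<in> A) \<le> entropy_rate (\<lambda>y. y \<in> B) + cent M (\<lambda>y. y \<in> A) (\<lambda>y. y \<in> B)"
      by (intro entropy_rate_le_cent simple_function_mem A Bm)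
    also have "cent M (\<lambda>y. y \<in> A) (\<lambda>y. y \<in> B) \<le> eta (prob (sym_diff A B)) + eta (1 - prob (sym_diff A B))"
      by (intro cent_mem_le_sym_diff simple_function_mem A Bm coarser_refl)
    also have "\<dots> < e" using \<delta>(2)[OF _ B(2)] by simp
    finally show "entropy_rate (\<lambda>y. y \<in> A) \<le> 0 + e" using B0 by simp
  qed
  then show "A \<in> pinsker M T"
    using A entropy_rate_nonneg[OF simple_function_mem[OF A]] by (simp add: pinsker_eq)
qed

text \<open>
  Closure under intersections is subadditivity of the entropy rate; closure under countable
  unions follows because the Pinsker sets are closed in the measure algebra.
\<close>

lemma pinsker_sigma_algebra: "sigma_algebra (space M) (pinsker M T)"
proof -
  have "algebra (space M) (pinsker M T)"
    unfolding algebra_iff_Int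
  proof (intro conjI ballI)
    show "pinsker M T \<subseteq> Pow (space M)" using sets.sets_into_space by (auto simp: pinsker_eq)
    have "ent M (block T (\<lambda>y. y \<in> {}) 0 m) = 0" for m
      by (subst ent_eq_sum[of "{replicate m False}"]) (auto simp: prob_space block_def map_replicate_const)
    then have "entropy_rate (\<lambda>y. y \<in> {}) = 0" by (simp add: entropy_rate_def)
    then show "{} \<in> pinsker M T" by (simp add: pinsker_eq)
  next
    fix A assume "A \<in> pinsker M T"
    then have A: "A \<in> sets M" "entropy_rate (\<lambda>y. y \<in> A) = 0" by (auto simp: pinsker_eq)
    have "entropy_rate (\<lambda>y. y \<in> space M - A) \<le> entropy_rate (\<lambda>y. y \<in> A)"
      by (intro entropy_rate_mono simple_function_mem A) (auto simp: coarser_def A)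
    then show "space M - A \<in> pinsker M T"
      using A entropy_rate_nonneg[OF simple_function_mem[of "space M - A"]] by (simp add: pinsker_eq)
  next
    fix A B assume "A \<in> pinsker M T" "B \<in> pinsker M T"
    then have A: "A \<in> sets M" "entropy_rate (\<lambda>y. y \<in> A) = 0"
      and B: "B \<in> sets M" "entropy_rate (\<lambda>y. y \<in> B) = 0" by (auto simp: pinsker_eq)
    have "entropy_rate (\<lambda>y. y \<in> A \<inter> B) \<le> entropy_rate (\<lambda>y. (y \<in> A, y \<in> B))"
      by (intro entropy_rate_mono simple_function_mem simple_function_Pair sets.Int A B) (auto simp: coarser_def)
    also have "\<dots> \<le> 0"
      using entropy_rate_Pair_le[OF simple_function_mem[OF A(1)] simple_function_mem[OF B(1)]] A B by simp
    finally show "A \<inter> B \<in> pinsker M T"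
      using A B entropy_rate_nonneg[OF simple_function_mem[of "A \<inter> B"]] by (simp add: pinsker_eq)
  qed
  moreover have sub: "pinsker M T \<subseteq> sets M" by (auto simp: pinsker_eq)
  ultimately have "sigma_algebra (space M) (approximable M (pinsker M T))"
    by (rule sigma_algebra_approximable)
  moreover have "approximable M (pinsker M T) = pinsker M T"
    using approximable_pinsker sub unfolding approximable_def by (auto intro!: bexI)
  ultimately show ?thesis by simp
qed

definition future :: "('a \<Rightarrow> 'b) \<Rightarrow> nat \<Rightarrow> 'a set set" where
  "future X n = {B \<in> sets M. \<exists>m. coarser M (\<lambda>y. y \<in> B) (block T X n m)}"

lemma algebra_future: "algebra (space M) (future X n)"
  unfolding algebra_iff_Un
proof (intro conjI ballI)
  show "future X n \<subseteq> Pow (space M)" using sets.sets_into_space by (auto simp: future_def)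
  show "{} \<in> future X n" by (auto simp: future_def)
next
  fix A assume "A \<in> future X n"
  then show "space M - A \<in> future X n" by (auto simp: future_def coarser_def)
next
  fix A B assume "A \<in> future X n" "B \<in> future X n"
  then obtain m m' where A: "A \<in> sets M" "coarser M (\<lambda>y. y \<in> A) (block T X n m)"
    and B: "B \<in> sets M" "coarser M (\<lambda>y. y \<in> B) (block T X n m')" by (auto simp: future_def)
  have "coarser M (\<lambda>y. y \<in> A) (block T X n (max m m'))" "coarser M (\<lambda>y. y \<in> B) (block T X n (max m m'))"
    by (rule coarser_trans[OF A(2)] coarser_trans[OF B(2)], rule coarser_block_mono, simp, simp)+
  then have "coarser M (\<lambda>y. y \<in> A \<union> B) (block T X n (max m m'))" unfolding coarser_def by blast
  then show "A \<union> B \<in> future X n" using A B unfolding future_def by blast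
qed

text \<open>
  Tail events have entropy zero. Let \<open>E\<close> be the process of visits to
  \<open>A\<close>. Given \<open>N + K\<close> letters of \<open>X\<close>, the first
  \<open>N\<close> letters of \<open>E\<close> are almost known, so \<open>E\<close> and
  \<open>X\<close> together have block entropy at most \<open>ent (X, N) + N \<epsilon> +
  O(1)\<close>. On the other hand the first \<open>N\<close> letters of \<open>E\<close> are
  almost a function of \<open>X\<close> after time \<open>N\<close>, so that conditioning on
  them leaves \<open>X\<close> its full rate: given them, the first \<open>N\<close> letters of
  \<open>X\<close> still have entropy at least \<open>N h(X) - \<epsilon>\<close>. Hence nothing
  is left for \<open>E\<close> but \<open>N \<epsilon> + o(N)\<close>.
\<close>

theorem tail_subset_pinsker:
  assumes X: "simple_function M X" and tail: "\<And>n. A \<in> approximable M (future X n)"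
  shows "A \<in> pinsker M T"
proof -
  let ?E = "\<lambda>y. y \<in> A"
  let ?a = "\<lambda>m. ent M (block T X 0 m)" and ?b = "\<lambda>m. ent M (block T ?E 0 m)"
  have A: "A \<in> sets M" using tail[of 0] by (simp add: approximable_def)
  note E = simple_function_mem[OF A]
  note sf = simple_function_block[OF X] simple_function_block[OF E] X E simple_function_funpow[OF E]
  \<comment> \<open>\<open>A\<close>, its translates, and finally a whole block of \<open>E\<close> are predictable from late letters of \<open>X\<close>.\<close>
  have step1: "\<exists>m\<ge>n. cent M ?E (block T X n m) \<le> \<epsilon>" if "0 < \<epsilon>" for n \<epsilon>
  proof -
    obtain \<delta> where \<delta>: "0 < \<delta>" "\<And>t. 0 \<le> t \<Longrightarrow> t < \<delta> \<Longrightarrow> eta t + eta (1 - t) < \<epsilon>"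
      using binary_entropy_small[OF \<open>0 < \<epsilon>\<close>] by auto
    obtain B m where B: "B \<in> sets M" "coarser M (\<lambda>y. y \<in> B) (block T X n m)" "prob (sym_diff A B) < \<delta>"
      using tail[of n] \<delta>(1) unfolding approximable_def future_def by blast
    have "cent M ?E (block T X n (max n m)) \<le> eta (prob (sym_diff A B)) + eta (1 - prob (sym_diff A B))"
      by (intro cent_mem_le_sym_diff A B sf coarser_trans[OF B(2)] coarser_block_mono) auto
    also have "\<dots> < \<epsilon>" using \<delta>(2)[OF _ B(3)] by simp
    finally show ?thesis by (intro exI[of _ "max n m"]) auto
  qed
  have step2: "\<exists>m\<ge>n. cent M (\<lambda>y. ?E ((T ^^ i) y)) (block T X n m) \<le> \<epsilon>" if "0 < \<epsilon>" for n i \<epsilon>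
  proof -
    obtain m where m: "n \<le> m" "cent M ?E (block T X n m) \<le> \<epsilon>" using step1[OF \<open>0 < \<epsilon>\<close>] by blast
    have "cent M (\<lambda>y. ?E ((T ^^ i) y)) (block T X n (m + i)) \<le> cent M (\<lambda>y. ?E ((T ^^ i) y)) (block T X (n + i) (m + i))"
      by (intro cent_mono_right sf coarser_block_mono) auto
    also have "\<dots> = cent M ?E (block T X n m)"
      unfolding block_shift by (rule cent_funpow[OF E sf(1)])
    finally show ?thesis using m by (intro exI[of _ "m + i"]) auto
  qed
  have step3: "\<exists>m\<ge>n. cent M (block T ?E 0 N) (block T X n m) \<le> \<epsilon>" if "0 < \<epsilon>" for n N \<epsilon>
  proof -
    have "\<exists>m\<ge>n. (\<Sum>i\<in>{0..<N}. cent M (\<lambda>y. ?E ((T ^^ i) y)) (block T X n m)) \<le> \<epsilon>" using \<open>0 < \<epsilon>\<close>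
    proof (induction N arbitrary: \<epsilon>)
      case (Suc N)
      obtain m where m: "n \<le> m" "(\<Sum>i\<in>{0..<N}. cent M (\<lambda>y. ?E ((T ^^ i) y)) (block T X n m)) \<le> \<epsilon> / 2"
        using Suc.IH[of "\<epsilon> / 2"] Suc.prems by auto
      obtain m' where m': "n \<le> m'" "cent M (\<lambda>y. ?E ((T ^^ N) y)) (block T X n m') \<le> \<epsilon> / 2"
        using step2[of "\<epsilon> / 2"] Suc.prems by auto
      have mono: "cent M (\<lambda>y. ?E ((T ^^ i) y)) (block T X n (max m m')) \<le> cent M (\<lambda>y. ?E ((T ^^ i) y)) (block T X n k)"
        if "k \<le> max m m'" for i k
        using that by (intro cent_mono_right sf coarser_block_mono) auto
      have "(\<Sum>i\<in>{0..<N}. cent M (\<lambda>y. ?E ((T ^^ i) y)) (block T X n (max m m'))) \<le>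
        (\<Sum>i\<in>{0..<N}. cent M (\<lambda>y. ?E ((T ^^ i) y)) (block T X n m))"
        by (intro sum_mono mono) auto
      with m m' mono[of m' N] show ?case by (intro exI[of _ "max m m'"]) auto
    qed auto
    then obtain m where "m \<ge> n" "(\<Sum>i\<in>{0..<N}. cent M (\<lambda>y. ?E ((T ^^ i) y)) (block T X n m)) \<le> \<epsilon>" by blast
    then show ?thesis using cent_block_le[OF E sf(1), of 0 N n m] by (intro exI[of _ m]) auto
  qed
  have "entropy_rate ?E \<le> 0"
  proof (rule field_le_epsilon)
    fix \<epsilon> :: real assume "0 < \<epsilon>"
    obtain K where K: "cent M ?E (block T X 0 K) \<le> \<epsilon>" using step1[OF \<open>0 < \<epsilon>\<close>] by blast
    have bound: "?b N \<le> ?a N + real K * ?a 1 - real N * entropy_rate X + real N * \<epsilon> + \<epsilon>" for N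
    proof -
      obtain L where L: "N \<le> L" "cent M (block T ?E 0 N) (block T X N L) \<le> \<epsilon>"
        using step3[OF \<open>0 < \<epsilon>\<close>] by blast
      have "cent M (block T ?E 0 N) (block T X 0 (N + K)) \<le> (\<Sum>i\<in>{0..<N}. cent M (\<lambda>y. ?E ((T ^^ i) y)) (block T X 0 (N + K)))"
        by (intro cent_block_le sf)
      also have "\<dots> \<le> (\<Sum>i\<in>{0..<N}. \<epsilon>)"
      proof (rule sum_mono)
        fix i assume i: "i \<in> {0..<N}"
        have "cent M (\<lambda>y. ?E ((T ^^ i) y)) (block T X 0 (N + K)) \<le> cent M (\<lambda>y. ?E ((T ^^ i) y)) (block T X (0 + i) (K + i))"
          using i by (intro cent_mono_right sf coarser_block_mono) auto
        also have "\<dots> = cent M ?E (block T X 0 K)"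
          unfolding block_shift by (rule cent_funpow[OF E sf(1)])
        finally show "cent M (\<lambda>y. ?E ((T ^^ i) y)) (block T X 0 (N + K)) \<le> \<epsilon>" using K by linarith
      qed
      finally have 1: "cent M (block T ?E 0 N) (block T X 0 (N + K)) \<le> real N * \<epsilon>" by simp
      have 2: "?b N + cent M (block T X 0 N) (block T ?E 0 N) \<le> ?a (N + K) + cent M (block T ?E 0 N) (block T X 0 (N + K))"
      proof -
        have "ent M (\<lambda>y. (block T X 0 N y, block T ?E 0 N y)) \<le> ent M (\<lambda>y. (block T ?E 0 N y, block T X 0 (N + K) y))"
          by (intro ent_mono simple_function_Pair sf)
            (simp add: coarser_PairI1 coarser_PairI2 coarser_block_mono)
        then show ?thesis unfolding cent_def by linarith
      qed
      have 3: "real N * entropy_rate X \<le> cent M (block T X 0 N) (block T X N L)"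
        using cent_block_split[OF X, of N "L - N"] entropy_increment_ge[OF X, of N "L - N"] L(1) by simp
      have 4: "cent M (block T X 0 N) (block T X N L) \<le> cent M (\<lambda>y. (block T X 0 N y, block T ?E 0 N y)) (block T X N L)"
        by (intro cent_mono_left simple_function_Pair sf) (auto simp: coarser_def)
      have 5: "\<dots> = cent M (block T ?E 0 N) (block T X N L) + cent M (block T X 0 N) (\<lambda>y. (block T ?E 0 N y, block T X N L y))"
        by (rule cent_Pair)
      have 6: "cent M (block T X 0 N) (\<lambda>y. (block T ?E 0 N y, block T X N L y)) \<le> cent M (block T X 0 N) (block T ?E 0 N)"
        by (intro cent_mono_right simple_function_Pair sf) (auto intro: coarser_intros)
      have 7: "?a (N + K) \<le> ?a N + real K * ?a 1"
      proof (induction K)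
        case (Suc K)
        have "?a (Suc (N + K)) - ?a (N + K) \<le> ?a (Suc 0) - ?a 0"
          by (rule entropy_increment_decreasing[OF X]) simp
        with Suc show ?case by (simp add: algebra_simps)
      qed simp
      from 1 2 3 4 5 6 7 L(2) show ?thesis by linarith
    qed
    have "(\<lambda>N. ?a N / real N - entropy_rate X + \<epsilon> + (\<epsilon> + real K * ?a 1) / real N) \<longlonglongrightarrow>
      entropy_rate X - entropy_rate X + \<epsilon> + 0"
      by (intro tendsto_intros entropy_rate_tendsto[OF X] lim_const_over_n)
    then have "entropy_rate ?E \<le> entropy_rate X - entropy_rate X + \<epsilon> + 0"
    proof (rule LIMSEQ_le[OF entropy_rate_tendsto[OF E]], intro exI allI impI)
      fix N :: nat assume N: "1 \<le> N"
      have "?b N / real N \<le> (?a N + real K * ?a 1 - real N * entropy_rate X + real N * \<epsilon> + \<epsilon>) / real N"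
        by (intro divide_right_mono bound) simp
      also have "\<dots> = ?a N / real N - entropy_rate X + \<epsilon> + (\<epsilon> + real K * ?a 1) / real N"
        using N by (simp add: field_simps)
      finally show "?b N / real N \<le> ?a N / real N - entropy_rate X + \<epsilon> + (\<epsilon> + real K * ?a 1) / real N" .
    qed
    then show "entropy_rate ?E \<le> 0 + \<epsilon>" by simp
  qed
  then show ?thesis using A entropy_rate_nonneg[OF E] by (simp add: pinsker_eq)
qed

text \<open>
  For a Pinsker set \<open>A\<close> the first \<open>n\<close> letters of \<open>X\<close>
  carry no information on \<open>A\<close> beyond that of the later ones. Let \<open>E\<close>
  be the process of visits to \<open>A\<close>. The information in question is symmetric: it is
  also the loss of entropy of the first \<open>n\<close> letters of \<open>X\<close> caused by
  \<open>A\<close>. Conditioning on all of \<open>E\<close> instead of \<open>A\<close>, this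
  loss is at most \<open>n (h(X) - h(X, E) + h(E))\<close> in the limit, and \<open>h(E) =
  0\<close> while \<open>h(X) \<le> h(X, E)\<close>. The remainder term of
  \<open>cent_gain\<close> then bounds the distance of the conditional probabilities.
\<close>

theorem pinsker_conditional_on_future:
  assumes X: "simple_function M X" and "A \<in> pinsker M T"
  shows "(\<lambda>m. \<integral>y. (cprob M (block T X 0 m) A (block T X 0 m y)
      - cprob M (block T X n m) A (block T X n m y))\<^sup>2 \<partial>M) \<longlonglongrightarrow> 0"
    (is "?D \<longlonglongrightarrow> 0")
proof -
  let ?E = "\<lambda>y. y \<in> A"
  let ?XE = "\<lambda>y. (X y, ?E y)"
  let ?a = "\<lambda>m. ent M (block T X 0 m)" and ?b = "\<lambda>m. ent M (block T ?E 0 m)" and ?c = "\<lambda>m. ent M (block T ?XE 0 m)"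
  from assms have A: "A \<in> sets M" and h0: "entropy_rate ?E = 0" by (auto simp: pinsker_eq)
  note E = simple_function_mem[OF A]
  note XE = simple_function_Pair[OF X E]
  note sf = simple_function_block[OF X] simple_function_block[OF E] simple_function_block[OF XE] X E XE
    simple_function_Pair
  let ?g = "\<lambda>m. 4 * ((?a (m + n) - ?a m) - (?c (m + n) - ?c m) + (?b (m + n) - ?b m))"
  have bound: "?D (m + n) \<le> ?g m" if m: "1 \<le> m" for m
  proof -
    let ?Xi = "block T X 0 n" and ?Xn = "block T X n (m + n)" and ?XN = "block T X 0 (m + n)"
    let ?Ei = "block T ?E 0 n" and ?En = "block T ?E n (m + n)" and ?XEn = "block T ?XE n (m + n)"
    have "?D (m + n) \<le> 4 * (cent M ?E ?Xn - cent M ?E ?XN)"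
      by (rule cent_mem_gain[OF A sf(1) sf(1) coarser_block_mono]) auto
    also have "cent M ?E ?XN = cent M ?E (\<lambda>y. (?Xi y, ?Xn y))"
    proof -
      have 1: "coarser M (\<lambda>y. (?Xi y, ?Xn y)) ?XN" by (auto intro: coarser_block_mono)
      have 2: "coarser M ?XN (\<lambda>y. (?Xi y, ?Xn y))" unfolding coarser_block_iff
      proof safe
        fix i assume "i < m + n"
        then show "coarser M (\<lambda>y. X ((T ^^ i) y)) (\<lambda>y. (?Xi y, ?Xn y))"
          by (cases "i < n") (auto intro!: coarser_block intro: coarser_PairI1 coarser_PairI2)
      qed
      show ?thesis
        by (rule cent_cong) (use 1 2 in \<open>auto intro: coarser_intros\<close>)
    qed
    also have "cent M ?E ?Xn - cent M ?E (\<lambda>y. (?Xi y, ?Xn y)) =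
      cent M ?Xi ?Xn - cent M ?Xi (\<lambda>y. (?E y, ?Xn y))"
    proof -
      have "cent M (\<lambda>y. (?E y, ?Xi y)) ?Xn = cent M (\<lambda>y. (?Xi y, ?E y)) ?Xn"
        by (rule cent_cong) (auto simp: coarser_def)
      then show ?thesis unfolding cent_Pair by linarith
    qed
    also have "cent M ?Xi ?Xn = ?a (m + n) - ?a m" by (rule cent_block_split[OF X])
    finally have up: "?D (m + n) \<le> 4 * ((?a (m + n) - ?a m) - cent M ?Xi (\<lambda>y. (?E y, ?Xn y)))" .
    have low: "cent M ?Xi (\<lambda>y. (?E y, ?Xn y)) \<ge> (?c (m + n) - ?c m) - (?b (m + n) - ?b m)"
    proof -
      have "?c (m + n) - ?c m = cent M (block T ?XE 0 n) ?XEn"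
        by (rule cent_block_split[OF XE, symmetric])
      also have "\<dots> \<le> cent M (\<lambda>y. (?Xi y, ?Ei y)) ?XEn"
        by (intro cent_mono_left sf coarser_PairI1 coarser_block_Pair)
      also have "\<dots> = cent M ?Ei ?XEn + cent M ?Xi (\<lambda>y. (?Ei y, ?XEn y))" by (rule cent_Pair)
      also have "cent M ?Ei ?XEn \<le> cent M ?Ei ?En"
        by (intro cent_mono_right sf coarser_block_Pair2)
      also have "\<dots> = ?b (m + n) - ?b m" by (rule cent_block_split[OF E])
      also have "cent M ?Xi (\<lambda>y. (?Ei y, ?XEn y)) \<le> cent M ?Xi (\<lambda>y. (?E y, ?Xn y))"
      proof (intro cent_mono_right sf)
        have "coarser M ?E (\<lambda>y. (?Ei y, ?XEn y))"
        proof (cases "n = 0")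
          case False
          then show ?thesis using coarser_block[of 0 0 n M ?E T] by (auto intro: coarser_PairI1)
        next
          case True
          then have "coarser M ?E ?En" using m coarser_block[of n 0 "m + n" M ?E T] by simp
          then show ?thesis by (intro coarser_PairI2 coarser_trans[OF _ coarser_block_Pair2])
        qed
        moreover have "coarser M ?Xn (\<lambda>y. (?Ei y, ?XEn y))" by (intro coarser_PairI2 coarser_block_Pair1)
        ultimately show "coarser M (\<lambda>y. (?E y, ?Xn y)) (\<lambda>y. (?Ei y, ?XEn y))" by simp
      qed
      finally show ?thesis by linarith
    qed
    show ?thesis by (rule order_trans[OF up]) (use low in simp)
  qed
  have lim: "?g \<longlonglongrightarrow> 4 * (real n * entropy_rate X - real n * entropy_rate ?XE + real n * entropy_rate ?E)"
    by (intro tendsto_intros entropy_increment_tendsto sf)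
  have "entropy_rate X \<le> entropy_rate ?XE"
    by (intro entropy_rate_mono sf) (auto intro: coarser_intros)
  moreover have "entropy_rate ?XE \<le> entropy_rate X + entropy_rate ?E"
    by (intro entropy_rate_Pair_le sf)
  ultimately have "?g \<longlonglongrightarrow> 0" using lim h0 by simp
  have "(\<lambda>m. ?D (m + n)) \<longlonglongrightarrow> 0"
  proof (rule tendsto_sandwich[OF _ _ tendsto_const \<open>?g \<longlonglongrightarrow> 0\<close>])
    show "\<forall>\<^sub>F m in sequentially. ?D (m + n) \<le> ?g m"
      using bound by (rule eventually_sequentiallyI)
  qed simp
  then show ?thesis by (rule LIMSEQ_offset)
qed

end

section \<open>Cylinder algebras\<close>

definition itinerary :: "(nat \<Rightarrow> 'a set) \<Rightarrow> nat \<Rightarrow> 'a \<Rightarrow> bool list" where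
  "itinerary U k y = map (\<lambda>j. y \<in> U j) [0..<k]"

text \<open>
  The algebra generated by the first \<open>k\<close> sets, described through the atoms. Their
  union over \<open>k\<close> is a countable algebra with the same generated sigma-algebra as
  the sequence.
\<close>

definition cylinders :: "'a set \<Rightarrow> (nat \<Rightarrow> 'a set) \<Rightarrow> nat \<Rightarrow> 'a set set" where
  "cylinders \<Omega> U k =
     {B. B \<subseteq> \<Omega> \<and> (\<forall>y\<in>\<Omega>. \<forall>z\<in>\<Omega>. itinerary U k y = itinerary U k z \<longrightarrow> (y \<in> B \<longleftrightarrow> z \<in> B))}"

lemma itinerary_eq_iff: "itinerary U k y = itinerary U k z \<longleftrightarrow> (\<forall>j<k. y \<in> U j \<longleftrightarrow> z \<in> U j)"
  by (auto simp: itinerary_def)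

lemma simple_function_itinerary:
  assumes "\<And>j. U j \<in> sets M" shows "simple_function M (itinerary U k)"
proof -
  have "simple_function M (\<lambda>y. map (\<lambda>j. y \<in> U j) js)" for js
  proof (induction js)
    case (Cons j js)
    from simple_function_compose2[OF simple_function_mem[OF assms[of j]] Cons, of "(#)"] show ?case by simp
  qed simp
  then show ?thesis unfolding itinerary_def .
qed

lemma cylinders_mono: "k \<le> k' \<Longrightarrow> cylinders \<Omega> U k \<subseteq> cylinders \<Omega> U k'"
proof -
  assume "k \<le> k'"
  then have "itinerary U k' y = itinerary U k' z \<Longrightarrow> itinerary U k y = itinerary U k z" for y z
    by (auto simp: itinerary_eq_iff)
  then show ?thesis unfolding cylinders_def by blast
qed

lemma cylinder_eq:
  assumes "B \<in> cylinders \<Omega> U k"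
  shows "B = (\<Union>v\<in>itinerary U k ` B. {y \<in> \<Omega>. itinerary U k y = v})"
proof (intro equalityI subsetI)
  fix y assume "y \<in> B"
  then show "y \<in> (\<Union>v\<in>itinerary U k ` B. {y \<in> \<Omega>. itinerary U k y = v})"
    using assms unfolding cylinders_def by auto
next
  fix y assume "y \<in> (\<Union>v\<in>itinerary U k ` B. {y \<in> \<Omega>. itinerary U k y = v})"
  then obtain b where "b \<in> B" "y \<in> \<Omega>" "itinerary U k y = itinerary U k b" by blast
  moreover from \<open>b \<in> B\<close> have "b \<in> \<Omega>" using assms unfolding cylinders_def by blast
  ultimately show "y \<in> B" using assms unfolding cylinders_def by blast
qed

lemma finite_cylinders: "finite (cylinders \<Omega> U k)"
proof (rule finite_subset)
  show "cylinders \<Omega> U k \<subseteq> (\<lambda>S. \<Union>v\<in>S. {y \<in> \<Omega>. itinerary U k y = v}) ` Pow {v. length v = k}"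
  proof
    fix B assume "B \<in> cylinders \<Omega> U k"
    from cylinder_eq[OF this] show "B \<in> (\<lambda>S. \<Union>v\<in>S. {y \<in> \<Omega>. itinerary U k y = v}) ` Pow {v. length v = k}"
      by (rule image_eqI) (auto simp: itinerary_def)
  qed
  show "finite ((\<lambda>S. \<Union>v\<in>S. {y \<in> \<Omega>. itinerary U k y = v}) ` Pow {v. length v = k})"
    using finite_lists_length_eq[of "UNIV :: bool set" k] by simp
qed

lemma countable_cylinders: "countable (\<Union>k. cylinders \<Omega> U k)"
  by (auto intro: countable_finite finite_cylinders)

lemma cylinders_subset_sets:
  assumes U: "\<And>j. U j \<in> sets M" shows "cylinders (space M) U k \<subseteq> sets M"
proof
  fix B assume B: "B \<in> cylinders (space M) U k"
  have sf: "simple_function M (itinerary U k)" by (rule simple_function_itinerary[OF U])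
  have "B \<subseteq> space M" using B by (auto simp: cylinders_def)
  then have "finite (itinerary U k ` B)"
    using simple_functionD(1)[OF sf] by (rule finite_subset[OF image_mono])
  then have "(\<Union>v\<in>itinerary U k ` B. {y \<in> space M. itinerary U k y = v}) \<in> sets M"
    by (intro sets.finite_UN simple_function_cell[OF sf])
  then show "B \<in> sets M" using cylinder_eq[OF B] by simp
qed

lemma algebra_cylinders: "algebra \<Omega> (\<Union>k. cylinders \<Omega> U k)"
  unfolding algebra_iff_Un
proof (intro conjI ballI)
  show "(\<Union>k. cylinders \<Omega> U k) \<subseteq> Pow \<Omega>" by (auto simp: cylinders_def)
  show "{} \<in> (\<Union>k. cylinders \<Omega> U k)" by (auto simp: cylinders_def)
next
  fix A assume "A \<in> (\<Union>k. cylinders \<Omega> U k)"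
  then show "\<Omega> - A \<in> (\<Union>k. cylinders \<Omega> U k)" unfolding cylinders_def by blast
next
  fix A B assume "A \<in> (\<Union>k. cylinders \<Omega> U k)" "B \<in> (\<Union>k. cylinders \<Omega> U k)"
  then obtain k l where "A \<in> cylinders \<Omega> U k" "B \<in> cylinders \<Omega> U l" by blast
  then have "A \<in> cylinders \<Omega> U (max k l)" "B \<in> cylinders \<Omega> U (max k l)"
    by (auto intro: subsetD[OF cylinders_mono, rotated])
  then have "A \<union> B \<in> cylinders \<Omega> U (max k l)" unfolding cylinders_def by blast
  then show "A \<union> B \<in> (\<Union>k. cylinders \<Omega> U k)" by blast
qed

lemma sigma_sets_cylinders:
  assumes U: "range U \<subseteq> Pow \<Omega>"
  shows "sigma_sets \<Omega> (\<Union>k. cylinders \<Omega> U k) = sigma_sets \<Omega> (range U)"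
proof (rule sigma_sets_eqI)
  fix B assume "B \<in> (\<Union>k. cylinders \<Omega> U k)"
  moreover have "cylinders (space (sigma \<Omega> (range U))) U k \<subseteq> sets (sigma \<Omega> (range U))" for k
    using U by (intro cylinders_subset_sets) auto
  ultimately show "B \<in> sigma_sets \<Omega> (range U)" using U by auto
next
  fix B assume "B \<in> range U"
  then obtain j where j: "B = U j" by blast
  have "U j \<in> cylinders \<Omega> U (Suc j)" using U by (auto simp: cylinders_def itinerary_eq_iff)
  then show "B \<in> sigma_sets \<Omega> (\<Union>k. cylinders \<Omega> U k)" unfolding j by blast
qed

lemma Int_stable_cylinders: "Int_stable (\<Union>k. cylinders \<Omega> U k)"
  using algebra_cylinders[of \<Omega> U] unfolding algebra_iff_Int Int_stable_def by blast

section \<open>Limits of bounded functions in mean square\<close>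

context prob_space begin

lemma integrable_bounded:
  fixes f :: "'a \<Rightarrow> real"
  assumes "f \<in> borel_measurable M" "\<And>x. x \<in> space M \<Longrightarrow> \<bar>f x\<bar> \<le> B"
  shows "integrable M f"
  using assms by (intro integrable_const_bound[where B=B]) auto

lemma sq_diff_le_1: "0 \<le> (a::real) \<Longrightarrow> a \<le> 1 \<Longrightarrow> 0 \<le> b \<Longrightarrow> b \<le> 1 \<Longrightarrow> (a - b)\<^sup>2 \<le> 1"
  using abs_square_le_1[of "a - b"] by simp

lemma integrable_sq_diff:
  fixes f g :: "'a \<Rightarrow> real"
  assumes "f \<in> borel_measurable M" "g \<in> borel_measurable M"
    "\<And>x. 0 \<le> f x" "\<And>x. f x \<le> 1" "\<And>x. 0 \<le> g x" "\<And>x. g x \<le> 1"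
  shows "integrable M (\<lambda>x. (f x - g x)\<^sup>2)"
  by (rule integrable_bounded[where B=1]) (use assms in \<open>auto intro!: sq_diff_le_1\<close>)

lemma integral_sq_diff_tendsto:
  fixes f h :: "'a \<Rightarrow> real" and g :: "nat \<Rightarrow> 'a \<Rightarrow> real"
  assumes f: "f \<in> borel_measurable M" "\<And>x. 0 \<le> f x" "\<And>x. f x \<le> 1"
    and g: "\<And>j. g j \<in> borel_measurable M" "\<And>j x. 0 \<le> g j x" "\<And>j x. g j x \<le> 1"
    and h: "h \<in> borel_measurable M" and lim: "AE x in M. (\<lambda>j. g j x) \<longlonglongrightarrow> h x"
  shows "(\<lambda>j. \<integral>x. (f x - g j x)\<^sup>2 \<partial>M) \<longlonglongrightarrow> (\<integral>x. (f x - h x)\<^sup>2 \<partial>M)"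
proof (rule integral_dominated_convergence[where w="\<lambda>_. 1"])
  show "AE x in M. (\<lambda>j. (f x - g j x)\<^sup>2) \<longlonglongrightarrow> (f x - h x)\<^sup>2"
    using lim by eventually_elim (intro tendsto_intros)
qed (use f g h in \<open>auto intro!: sq_diff_le_1\<close>)

text \<open>
  Rounding a function with values in \<open>[0, 1]\<close> to the nearest indicator increases
  the distance to the indicator of \<open>A\<close> only by a constant factor: an error at
  \<open>y\<close> requires \<open>\<bar>indicator A y - f y\<bar> \<ge> 1/2\<close>.
\<close>

lemma prob_level_set:
  fixes f :: "'a \<Rightarrow> real"
  assumes f: "f \<in> borel_measurable M" "\<And>x. 0 \<le> f x" "\<And>x. f x \<le> 1" and A: "A \<in> sets M"
  shows "prob (sym_diff A {y \<in> space M. f y > 1/2}) \<le> 4 * (\<integral>y. (indicator A y - f y)\<^sup>2 \<partial>M)"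
proof -
  let ?D = "sym_diff A {y \<in> space M. f y > 1/2}"
  have D: "?D \<in> sets M" using f(1) A by measurable
  have "prob ?D = (\<integral>y. indicator ?D y \<partial>M)" using D by simp
  also have "\<dots> \<le> (\<integral>y. 4 * (indicator A y - f y)\<^sup>2 \<partial>M)"
  proof (rule integral_mono)
    show "integrable M (\<lambda>y. 4 * (indicator A y - f y)\<^sup>2 :: real)"
      using f A by (intro integrable_mult_right integrable_sq_diff) (auto simp: indicator_def)
    fix y assume y: "y \<in> space M"
    show "indicator ?D y \<le> 4 * (indicator A y - f y)\<^sup>2"
    proof (cases "y \<in> ?D")
      case True
      then have "1/2 \<le> \<bar>indicator A y - f y\<bar>"
        using y by (auto simp: indicator_def abs_if)
      then have "(1/2)\<^sup>2 \<le> \<bar>indicator A y - f y\<bar>\<^sup>2" by (rule power_mono) simp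
      then show ?thesis using True by (simp add: power2_eq_square)
    qed simp
  qed (rule integrable_real_indicator[OF D], simp add: less_top[symmetric])
  finally show ?thesis by simp
qed

text \<open>
  Completeness of the space of square-integrable functions, for sequences whose distances are
  controlled by a convergent numerical sequence \<open>E\<close>, with a rate for the distance
  to the limit. Convergence almost everywhere along a subsequence, unlike convergence in mean
  square, passes to the components of a disintegration.
\<close>

lemma bounded_Cauchy_L2_subsequence:
  fixes u :: "nat \<Rightarrow> 'a \<Rightarrow> real"
  assumes u: "\<And>m. u m \<in> borel_measurable M" "\<And>m x. 0 \<le> u m x" "\<And>m x. u m x \<le> 1"
    and E: "E \<longlonglongrightarrow> L" and K: "0 \<le> K"
    and cau: "\<And>m m'. (\<integral>x. (u m x - u m' x)\<^sup>2 \<partial>M) \<le> K * \<bar>E m - E m'\<bar>"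
  obtains v r where "v \<in> borel_measurable M" "\<And>x. 0 \<le> v x" "\<And>x. v x \<le> 1" "strict_mono (r :: nat \<Rightarrow> nat)"
    "AE x in M. (\<lambda>j. u (r j) x) \<longlonglongrightarrow> v x"
    "\<And>m. (\<integral>x. (u m x - v x)\<^sup>2 \<partial>M) \<le> K * \<bar>E m - L\<bar>"
proof -
  have "\<exists>N. \<forall>m\<ge>N. \<forall>m'\<ge>N. K * \<bar>E m - E m'\<bar> \<le> (1/8) ^ j" for j
  proof -
    have "0 < (1/8) ^ j / (K + 1)" using K by simp
    then obtain N where N: "\<And>m m'. m \<ge> N \<Longrightarrow> m' \<ge> N \<Longrightarrow> norm (E m - E m') < (1/8) ^ j / (K + 1)"
      using CauchyD[OF LIMSEQ_imp_Cauchy[OF E]] by blast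
    have "K * \<bar>E m - E m'\<bar> \<le> (1/8) ^ j" if "m \<ge> N" "m' \<ge> N" for m m'
    proof -
      have "K * \<bar>E m - E m'\<bar> \<le> (K + 1) * ((1/8) ^ j / (K + 1))"
        using N[OF that] K by (intro mult_mono) auto
      then show ?thesis using K by simp
    qed
    then show ?thesis by blast
  qed
  then obtain N where N: "\<And>j m m'. m \<ge> N j \<Longrightarrow> m' \<ge> N j \<Longrightarrow> K * \<bar>E m - E m'\<bar> \<le> (1/8) ^ j" by metis
  \<comment> \<open>Squared distances of at most \<open>8^-j\<close> make the events \<open>\<bar>d j\<bar> \<ge> 2^-j\<close> of probability at most \<open>4^j 8^-j = 2^-j\<close>, which is summable.\<close>
  define r where "r j = j + (\<Sum>i\<le>j. N i)" for j
  have r_mono: "strict_mono r" by (rule strict_monoI_Suc) (simp add: r_def)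
  have r_ge: "N j \<le> r j" for j
    unfolding r_def by (rule trans_le_add2, rule member_le_sum) auto
  define d where "d j x = u (r (Suc j)) x - u (r j) x" for j x
  have d_meas [measurable]: "d j \<in> borel_measurable M" for j unfolding d_def using u(1) by measurable
  have "AE x in M. \<forall>\<^sub>F j in sequentially. x \<in> space M - {x \<in> space M. (1/2) ^ j \<le> \<bar>d j x\<bar>}"
  proof (rule borel_cantelli_AE1)
    show "summable (\<lambda>j. prob {x \<in> space M. (1/2) ^ j \<le> \<bar>d j x\<bar>})"
    proof (rule summable_comparison_test_ev[OF always_eventually])
      show "\<forall>j. norm (prob {x \<in> space M. (1/2) ^ j \<le> \<bar>d j x\<bar>}) \<le> (1/2) ^ j"
      proof
        fix j
        let ?D = "{x \<in> space M. (1/2) ^ j \<le> \<bar>d j x\<bar>}"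
        have "prob ?D = (\<integral>x. indicator ?D x \<partial>M)" by simp
        also have "\<dots> \<le> (\<integral>x. 4 ^ j * (d j x)\<^sup>2 \<partial>M)"
        proof (rule integral_mono)
          show "integrable M (\<lambda>x. 4 ^ j * (d j x)\<^sup>2)"
            unfolding d_def by (intro integrable_mult_right integrable_sq_diff u)
          fix x
          show "indicator ?D x \<le> 4 ^ j * (d j x)\<^sup>2"
          proof (cases "x \<in> ?D")
            case True
            then have "((1/2) ^ j)\<^sup>2 \<le> \<bar>d j x\<bar>\<^sup>2" by (intro power_mono) auto
            then have "4 ^ j * ((1/2) ^ j)\<^sup>2 \<le> 4 ^ j * (d j x)\<^sup>2" by (intro mult_left_mono) auto
            moreover have "(4::real) ^ j * ((1/2) ^ j)\<^sup>2 = 1"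
            proof -
              have "(4::real) ^ j * ((1/2) ^ j)\<^sup>2 = 4 ^ j * ((1/2)\<^sup>2) ^ j"
                by (simp only: power_mult[symmetric] mult.commute)
              also have "\<dots> = (4 * (1/2)\<^sup>2) ^ j" by (simp only: power_mult_distrib)
              finally show ?thesis by (simp add: power2_eq_square)
            qed
            ultimately show ?thesis using True by simp
          qed simp
        qed (simp add: less_top[symmetric])
        also have "\<dots> = 4 ^ j * (\<integral>x. (d j x)\<^sup>2 \<partial>M)" by simp
        also have "\<dots> \<le> 4 ^ j * (1/8) ^ j"
        proof (rule mult_left_mono)
          have "r j \<le> r (Suc j)" using r_mono by (simp add: strict_mono_less_eq)
          then have "K * \<bar>E (r (Suc j)) - E (r j)\<bar> \<le> (1/8) ^ j" using r_ge[of j] by (intro N) auto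
          then show "(\<integral>x. (d j x)\<^sup>2 \<partial>M) \<le> (1/8) ^ j"
            using cau[of "r (Suc j)" "r j"] unfolding d_def by linarith
        qed simp
        also have "\<dots> = (1/2) ^ j" by (simp add: power_mult_distrib[symmetric])
        finally show "norm (prob ?D) \<le> (1/2) ^ j" by simp
      qed
    qed simp
  qed (auto simp: less_top[symmetric])
  then have conv: "AE x in M. convergent (\<lambda>j. u (r j) x)"
  proof eventually_elim
    case (elim x)
    then have "\<forall>\<^sub>F j in sequentially. norm (d j x) \<le> (1/2) ^ j"
      by eventually_elim auto
    then have "summable (\<lambda>j. d j x)"
      by (rule summable_comparison_test_ev) simp
    then have "convergent (\<lambda>n. \<Sum>j<n. d j x)" by (simp add: summable_iff_convergent)
    moreover have "(\<Sum>j<n. d j x) = u (r n) x - u (r 0) x" for n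
      by (induction n) (auto simp: d_def)
    ultimately have "convergent (\<lambda>n. u (r 0) x + (u (r n) x - u (r 0) x))"
      by (intro convergent_add convergent_const) simp
    then show ?case by simp
  qed
  define v where "v x = max 0 (min 1 (lim (\<lambda>j. u (r j) x)))" for x
  have [measurable]: "u m \<in> borel_measurable M" for m by (rule u(1))
  have v: "v \<in> borel_measurable M" unfolding v_def by measurable
  have v01: "0 \<le> v x" "v x \<le> 1" for x unfolding v_def by auto
  have lim: "AE x in M. (\<lambda>j. u (r j) x) \<longlonglongrightarrow> v x"
    using conv
  proof eventually_elim
    case (elim x)
    then have l: "(\<lambda>j. u (r j) x) \<longlonglongrightarrow> lim (\<lambda>j. u (r j) x)" by (simp add: convergent_LIMSEQ_iff)
    have "0 \<le> lim (\<lambda>j. u (r j) x)" by (rule LIMSEQ_le_const[OF l]) (use u in auto)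
    moreover have "lim (\<lambda>j. u (r j) x) \<le> 1" by (rule LIMSEQ_le_const2[OF l]) (use u in auto)
    ultimately show ?case using l by (simp add: v_def)
  qed
  have "(\<integral>x. (u m x - v x)\<^sup>2 \<partial>M) \<le> K * \<bar>E m - L\<bar>" for m
  proof (rule LIMSEQ_le)
    show "(\<lambda>j. \<integral>x. (u m x - u (r j) x)\<^sup>2 \<partial>M) \<longlonglongrightarrow> (\<integral>x. (u m x - v x)\<^sup>2 \<partial>M)"
      by (rule integral_sq_diff_tendsto) (use u v v01 lim in auto)
    have "(\<lambda>j. E (r j)) \<longlonglongrightarrow> L" using LIMSEQ_subseq_LIMSEQ[OF E r_mono] by (simp add: comp_def)
    then show "(\<lambda>j. K * \<bar>E m - E (r j)\<bar>) \<longlonglongrightarrow> K * \<bar>E m - L\<bar>" by (intro tendsto_intros)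
  qed (use cau in auto)
  with v v01 r_mono lim show ?thesis by (intro that)
qed

lemma sq_diff_triangle3: "((a::real) - d)\<^sup>2 \<le> 3 * ((a - b)\<^sup>2 + (b - c)\<^sup>2 + (c - d)\<^sup>2)"
proof -
  have "0 \<le> ((a - b) - (b - c))\<^sup>2 + ((b - c) - (c - d))\<^sup>2 + ((a - b) - (c - d))\<^sup>2" by simp
  then show ?thesis by (simp add: power2_eq_square algebra_simps)
qed

lemma integral_sq_diff_triangle3:
  fixes a b c d :: "'a \<Rightarrow> real"
  assumes "a \<in> borel_measurable M" "\<And>x. 0 \<le> a x" "\<And>x. a x \<le> 1"
    "b \<in> borel_measurable M" "\<And>x. 0 \<le> b x" "\<And>x. b x \<le> 1"
    "c \<in> borel_measurable M" "\<And>x. 0 \<le> c x" "\<And>x. c x \<le> 1"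
    "d \<in> borel_measurable M" "\<And>x. 0 \<le> d x" "\<And>x. d x \<le> 1"
  shows "(\<integral>x. (a x - d x)\<^sup>2 \<partial>M) \<le> 3 * ((\<integral>x. (a x - b x)\<^sup>2 \<partial>M) + (\<integral>x. (b x - c x)\<^sup>2 \<partial>M) + (\<integral>x. (c x - d x)\<^sup>2 \<partial>M))"
proof -
  have i: "integrable M (\<lambda>x. (a x - b x)\<^sup>2)" "integrable M (\<lambda>x. (b x - c x)\<^sup>2)" "integrable M (\<lambda>x. (c x - d x)\<^sup>2)"
    by (intro integrable_sq_diff assms)+
  have "(\<integral>x. (a x - d x)\<^sup>2 \<partial>M) \<le> (\<integral>x. 3 * ((a x - b x)\<^sup>2 + (b x - c x)\<^sup>2 + (c x - d x)\<^sup>2) \<partial>M)"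
    by (intro integral_mono sq_diff_triangle3 integrable_mult_right Bochner_Integration.integrable_add i integrable_sq_diff assms)
  then show ?thesis using i by simp
qed

text \<open>
  The situation of conditional probabilities given the coordinates from \<open>n\<close> to
  \<open>m\<close>: the energies increase in \<open>m\<close> and decrease in \<open>n\<close>,
  so both limits exist by orthogonality. This is the mean-square form of the forward and
  backward martingale convergence theorems.
\<close>

lemma double_L2_limit:
  fixes u :: "nat \<Rightarrow> nat \<Rightarrow> 'a \<Rightarrow> real"
  assumes u: "\<And>n m. u n m \<in> borel_measurable M" "\<And>n m x. 0 \<le> u n m x" "\<And>n m x. u n m x \<le> 1"
    and pyth_m: "\<And>n m m'. m \<le> m' \<Longrightarrow> (\<integral>x. (u n m' x - u n m x)\<^sup>2 \<partial>M) = (\<integral>x. (u n m' x)\<^sup>2 \<partial>M) - (\<integral>x. (u n m x)\<^sup>2 \<partial>M)"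
    and pyth_n: "\<And>n n' m. n \<le> n' \<Longrightarrow> (\<integral>x. (u n m x - u n' m x)\<^sup>2 \<partial>M) = (\<integral>x. (u n m x)\<^sup>2 \<partial>M) - (\<integral>x. (u n' m x)\<^sup>2 \<partial>M)"
  obtains g e r s where "g \<in> borel_measurable M" "\<And>x. 0 \<le> g x" "\<And>x. g x \<le> 1"
    "\<And>n. e n \<in> borel_measurable M" "\<And>n x. 0 \<le> e n x" "\<And>n x. e n x \<le> 1"
    "\<And>n. strict_mono (r n :: nat \<Rightarrow> nat)" "strict_mono (s :: nat \<Rightarrow> nat)"
    "\<And>n. AE x in M. (\<lambda>j. u n (r n j) x) \<longlonglongrightarrow> e n x" "AE x in M. (\<lambda>j. e (s j) x) \<longlonglongrightarrow> g x"
proof -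
  define E where "E n m = (\<integral>x. (u n m x)\<^sup>2 \<partial>M)" for n m
  have nonneg: "0 \<le> (\<integral>x. (f x :: real)\<^sup>2 \<partial>M)" for f by simp
  have E01: "0 \<le> E n m" "E n m \<le> 1" for n m
  proof -
    show "0 \<le> E n m" unfolding E_def by simp
    have "integrable M (\<lambda>x. (u n m x - 0)\<^sup>2)" by (rule integrable_sq_diff) (use u in auto)
    then have "E n m \<le> (\<integral>x. 1 \<partial>M)" unfolding E_def
      by (intro integral_mono) (use sq_diff_le_1[of "u n m _" 0] u in auto)
    then show "E n m \<le> 1" by (simp add: prob_space)
  qed
  have E_m: "E n m \<le> E n m'" if "m \<le> m'" for n m m'
    using pyth_m[OF that, of n] nonneg[of "\<lambda>x. u n m' x - u n m x"] unfolding E_def by linarith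
  have E_n: "E n' m \<le> E n m" if "n \<le> n'" for n n' m
    using pyth_n[OF that, of m] nonneg[of "\<lambda>x. u n m x - u n' m x"] unfolding E_def by linarith
  have "\<exists>L. E n \<longlonglongrightarrow> L" for n
  proof -
    have "incseq (E n)" using E_m by (auto simp: incseq_def)
    then show ?thesis using incseq_convergent[of "E n" 1] E01(2) by metis
  qed
  then obtain L where L: "\<And>n. E n \<longlonglongrightarrow> L n" by metis
  have cau: "(\<integral>x. (u n m x - u n m' x)\<^sup>2 \<partial>M) \<le> 1 * \<bar>E n m - E n m'\<bar>" for n m m'
  proof (cases "m \<le> m'")
    case True
    then show ?thesis using pyth_m[OF True, of n] unfolding E_def by (simp add: power2_commute)
  next
    case False
    then show ?thesis using pyth_m[of m' m n] unfolding E_def by simp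
  qed
  define ok where "ok n v r \<longleftrightarrow> v \<in> borel_measurable M \<and> (\<forall>x. 0 \<le> v x) \<and> (\<forall>x. v x \<le> 1) \<and>
      strict_mono (r :: nat \<Rightarrow> nat) \<and> (AE x in M. (\<lambda>j. u n (r j) x) \<longlonglongrightarrow> v x) \<and>
      (\<forall>m. (\<integral>x. (u n m x - v x)\<^sup>2 \<partial>M) \<le> 1 * \<bar>E n m - L n\<bar>)" for n v r
  have "\<exists>v r. ok n v r" for n
    unfolding ok_def by (rule bounded_Cauchy_L2_subsequence[OF u L zero_le_one cau]) blast
  then obtain e r where ok: "\<And>n. ok n (e n) (r n)" by metis
  have e: "\<And>n. e n \<in> borel_measurable M" "\<And>n x. 0 \<le> e n x" "\<And>n x. e n x \<le> 1"
    and r: "\<And>n. strict_mono (r n)" "\<And>n. AE x in M. (\<lambda>j. u n (r n j) x) \<longlonglongrightarrow> e n x"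
    and ue: "\<And>n m. (\<integral>x. (u n m x - e n x)\<^sup>2 \<partial>M) \<le> 1 * \<bar>E n m - L n\<bar>"
    using ok unfolding ok_def by auto
  have L_dec: "L n' \<le> L n" if "n \<le> n'" for n n'
    by (rule LIMSEQ_le[OF L L]) (use E_n[OF that] in auto)
  have L0: "0 \<le> L n" for n by (rule LIMSEQ_le_const[OF L]) (use E01 in auto)
  have "decseq L" using L_dec by (auto simp: decseq_def)
  then obtain LL where LL: "L \<longlonglongrightarrow> LL" using decseq_convergent[of L 0] L0 by metis
  have cau2: "(\<integral>x. (e n x - e n' x)\<^sup>2 \<partial>M) \<le> 3 * \<bar>L n - L n'\<bar>" for n n'
  proof (rule LIMSEQ_le[OF tendsto_const])
    show "(\<lambda>m. 3 * (\<bar>E n m - L n\<bar> + \<bar>E n m - E n' m\<bar> + \<bar>E n' m - L n'\<bar>)) \<longlonglongrightarrow> 3 * \<bar>L n - L n'\<bar>"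
    proof -
      have "(\<lambda>m. 3 * (\<bar>E n m - L n\<bar> + \<bar>E n m - E n' m\<bar> + \<bar>E n' m - L n'\<bar>)) \<longlonglongrightarrow>
        3 * (\<bar>L n - L n\<bar> + \<bar>L n - L n'\<bar> + \<bar>L n' - L n'\<bar>)"
        by (intro tendsto_intros L)
      then show ?thesis by simp
    qed
    have "(\<integral>x. (e n x - e n' x)\<^sup>2 \<partial>M) \<le> 3 * (\<bar>E n m - L n\<bar> + \<bar>E n m - E n' m\<bar> + \<bar>E n' m - L n'\<bar>)" for m
    proof -
      have "(\<integral>x. (e n x - e n' x)\<^sup>2 \<partial>M) \<le> 3 * ((\<integral>x. (e n x - u n m x)\<^sup>2 \<partial>M) +
          (\<integral>x. (u n m x - u n' m x)\<^sup>2 \<partial>M) + (\<integral>x. (u n' m x - e n' x)\<^sup>2 \<partial>M))"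
        by (intro integral_sq_diff_triangle3 e u)
      moreover have "(\<integral>x. (e n x - u n m x)\<^sup>2 \<partial>M) \<le> \<bar>E n m - L n\<bar>"
        using ue[of n m] by (simp add: power2_commute)
      moreover have "(\<integral>x. (u n' m x - e n' x)\<^sup>2 \<partial>M) \<le> \<bar>E n' m - L n'\<bar>"
        using ue[of n' m] by simp
      moreover have "(\<integral>x. (u n m x - u n' m x)\<^sup>2 \<partial>M) \<le> \<bar>E n m - E n' m\<bar>"
      proof (cases "n \<le> n'")
        case True
        then show ?thesis using pyth_n[OF True, of m] unfolding E_def by simp
      next
        case False
        then show ?thesis using pyth_n[of n' n m] unfolding E_def by (simp add: power2_commute)
      qed
      ultimately show ?thesis by (auto intro: order_trans)
    qed
    then show "\<exists>N. \<forall>m\<ge>N. (\<integral>x. (e n x - e n' x)\<^sup>2 \<partial>M) \<le> 3 * (\<bar>E n m - L n\<bar> + \<bar>E n m - E n' m\<bar> + \<bar>E n' m - L n'\<bar>)"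
      by blast
  qed
  obtain g s where g: "g \<in> borel_measurable M" "\<And>x. 0 \<le> g x" "\<And>x. g x \<le> 1" "strict_mono (s :: nat \<Rightarrow> nat)"
    "AE x in M. (\<lambda>j. e (s j) x) \<longlonglongrightarrow> g x"
    by (rule bounded_Cauchy_L2_subsequence[OF e LL _ cau2]) auto
  show ?thesis by (rule that[OF g(1-3) e r(1) g(4) r(2) g(5)])
qed

end

section \<open>Conditional probabilities given the tail of a process\<close>

context stationary begin

lemma cprob_comp_measurable:
  "simple_function M Y \<Longrightarrow> (\<lambda>y. cprob M Y B (Y y)) \<in> borel_measurable M"
  using borel_measurable_simple_function[OF simple_function_compose[of M Y "cprob M Y B"]] by (simp add: comp_def)

lemma cent_block_1:
  assumes X: "simple_function M X"
  shows "cent M X (block T X 1 (m + 1)) = ent M (block T X 0 (m + 1)) - ent M (block T X 0 m)"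
proof -
  have "cent M X (block T X 1 (m + 1)) = cent M (block T X 0 1) (block T X 1 (m + 1))"
    by (rule cent_cong) (auto simp: coarser_def block_def[of T X 0])
  then show ?thesis using cent_block_split[OF X, of 1 m] by simp
qed

text \<open>
  \<open>g\<close> is a version of the conditional probability of \<open>B\<close> given the
  tail of \<open>X\<close>: \<open>e n\<close> is the conditional probability given all
  coordinates from \<open>n\<close> on, obtained along the end points \<open>r n j\<close>. The
  subsequences are part of the notion because convergence in mean square gives almost sure
  convergence only along them.
\<close>

definition tail_limit :: "('a \<Rightarrow> 'b) \<Rightarrow> 'a set \<Rightarrow> ('a \<Rightarrow> real) \<Rightarrow> bool" where
  "tail_limit X B g \<longleftrightarrow> (\<exists>e r s.
     (\<forall>n. e n \<in> borel_measurable M) \<and> (\<forall>n y. 0 \<le> e n y \<and> e n y \<le> (1 :: real)) \<and>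
     (\<forall>n. strict_mono (r n :: nat \<Rightarrow> nat)) \<and> strict_mono (s :: nat \<Rightarrow> nat) \<and>
     (\<forall>n. AE y in M. (\<lambda>j. cprob M (block T X n (r n j)) B (block T X n (r n j) y)) \<longlonglongrightarrow> e n y) \<and>
     (AE y in M. (\<lambda>j. e (s j) y) \<longlonglongrightarrow> g y))"

text \<open>
  For every \<open>n0\<close> the approximations, and therefore \<open>g\<close> up to a null
  set, are measurable with respect to the completed future from time \<open>n0\<close>, so the
  level sets of \<open>g\<close> are tail events.
\<close>

lemma tail_limit_level_in_pinsker:
  assumes X: "simple_function M X" and g: "g \<in> borel_measurable M" and tl: "tail_limit X B g"
  shows "{y \<in> space M. g y > c} \<in> pinsker M T"
proof (rule tail_subset_pinsker[OF X])
  fix n0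
  obtain e r s where e: "\<And>n. e n \<in> borel_measurable M"
    and r: "\<And>n. strict_mono (r n)" and s: "strict_mono s"
    and er: "\<And>n. AE y in M. (\<lambda>j. cprob M (block T X n (r n j)) B (block T X n (r n j) y)) \<longlonglongrightarrow> e n y"
    and gs: "AE y in M. (\<lambda>j. e (s j) y) \<longlonglongrightarrow> g y"
    using tl unfolding tail_limit_def by blast
  let ?c = "\<lambda>n m y. cprob M (block T X n m) B (block T X n m y)"
  have fsub: "future X n0 \<subseteq> sets M" by (auto simp: future_def)
  have sa: "sigma_algebra (space M) (approximable M (future X n0))"
    by (rule sigma_algebra_approximable[OF algebra_future fsub])
  define N where "N = sigma (space M) (approximable M (future X n0))"
  have setsN: "sets N = approximable M (future X n0)" and spN [simp]: "space N = space M"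
    unfolding N_def using sigma_algebra.sets_measure_of_eq[OF sa] sigma_algebra.space_measure_of_eq[OF sa] by auto
  have cm: "?c n m \<in> borel_measurable N" if "n0 \<le> n" for n m
  proof (rule measurableI)
    fix S :: "real set" assume "S \<in> sets borel"
    have "?c n m -` S \<inter> space M \<in> future X n0"
      unfolding future_def
    proof safe
      show "?c n m -` S \<inter> space M \<in> sets M"
        using measurable_sets[OF cprob_comp_measurable[OF simple_function_block[OF X]] \<open>S \<in> sets borel\<close>] .
      have "coarser M (\<lambda>y. y \<in> ?c n m -` S \<inter> space M) (block T X n m)"
        by (auto simp: coarser_def)
      then have "coarser M (\<lambda>y. y \<in> ?c n m -` S \<inter> space M) (block T X n0 m)"
        by (rule coarser_trans) (intro coarser_block_mono that order_refl)
      then show "\<exists>m'. coarser M (\<lambda>y. y \<in> ?c n m -` S \<inter> space M) (block T X n0 m')" by blast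
    qed
    moreover have "future X n0 \<subseteq> approximable M (future X n0)"
    proof
      fix A assume A: "A \<in> future X n0"
      have "\<exists>D\<in>future X n0. prob (sym_diff A D) < \<epsilon>" if "0 < \<epsilon>" for \<epsilon>
        using that by (intro bexI[OF _ A]) simp
      then show "A \<in> approximable M (future X n0)" using fsub A unfolding approximable_def by blast
    qed
    ultimately show "?c n m -` S \<inter> space N \<in> sets N" unfolding setsN spN by blast
  qed simp
  define e' where "e' n y = lim (\<lambda>j. ?c n (r n j) y)" for n y
  have e'm: "e' n \<in> borel_measurable N" if "n0 \<le> n" for n
    unfolding e'_def by (intro borel_measurable_lim_metric cm that)
  \<comment> \<open>The indices \<open>s (j + n0)\<close> are at least \<open>n0\<close>, and so only the future from time \<open>n0\<close> enters.\<close>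
  define g' where "g' y = lim (\<lambda>j. e' (s (j + n0)) y)" for y
  have "n0 \<le> s (j + n0)" for j using seq_suble[OF s, of "j + n0"] by simp
  then have g'm: "g' \<in> borel_measurable N"
    unfolding g'_def by (intro borel_measurable_lim_metric e'm)
  have "AE y in M. \<forall>n. (\<lambda>j. ?c n (r n j) y) \<longlonglongrightarrow> e n y"
    using er by (simp add: AE_all_countable)
  then have gg: "AE y in M. g' y = g y" using gs
  proof eventually_elim
    case (elim y)
    have "e' n y = e n y" for n unfolding e'_def using elim(1) by (auto intro: limI)
    moreover have "(\<lambda>j. e (s (j + n0)) y) \<longlonglongrightarrow> g y" by (rule LIMSEQ_ignore_initial_segment[OF elim(2)])
    ultimately show "g' y = g y" unfolding g'_def by (simp add: limI)
  qed
  have "{y \<in> space N. g' y > c} \<in> sets N" using g'm by measurable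
  then have L': "{y \<in> space M. g' y > c} \<in> approximable M (future X n0)" unfolding setsN spN .
  then have L'm: "{y \<in> space M. g' y > c} \<in> sets M" by (simp add: approximable_def)
  have Lm: "{y \<in> space M. g y > c} \<in> sets M" using g by measurable
  show "{y \<in> space M. g y > c} \<in> approximable M (future X n0)"
    unfolding approximable_def
  proof safe
    fix \<epsilon> :: real assume "0 < \<epsilon>"
    with L' obtain D where D: "D \<in> future X n0" "prob (sym_diff {y \<in> space M. g' y > c} D) < \<epsilon>"
      unfolding approximable_def by blast
    have Dm: "D \<in> sets M" using D(1) fsub by blast
    have "prob (sym_diff {y \<in> space M. g y > c} D) = prob (sym_diff {y \<in> space M. g' y > c} D)"
      using gg Lm L'm Dm by (intro finite_measure_eq_AE) auto
    with D show "\<exists>D\<in>future X n0. prob (sym_diff {y \<in> space M. g y > c} D) < \<epsilon>"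
      by (intro bexI[of _ D]) simp_all
  qed (rule Lm)
qed

text \<open>
  If the Pinsker set \<open>A\<close> is close to a set \<open>B\<close> determined by
  \<open>X\<close>, then the indicator of \<open>A\<close> is close to its conditional
  probability given the block from \<open>0\<close> to \<open>m\<close>, which by
  \<open>pinsker_conditional_on_future\<close> is close to the one given the block from
  \<open>n\<close> to \<open>m\<close>; there \<open>A\<close> may be replaced by
  \<open>B\<close>, since conditioning is a contraction.
\<close>

lemma tail_limit_close_to_pinsker:
  assumes X: "simple_function M X" and A: "A \<in> pinsker M T" and B: "B \<in> sets M"
    and co: "coarser M (\<lambda>y. y \<in> B) X"
    and g: "g \<in> borel_measurable M" and tl: "tail_limit X B g"
  defines "d \<equiv> prob (sym_diff A B)"
  shows "(\<integral>y. (indicator A y - g y)\<^sup>2 \<partial>M) \<le> 3 * (eta d + eta (1 - d) + d)"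
proof -
  obtain e r s where e: "\<And>n. e n \<in> borel_measurable M" "\<And>n y. 0 \<le> e n y" "\<And>n y. e n y \<le> 1"
    and r: "\<And>n. strict_mono (r n)" and s: "strict_mono s"
    and er: "\<And>n. AE y in M. (\<lambda>j. cprob M (block T X n (r n j)) B (block T X n (r n j) y)) \<longlonglongrightarrow> e n y"
    and gs: "AE y in M. (\<lambda>j. e (s j) y) \<longlonglongrightarrow> g y"
    using tl unfolding tail_limit_def by blast
  have Am: "A \<in> sets M" using A by (simp add: pinsker_eq)
  let ?c = "\<lambda>A n m y. cprob M (block T X n m) A (block T X n m y)"
  let ?\<delta> = "\<lambda>n m. \<integral>y. (?c A 0 m y - ?c A n m y)\<^sup>2 \<partial>M"
  note bl = simple_function_block[OF X]
  note c = cprob_comp_measurable[OF bl] cprob_nonneg cprob_le_1[OF bl]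
  have ind: "indicator A \<in> borel_measurable M" "\<And>y. 0 \<le> (indicator A y :: real)" "\<And>y. indicator A y \<le> (1 :: real)"
    using Am by (auto simp: indicator_def)
  have 1: "(\<integral>y. (indicator A y - ?c A 0 m y)\<^sup>2 \<partial>M) \<le> eta d + eta (1 - d)" if "1 \<le> m" for m
  proof -
    have "coarser M X (block T X 0 m)" using coarser_block[of 0 0 m M X T] that by simp
    then have "cent M (\<lambda>y. y \<in> A) (block T X 0 m) \<le> eta d + eta (1 - d)"
      unfolding d_def by (intro cent_mem_le_sym_diff Am B bl coarser_trans[OF co])
    with cent_mem_ge_residual[OF Am bl, of 0 m] show ?thesis by (rule order_trans)
  qed
  have 2: "(\<integral>y. (?c A n m y - ?c B n m y)\<^sup>2 \<partial>M) \<le> d" for n m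
  proof -
    have "(\<integral>y. (?c A n m y - ?c B n m y)\<^sup>2 \<partial>M) \<le> (\<integral>y. \<bar>?c A n m y - ?c B n m y\<bar> \<partial>M)"
    proof (rule integral_mono)
      show "integrable M (\<lambda>y. (?c A n m y - ?c B n m y)\<^sup>2)" by (intro integrable_sq_diff c)
      show "integrable M (\<lambda>y. \<bar>?c A n m y - ?c B n m y\<bar>)"
        by (rule integrable_simple_comp[OF bl, of "\<lambda>w. \<bar>cprob M _ A w - cprob M _ B w\<bar>"])
      fix y
      have "\<bar>?c A n m y - ?c B n m y\<bar> \<le> 1"
        using c(2)[of "block T X n m" A "block T X n m y"] c(2)[of "block T X n m" B "block T X n m y"]
          c(3)[of n m A "block T X n m y"] c(3)[of n m B "block T X n m y"] by linarith
      then have "\<bar>?c A n m y - ?c B n m y\<bar> * \<bar>?c A n m y - ?c B n m y\<bar> \<le> \<bar>?c A n m y - ?c B n m y\<bar> * 1"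
        by (intro mult_left_mono) auto
      then show "(?c A n m y - ?c B n m y)\<^sup>2 \<le> \<bar>?c A n m y - ?c B n m y\<bar>"
        by (simp add: power2_eq_square abs_mult_self_eq)
    qed
    also have "\<dots> \<le> d" unfolding d_def by (rule cprob_contraction[OF bl Am B])
    finally show ?thesis .
  qed
  have 3: "(\<integral>y. (indicator A y - ?c B n m y)\<^sup>2 \<partial>M) \<le> 3 * (eta d + eta (1 - d) + ?\<delta> n m + d)" if "1 \<le> m" for n m
  proof (rule order_trans)
    show "(\<integral>y. (indicator A y - ?c B n m y)\<^sup>2 \<partial>M) \<le> 3 * ((\<integral>y. (indicator A y - ?c A 0 m y)\<^sup>2 \<partial>M) + ?\<delta> n m
      + (\<integral>y. (?c A n m y - ?c B n m y)\<^sup>2 \<partial>M))"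
      by (intro integral_sq_diff_triangle3 ind c)
  qed (intro mult_left_mono add_mono 1[OF that] 2 order_refl, simp)
  have 4: "(\<integral>y. (indicator A y - e n y)\<^sup>2 \<partial>M) \<le> 3 * (eta d + eta (1 - d) + d)" for n
  proof (rule LIMSEQ_le)
    show "(\<lambda>j. \<integral>y. (indicator A y - ?c B n (r n j) y)\<^sup>2 \<partial>M) \<longlonglongrightarrow> (\<integral>y. (indicator A y - e n y)\<^sup>2 \<partial>M)"
      by (rule integral_sq_diff_tendsto[OF ind c e(1) er])
    have "(\<lambda>j. ?\<delta> n (r n j)) \<longlonglongrightarrow> 0"
      using LIMSEQ_subseq_LIMSEQ[OF pinsker_conditional_on_future[OF X A, of n] r[of n]] by (simp add: comp_def)
    then have "(\<lambda>j. 3 * (eta d + eta (1 - d) + ?\<delta> n (r n j) + d)) \<longlonglongrightarrow> 3 * (eta d + eta (1 - d) + 0 + d)"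
      by (intro tendsto_intros)
    then show "(\<lambda>j. 3 * (eta d + eta (1 - d) + ?\<delta> n (r n j) + d)) \<longlonglongrightarrow> 3 * (eta d + eta (1 - d) + d)" by simp
    show "\<exists>N. \<forall>j\<ge>N. (\<integral>y. (indicator A y - ?c B n (r n j) y)\<^sup>2 \<partial>M) \<le> 3 * (eta d + eta (1 - d) + ?\<delta> n (r n j) + d)"
    proof (intro exI allI impI 3)
      fix j :: nat assume "1 \<le> j"
      then show "1 \<le> r n j" using seq_suble[OF r[of n], of j] by linarith
    qed
  qed
  show ?thesis
  proof (rule LIMSEQ_le_const2)
    show "(\<lambda>j. \<integral>y. (indicator A y - e (s j) y)\<^sup>2 \<partial>M) \<longlonglongrightarrow> (\<integral>y. (indicator A y - g y)\<^sup>2 \<partial>M)"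
      by (rule integral_sq_diff_tendsto[OF ind e g gs])
  qed (use 4 in blast)
qed

end

section \<open>Disintegration over the ergodic components\<close>

locale ergodic_system =
  fixes M :: "'a measure" and T :: "'a \<Rightarrow> 'a" and \<kappa> :: "'a \<Rightarrow> 'a measure"
  assumes mps: "invertible_mps M T" and dec: "ergodic_decomposition M T \<kappa>"

sublocale ergodic_system \<subseteq> stationary M T
  using mps unfolding invertible_mps_def invariant_under_def
  by (auto intro!: stationary.intro simp: stationary_axioms_def)

lemma standard_borel_generating_sequence:
  assumes "standard_borel M"
  obtains U :: "nat \<Rightarrow> 'a set" where "range U \<subseteq> Pow (space M)" "sets M = sigma_sets (space M) (range U)"
proof -
  obtain S where S: "second_countable S" "topspace S = space M" "sets M = sigma_sets (topspace S) {U. openin S U}"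
    using assms unfolding standard_borel_def by blast
  obtain B where B: "countable B" "\<And>V. V \<in> B \<Longrightarrow> openin S V"
    "\<And>U x. openin S U \<Longrightarrow> x \<in> U \<Longrightarrow> \<exists>V\<in>B. x \<in> V \<and> V \<subseteq> U"
    using S(1)[unfolded second_countable_def] by (elim exE conjE) (rule that, auto)
  define U where "U = from_nat_into (insert {} B)"
  have rU: "range U = insert {} B"
    unfolding U_def using B(1) by (intro range_from_nat_into) auto
  have sub: "range U \<subseteq> Pow (space M)"
  proof -
    have "V \<subseteq> space M" if "V \<in> B" for V using openin_subset[OF B(2)[OF that]] S(2) by simp
    then show ?thesis unfolding rU by auto
  qed
  have "sigma_sets (topspace S) {U. openin S U} = sigma_sets (topspace S) (range U)"
  proof (rule sigma_sets_eqI)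
    fix W assume "W \<in> {U. openin S U}"
    then have W: "W = \<Union>{V \<in> B. V \<subseteq> W}" using B(3) by blast
    have "\<Union>{V \<in> B. V \<subseteq> W} \<in> sigma_sets (topspace S) (range U)"
      by (intro sigma_sets_UNION countable_subset[OF _ B(1)]) (auto simp: rU)
    with W show "W \<in> sigma_sets (topspace S) (range U)" by simp
  next
    fix W assume "W \<in> range U"
    then have "openin S W" unfolding rU using B(2) by auto
    then show "W \<in> sigma_sets (topspace S) {U. openin S U}" by auto
  qed
  with S sub show ?thesis by (intro that) auto
qed

context ergodic_system begin

definition \<I> :: "'a measure" where "\<I> = sigma (space M) (invariant_sets M T)"

lemma sigma_algebra_invariant_sets: "sigma_algebra (space M) (invariant_sets M T)"
proof -
  have sp: "T y \<in> space M" if "y \<in> space M" for y using T_meas that by (rule measurable_space)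
  show ?thesis
    unfolding sigma_algebra_iff2
  proof (intro conjI ballI allI impI)
    show "invariant_sets M T \<subseteq> Pow (space M)"
      using sets.sets_into_space by (auto simp: invariant_sets_def)
    fix A assume "A \<in> invariant_sets M T"
    then show "space M - A \<in> invariant_sets M T" using sp by (auto simp: invariant_sets_def)
  next
    fix A :: "nat \<Rightarrow> 'a set" assume "range A \<subseteq> invariant_sets M T"
    then have "A i \<in> sets M" "T -` A i \<inter> space M = A i" for i by (auto simp: invariant_sets_def)
    moreover have "T -` (\<Union>i. A i) \<inter> space M = (\<Union>i. T -` A i \<inter> space M)" by auto
    ultimately show "(\<Union>i. A i) \<in> invariant_sets M T" by (auto simp: invariant_sets_def)
  qed (auto simp: invariant_sets_def)
qed

lemma sets_\<I>: "sets \<I> = invariant_sets M T" and space_\<I> [simp]: "space \<I> = space M"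
  unfolding \<I>_def
  using sigma_algebra.sets_measure_of_eq[OF sigma_algebra_invariant_sets]
    sigma_algebra.space_measure_of_eq[OF sigma_algebra_invariant_sets] by auto

lemma subalgebra_\<I>: "subalgebra M \<I>"
  unfolding subalgebra_def sets_\<I> by (auto simp: invariant_sets_def)

sublocale I: finite_measure_subalgebra M \<I>
  by unfold_locales (rule subalgebra_\<I>)

lemma kernel [measurable]: "\<kappa> \<in> M \<rightarrow>\<^sub>M prob_algebra M"
  using dec by (simp add: ergodic_decomposition_def)

lemma kernel_subprob [measurable]: "\<kappa> \<in> M \<rightarrow>\<^sub>M subprob_algebra M"
  by (rule measurable_prob_algebraD[OF kernel])

lemma
  assumes "x \<in> space M"
  shows sets_\<kappa>: "sets (\<kappa> x) = sets M" and space_\<kappa>: "space (\<kappa> x) = space M"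
    and stationary_\<kappa>: "stationary (\<kappa> x) T"
proof -
  have "\<kappa> x \<in> space (prob_algebra M)" using measurable_space[OF kernel assms] .
  then show s: "sets (\<kappa> x) = sets M" by (simp add: space_prob_algebra)
  then show "space (\<kappa> x) = space M" by (rule sets_eq_imp_space_eq)
  have "ergodic_under T (\<kappa> x)" using dec assms by (simp add: ergodic_decomposition_def)
  then show "stationary (\<kappa> x) T"
    by (auto simp: ergodic_under_def invariant_under_def stationary_def stationary_axioms_def)
qed

lemma prob_space_\<kappa>: "x \<in> space M \<Longrightarrow> prob_space (\<kappa> x)"
  using stationary_\<kappa> by (rule stationary.axioms)

lemma cond_exp_\<I>: "integrable M f \<Longrightarrow> AE x in M. real_cond_exp M \<I> f x = (\<integral>y. f y \<partial>\<kappa> x)"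
  using dec unfolding ergodic_decomposition_def \<I>_def by blast

lemma kernel_integral_measurable:
  "(f :: 'a \<Rightarrow> real) \<in> borel_measurable M \<Longrightarrow> (\<lambda>x. \<integral>y. f y \<partial>\<kappa> x) \<in> borel_measurable M"
  using measurable_compose[OF kernel_subprob integral_measurable_subprob_algebra] .

lemma kernel_measure_measurable:
  "A \<in> sets M \<Longrightarrow> (\<lambda>x. measure (\<kappa> x) A) \<in> borel_measurable M"
  using measurable_compose[OF kernel measurable_measure_prob_algebra] .

lemma integral_disintegrate:
  fixes f :: "'a \<Rightarrow> real"
  assumes f: "integrable M f"
  shows "(\<integral>x. (\<integral>y. f y \<partial>\<kappa> x) \<partial>M) = (\<integral>x. f x \<partial>M)"
proof -
  have "(\<integral>x. (\<integral>y. f y \<partial>\<kappa> x) \<partial>M) = (\<integral>x. real_cond_exp M \<I> f x \<partial>M)"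
    using cond_exp_\<I>[OF f] f
    by (intro integral_cong_AE kernel_integral_measurable borel_measurable_integrable I.real_cond_exp_int) auto
  then show ?thesis using I.real_cond_exp_int[OF f] by simp
qed

lemma measure_disintegrate:
  assumes A: "A \<in> sets M"
  shows "prob A = (\<integral>x. measure (\<kappa> x) A \<partial>M)"
proof -
  have "(\<integral>x. measure (\<kappa> x) A \<partial>M) = (\<integral>x. (\<integral>y. indicator A y \<partial>\<kappa> x) \<partial>M)"
    using A by (intro Bochner_Integration.integral_cong refl) (simp add: sets_\<kappa> space_\<kappa> Int_absorb2 sets.sets_into_space)
  also have "\<dots> = (\<integral>x. indicator A x \<partial>M)"
    using A by (intro integral_disintegrate) (simp add: less_top[symmetric])
  finally show ?thesis using A by simp
qed

lemma bind_kernel: "M \<bind> \<kappa> = M"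
proof (rule measure_eqI)
  have ne: "space M \<noteq> {}" by (rule not_empty)
  have s: "sets (M \<bind> \<kappa>) = sets M" using ne by (intro sets_bind) (auto simp: sets_\<kappa>)
  then show "sets (M \<bind> \<kappa>) = sets M" .
  fix A assume "A \<in> sets (M \<bind> \<kappa>)"
  then have A: "A \<in> sets M" using s by simp
  have "emeasure (M \<bind> \<kappa>) A = (\<integral>\<^sup>+ x. emeasure (\<kappa> x) A \<partial>M)"
    by (rule emeasure_bind[OF ne kernel_subprob A])
  also have "\<dots> = (\<integral>\<^sup>+ x. ennreal (measure (\<kappa> x) A) \<partial>M)"
  proof (rule nn_integral_cong)
    fix x assume "x \<in> space M"
    then interpret k: prob_space "\<kappa> x" by (rule prob_space_\<kappa>)
    show "emeasure (\<kappa> x) A = ennreal (measure (\<kappa> x) A)" by (rule k.emeasure_eq_measure)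
  qed
  also have "\<dots> = ennreal (\<integral>x. measure (\<kappa> x) A \<partial>M)"
    by (intro nn_integral_eq_integral integrable_bounded[where B=1] kernel_measure_measurable A)
      (auto intro: prob_space.prob_le_1[OF prob_space_\<kappa>])
  finally show "emeasure (M \<bind> \<kappa>) A = emeasure M A"
    by (simp add: measure_disintegrate[OF A, symmetric] emeasure_eq_measure)
qed

lemma AE_disintegrate_pred:
  "Measurable.pred M P \<Longrightarrow> (AE x in M. P x) \<longleftrightarrow> (AE x in M. AE y in \<kappa> x. P y)"
  using AE_bind[OF kernel_subprob, of P] unfolding bind_kernel .

lemma AE_disintegrate:
  assumes "AE x in M. P x" shows "AE x in M. AE y in \<kappa> x. P y"
proof -
  obtain N where N: "N \<in> null_sets M" "{x \<in> space M. \<not> P x} \<subseteq> N"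
    using assms by (auto simp: eventually_ae_filter)
  have "AE x in M. x \<notin> N" by (rule AE_not_in[OF N(1)])
  then have "AE x in M. AE y in \<kappa> x. y \<notin> N"
    using N(1) by (subst (asm) AE_disintegrate_pred) auto
  then show ?thesis
    using AE_space
  proof eventually_elim
    case (elim x)
    from elim(1) AE_space show ?case
    proof eventually_elim
      case (elim y)
      then show ?case using N(2) space_\<kappa>[OF \<open>x \<in> space M\<close>] by auto
    qed
  qed
qed

lemma integrable_disintegrate:
  fixes f :: "'a \<Rightarrow> real"
  assumes f: "integrable M f"
  shows "AE x in M. integrable (\<kappa> x) f"
proof -
  have fm [measurable]: "f \<in> borel_measurable M" using f by simp
  have "(\<integral>\<^sup>+ x. (\<integral>\<^sup>+ y. ennreal (norm (f y)) \<partial>\<kappa> x) \<partial>M) = (\<integral>\<^sup>+ y. ennreal (norm (f y)) \<partial>(M \<bind> \<kappa>))"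
    by (rule nn_integral_bind[OF _ kernel_subprob, symmetric]) simp
  also have "\<dots> \<noteq> \<infinity>" unfolding bind_kernel using f by (simp add: integrable_iff_bounded)
  finally have "AE x in M. (\<integral>\<^sup>+ y. ennreal (norm (f y)) \<partial>\<kappa> x) \<noteq> \<infinity>"
    by (intro nn_integral_PInf_AE measurable_compose[OF kernel_subprob nn_integral_measurable_subprob_algebra]) auto
  then show ?thesis using AE_space
    by eventually_elim (auto simp: integrable_iff_bounded less_top measurable_cong_sets[OF sets_\<kappa> refl])
qed

text \<open>
  The function \<open>v y = measure (\<kappa> y) B\<close> is a version of an invariant
  function, hence so is its square. So conditioning on the invariant sets fixes both, which
  means that under \<open>\<kappa> x\<close> the function \<open>v\<close> has mean \<open>v
  x\<close> and second moment \<open>(v x)^2\<close>, i.e. variance zero.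
\<close>

lemma kernel_measure_constant:
  assumes B: "B \<in> sets M"
  shows "AE x in M. AE y in \<kappa> x. measure (\<kappa> y) B = measure (\<kappa> x) B"
proof -
  let ?v = "\<lambda>x. measure (\<kappa> x) B"
  let ?u = "real_cond_exp M \<I> (indicator B)"
  have v: "?v \<in> borel_measurable M" by (rule kernel_measure_measurable[OF B])
  have v1: "?v x \<le> 1" if "x \<in> space M" for x using prob_space.prob_le_1[OF prob_space_\<kappa>[OF that]] .
  have iv: "integrable M ?v" "integrable M (\<lambda>x. (?v x)\<^sup>2)"
    using v v1 by (auto intro!: integrable_bounded[where B=1] simp: power_le_one)
  have iB: "integrable M (indicator B :: 'a \<Rightarrow> real)" using B by (simp add: less_top[symmetric])
  have um: "?u \<in> borel_measurable \<I>" by simp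
  have uM: "?u \<in> borel_measurable M" by simp
  have uv: "AE x in M. ?u x = ?v x"
    using cond_exp_\<I>[OF iB] AE_space
    by eventually_elim (use B in \<open>simp add: sets_\<kappa> space_\<kappa> Int_absorb2 sets.sets_into_space\<close>)
  have E: "AE x in M. (\<integral>y. \<phi> (?v y) \<partial>\<kappa> x) = \<phi> (?v x)"
    if \<phi>: "integrable M (\<lambda>x. \<phi> (?v x))" "\<phi> \<in> borel_measurable borel" for \<phi> :: "real \<Rightarrow> real"
  proof -
    note [measurable] = um uM v \<phi>(2)
    have eq: "AE x in M. \<phi> (?u x) = \<phi> (?v x)" using uv by eventually_elim simp
    have iu: "integrable M (\<lambda>x. \<phi> (?u x))"
      using \<phi>(1) by (rule integrable_cong_AE_imp) (use eq in auto)
    have "AE x in M. real_cond_exp M \<I> (\<lambda>x. \<phi> (?u x)) x = \<phi> (?u x)"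
      by (rule I.real_cond_exp_F_meas[OF iu]) measurable
    moreover have "AE x in M. real_cond_exp M \<I> (\<lambda>x. \<phi> (?u x)) x = real_cond_exp M \<I> (\<lambda>x. \<phi> (?v x)) x"
      by (rule I.real_cond_exp_cong[OF eq]) measurable
    ultimately show ?thesis using cond_exp_\<I>[OF \<phi>(1)] eq by eventually_elim simp
  qed
  from E[of "\<lambda>t. t"] E[of "\<lambda>t. t\<^sup>2"] iv
  have "AE x in M. (\<integral>y. ?v y \<partial>\<kappa> x) = ?v x" "AE x in M. (\<integral>y. (?v y)\<^sup>2 \<partial>\<kappa> x) = (?v x)\<^sup>2" by auto
  then show ?thesis using AE_space
  proof eventually_elim
    case (elim x)
    interpret k: prob_space "\<kappa> x" by (rule prob_space_\<kappa>) fact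
    have m [measurable]: "?v \<in> borel_measurable (\<kappa> x)"
      using v by (simp add: measurable_cong_sets[OF sets_\<kappa>[OF elim(3)] refl])
    have i: "integrable (\<kappa> x) ?v" "integrable (\<kappa> x) (\<lambda>y. (?v y)\<^sup>2)"
      by (rule k.integrable_bounded[where B=1], use v1 in \<open>auto simp: power_le_one space_\<kappa>[OF elim(3)]\<close>)+
    have isq: "integrable (\<kappa> x) (\<lambda>y. (?v y - ?v x)\<^sup>2)"
      using i by (simp add: power2_diff)
    have "(\<integral>y. (?v y - ?v x)\<^sup>2 \<partial>\<kappa> x) = (\<integral>y. (?v y)\<^sup>2 \<partial>\<kappa> x) + (?v x)\<^sup>2 - 2 * (\<integral>y. ?v y \<partial>\<kappa> x) * ?v x"
      using i by (simp add: power2_diff k.prob_space)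
    also have "\<dots> = 0" using elim by (simp add: power2_eq_square)
    finally have "AE y in \<kappa> x. (?v y - ?v x)\<^sup>2 = 0"
      using integral_nonneg_eq_0_iff_AE[OF isq] by simp
    then show ?case by eventually_elim simp
  qed
qed

text \<open>
  An arbitrary but fixed sequence generating the measurable sets. Its itineraries are the
  increasing finite partitions whose tails are used below.
\<close>

definition gen :: "nat \<Rightarrow> 'a set" where
  "gen = (SOME U. range U \<subseteq> Pow (space M) \<and> sets M = sigma_sets (space M) (range U))"

lemma gen: "range gen \<subseteq> Pow (space M)" "sets M = sigma_sets (space M) (range gen)"
proof -
  have "standard_borel M" using mps by (simp add: invertible_mps_def)
  then have "\<exists>U :: nat \<Rightarrow> 'a set. range U \<subseteq> Pow (space M) \<and> sets M = sigma_sets (space M) (range U)"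
    by (metis standard_borel_generating_sequence)
  from someI_ex[OF this] show "range gen \<subseteq> Pow (space M)" "sets M = sigma_sets (space M) (range gen)"
    unfolding gen_def by blast+
qed

abbreviation cyl :: "nat \<Rightarrow> 'a set set" where "cyl \<equiv> cylinders (space M) gen"

lemma gen_sets: "gen j \<in> sets M" unfolding gen(2) by auto

lemma cyl_sets: "cyl k \<subseteq> sets M"
  by (rule cylinders_subset_sets) (rule gen_sets)

lemma sets_eq_cyl: "sets M = sigma_sets (space M) (\<Union>k. cyl k)"
  unfolding gen(2) by (rule sigma_sets_cylinders[OF gen(1), symmetric])

text \<open>
  The fundamental consistency of the decomposition: evaluating \<open>\<kappa>\<close> at a
  \<open>\<kappa> x\<close>-typical point gives back \<open>\<kappa> x\<close>. It allows a
  function of \<open>(\<kappa> y, y)\<close> to be treated, on almost every component, as a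
  function of \<open>y\<close> for a fixed measure.
\<close>

lemma kernel_constant: "AE x in M. AE y in \<kappa> x. \<kappa> y = \<kappa> x"
proof -
  have "AE x in M. \<forall>B\<in>(\<Union>k. cyl k). AE y in \<kappa> x. measure (\<kappa> y) B = measure (\<kappa> x) B"
    unfolding AE_ball_countable[OF countable_cylinders]
  proof
    fix B assume "B \<in> (\<Union>k. cyl k)"
    then have "B \<in> sets M" using cyl_sets by blast
    then show "AE x in M. AE y in \<kappa> x. measure (\<kappa> y) B = measure (\<kappa> x) B"
      by (rule kernel_measure_constant)
  qed
  then show ?thesis using AE_space
  proof eventually_elim
    case (elim x)
    from elim(1) have "AE y in \<kappa> x. \<forall>B\<in>(\<Union>k. cyl k). measure (\<kappa> y) B = measure (\<kappa> x) B"
      unfolding AE_ball_countable[OF countable_cylinders] .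
    then show ?case using AE_space
    proof eventually_elim
      case (elim y)
      have xy: "x \<in> space M" "y \<in> space M" using \<open>x \<in> space M\<close> elim(2) by (auto simp: space_\<kappa>)
      interpret kx: prob_space "\<kappa> x" by (rule prob_space_\<kappa>) fact
      interpret ky: prob_space "\<kappa> y" by (rule prob_space_\<kappa>) fact
      show ?case
      proof (rule measure_eqI_generator_eq[OF Int_stable_cylinders, where A="\<lambda>_. space M"])
        show "(\<Union>k. cyl k) \<subseteq> Pow (space M)" using cyl_sets sets.sets_into_space by blast
        show "range (\<lambda>_. space M) \<subseteq> (\<Union>k. cyl k)" by (auto simp: cylinders_def)
        fix B assume "B \<in> (\<Union>k. cyl k)"
        then show "emeasure (\<kappa> y) B = emeasure (\<kappa> x) B"
          unfolding kx.emeasure_eq_measure ky.emeasure_eq_measure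
          by (rule arg_cong[OF bspec[OF elim(1)]])
      qed (auto simp: sets_\<kappa>[OF xy(1)] sets_\<kappa>[OF xy(2)] sets_eq_cyl)
    qed
  qed
qed

lemma approximable_cyl:
  assumes N: "prob_space N" "sets N = sets M" and A: "A \<in> sets M"
  shows "A \<in> approximable N (\<Union>k. cyl k)"
proof -
  interpret N: prob_space N by fact
  have sp: "space N = space M" using N(2) by (rule sets_eq_imp_space_eq)
  have "sigma_algebra (space M) (approximable N (\<Union>k. cyl k))"
    using N.sigma_algebra_approximable[of "\<Union>k. cyl k"] algebra_cylinders[of "space M" gen] cyl_sets
    unfolding sp N(2) by blast
  moreover have "(\<Union>k. cyl k) \<subseteq> approximable N (\<Union>k. cyl k)"
  proof
    fix B assume B: "B \<in> (\<Union>k. cyl k)"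
    then have "B \<in> sets N" using cyl_sets N(2) by blast
    moreover have "\<exists>D\<in>(\<Union>k. cyl k). N.prob (sym_diff B D) < \<epsilon>" if "0 < \<epsilon>" for \<epsilon>
      using that by (intro bexI[OF _ B]) simp
    ultimately show "B \<in> approximable N (\<Union>k. cyl k)" unfolding approximable_def by blast
  qed
  ultimately have "sigma_sets (space M) (\<Union>k. cyl k) \<subseteq> approximable N (\<Union>k. cyl k)"
    by (rule sigma_algebra.sigma_sets_subset)
  then show ?thesis using A sets_eq_cyl by auto
qed

end

section \<open>Conditional probabilities on the components\<close>

context ergodic_system begin

lemma simple_function_\<kappa>: "x \<in> space M \<Longrightarrow> simple_function M Y \<Longrightarrow> simple_function (\<kappa> x) Y"
  using simple_function_cong_algebra[OF sets_\<kappa> space_\<kappa>, of x Y] by simp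

lemma coarser_\<kappa>: "x \<in> space M \<Longrightarrow> coarser M X Y \<Longrightarrow> coarser (\<kappa> x) X Y"
  unfolding coarser_def by (simp only: space_\<kappa>)

text \<open>
  The conditional probability at \<open>y\<close>, computed with respect to the component of
  \<open>y\<close> itself. By \<open>kernel_constant\<close> this one function is a version for
  almost every component simultaneously. The value \<open>0\<close> outside the space keeps it
  within \<open>[0, 1]\<close> everywhere.
\<close>

definition fibre_cprob :: "('a \<Rightarrow> 'b) \<Rightarrow> 'a set \<Rightarrow> 'a \<Rightarrow> real" where
  "fibre_cprob Y B y = (if y \<in> space M then cprob (\<kappa> y) Y B (Y y) else 0)"

lemma fibre_cprob_measurable:
  assumes Y: "simple_function M Y" and B: "B \<in> sets M"
  shows "fibre_cprob Y B \<in> borel_measurable M"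
proof -
  let ?c = "\<lambda>w. {z \<in> space M. Y z = w}"
  have c: "?c w \<in> sets M" for w by (rule simple_function_cell[OF Y])
  have "(\<lambda>y. \<Sum>w\<in>Y ` space M. indicator (?c w) y * (measure (\<kappa> y) (B \<inter> ?c w) / measure (\<kappa> y) (?c w))) \<in> borel_measurable M"
    using c B by (intro borel_measurable_sum borel_measurable_times borel_measurable_divide kernel_measure_measurable
      borel_measurable_indicator sets.Int)
  also have "?this \<longleftrightarrow> ?thesis"
  proof (rule measurable_cong)
    fix y assume y: "y \<in> space M"
    have "(\<Sum>w\<in>Y ` space M. indicator (?c w) y * (measure (\<kappa> y) (B \<inter> ?c w) / measure (\<kappa> y) (?c w))) =
      (\<Sum>w\<in>Y ` space M. if w = Y y then measure (\<kappa> y) (B \<inter> ?c w) / measure (\<kappa> y) (?c w) else 0)"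
      using y by (intro sum.cong) (auto simp: indicator_def)
    also have "\<dots> = measure (\<kappa> y) (B \<inter> ?c (Y y)) / measure (\<kappa> y) (?c (Y y))"
      using y simple_functionD(1)[OF Y] by (subst sum.delta) auto
    finally show "(\<Sum>w\<in>Y ` space M. indicator (?c w) y * (measure (\<kappa> y) (B \<inter> ?c w) / measure (\<kappa> y) (?c w))) = fibre_cprob Y B y"
      using y by (simp add: fibre_cprob_def cprob_def space_\<kappa>)
  qed
  finally show ?thesis .
qed

lemma fibre_cprob_nonneg: "0 \<le> fibre_cprob Y B y"
  by (simp add: fibre_cprob_def cprob_def)

lemma fibre_cprob_le_1:
  assumes "simple_function M Y" shows "fibre_cprob Y B y \<le> 1"
proof (cases "y \<in> space M")
  case True
  then show ?thesis
    using prob_space.cprob_le_1[OF prob_space_\<kappa> simple_function_\<kappa>[OF _ assms], OF True True, of B "Y y"]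
    by (simp add: fibre_cprob_def)
qed (simp add: fibre_cprob_def)

lemma fibre_cprob_eq:
  "x \<in> space M \<Longrightarrow> y \<in> space (\<kappa> x) \<Longrightarrow> \<kappa> y = \<kappa> x \<Longrightarrow> fibre_cprob Y B y = cprob (\<kappa> x) Y B (Y y)"
  by (simp add: fibre_cprob_def space_\<kappa>)

lemma fibre_cprob_AE:
  assumes "x \<in> space M" "AE y in \<kappa> x. \<kappa> y = \<kappa> x"
  shows "AE y in \<kappa> x. fibre_cprob Y B y = cprob (\<kappa> x) Y B (Y y)"
  using assms(2) AE_space by eventually_elim (rule fibre_cprob_eq[OF assms(1)])

lemma fibre_integral_cong:
  fixes \<phi> :: "real \<Rightarrow> real \<Rightarrow> real"
  assumes x: "x \<in> space M" "AE y in \<kappa> x. \<kappa> y = \<kappa> x" and Y: "simple_function M Y" "simple_function M Y'"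
    and B: "B \<in> sets M" and \<phi>: "(\<lambda>(s, t). \<phi> s t) \<in> borel_measurable (borel \<Otimes>\<^sub>M borel)"
  shows "(\<integral>y. \<phi> (fibre_cprob Y B y) (fibre_cprob Y' B y) \<partial>\<kappa> x) =
    (\<integral>y. \<phi> (cprob (\<kappa> x) Y B (Y y)) (cprob (\<kappa> x) Y' B (Y' y)) \<partial>\<kappa> x)"
proof (rule integral_cong_AE)
  have m1 [measurable]: "fibre_cprob Y B \<in> borel_measurable (\<kappa> x)" "fibre_cprob Y' B \<in> borel_measurable (\<kappa> x)"
    unfolding measurable_cong_sets[OF sets_\<kappa>[OF x(1)] refl] by (intro fibre_cprob_measurable Y B)+
  show "(\<lambda>y. \<phi> (fibre_cprob Y B y) (fibre_cprob Y' B y)) \<in> borel_measurable (\<kappa> x)"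
    using measurable_compose[OF measurable_Pair[OF m1] \<phi>] by simp
  have "simple_function (\<kappa> x) (\<lambda>y. \<phi> (cprob (\<kappa> x) Y B (Y y)) (cprob (\<kappa> x) Y' B (Y' y)))"
    by (rule simple_function_compose2[OF simple_function_\<kappa>[OF x(1) Y(1)] simple_function_\<kappa>[OF x(1) Y(2)], of "\<lambda>a b. \<phi> (cprob (\<kappa> x) Y B a) (cprob (\<kappa> x) Y' B b)"])
  then show "(\<lambda>y. \<phi> (cprob (\<kappa> x) Y B (Y y)) (cprob (\<kappa> x) Y' B (Y' y))) \<in> borel_measurable (\<kappa> x)"
    by (rule borel_measurable_simple_function)
  show "AE y in \<kappa> x. \<phi> (fibre_cprob Y B y) (fibre_cprob Y' B y) = \<phi> (cprob (\<kappa> x) Y B (Y y)) (cprob (\<kappa> x) Y' B (Y' y))"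
    using fibre_cprob_AE[OF x, of Y B] fibre_cprob_AE[OF x, of Y' B] by eventually_elim simp
qed

text \<open>
  The identity holds on almost every component and is integrated over the components.
\<close>

lemma fibre_pythagoras:
  assumes Y: "simple_function M Y" and Y': "simple_function M Y'" and B: "B \<in> sets M" and co: "coarser M Y' Y"
  shows "(\<integral>y. (fibre_cprob Y B y - fibre_cprob Y' B y)\<^sup>2 \<partial>M) =
    (\<integral>y. (fibre_cprob Y B y)\<^sup>2 \<partial>M) - (\<integral>y. (fibre_cprob Y' B y)\<^sup>2 \<partial>M)"
proof -
  note m [measurable] = fibre_cprob_measurable[OF Y B] fibre_cprob_measurable[OF Y' B]
  have sq: "\<bar>(fibre_cprob Y B y)\<^sup>2\<bar> \<le> 1" if "simple_function M Y" for Y :: "'a \<Rightarrow> 'd" and y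
    using fibre_cprob_nonneg[of Y B y] fibre_cprob_le_1[OF that, of B y] by (simp add: power_le_one)
  have i: "integrable M (\<lambda>y. (fibre_cprob Y B y)\<^sup>2)" "integrable M (\<lambda>y. (fibre_cprob Y' B y)\<^sup>2)"
    "integrable M (\<lambda>y. (fibre_cprob Y B y - fibre_cprob Y' B y)\<^sup>2)"
    by (rule integrable_bounded[where B=1], use sq[OF Y] in simp, use sq[OF Y] in simp)
      (rule integrable_bounded[where B=1], use sq[OF Y'] in simp, use sq[OF Y'] in simp,
       intro integrable_sq_diff m fibre_cprob_nonneg fibre_cprob_le_1 Y Y')
  have ix: "integrable M (\<lambda>x. \<integral>y. f y \<partial>\<kappa> x)" if "f \<in> borel_measurable M" "\<And>y. \<bar>f y\<bar> \<le> 1" for f :: "'a \<Rightarrow> real"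
  proof (rule integrable_bounded[where B=1])
    show "(\<lambda>x. \<integral>y. f y \<partial>\<kappa> x) \<in> borel_measurable M" by (rule kernel_integral_measurable) fact
    fix x assume x: "x \<in> space M"
    interpret k: prob_space "\<kappa> x" by (rule prob_space_\<kappa>[OF x])
    have "integrable (\<kappa> x) f"
      using that by (intro k.integrable_bounded[where B=1]) (simp_all add: measurable_cong_sets[OF sets_\<kappa>[OF x] refl])
    then have "\<bar>\<integral>y. f y \<partial>\<kappa> x\<bar> \<le> (\<integral>y. 1 \<partial>\<kappa> x)"
      using that(2) by (intro order_trans[OF integral_abs_bound] integral_mono) auto
    then show "\<bar>\<integral>y. f y \<partial>\<kappa> x\<bar> \<le> 1" by (simp add: k.prob_space)
  qed
  have "AE x in M. (\<integral>y. (fibre_cprob Y B y - fibre_cprob Y' B y)\<^sup>2 \<partial>\<kappa> x) =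
    (\<integral>y. (fibre_cprob Y B y)\<^sup>2 \<partial>\<kappa> x) - (\<integral>y. (fibre_cprob Y' B y)\<^sup>2 \<partial>\<kappa> x)"
    using kernel_constant AE_space
  proof eventually_elim
    case (elim x)
    note c = fibre_integral_cong[OF elim(2,1) Y Y' B]
    show ?case
      using c[of "\<lambda>s t. (s - t)\<^sup>2"] c[of "\<lambda>s t. s\<^sup>2"] c[of "\<lambda>s t. t\<^sup>2"]
        prob_space.cprob_pythagoras[OF prob_space_\<kappa>[OF elim(2)] simple_function_\<kappa>[OF elim(2) Y] simple_function_\<kappa>[OF elim(2) Y'] _ coarser_\<kappa>[OF elim(2) co], of B]
        B sets_\<kappa>[OF elim(2)] by simp
  qed
  then have "(\<integral>x. (\<integral>y. (fibre_cprob Y B y - fibre_cprob Y' B y)\<^sup>2 \<partial>\<kappa> x) \<partial>M) =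
    (\<integral>x. (\<integral>y. (fibre_cprob Y B y)\<^sup>2 \<partial>\<kappa> x) - (\<integral>y. (fibre_cprob Y' B y)\<^sup>2 \<partial>\<kappa> x) \<partial>M)"
    by (intro integral_cong_AE borel_measurable_diff kernel_integral_measurable) auto
  also have "\<dots> = (\<integral>x. (\<integral>y. (fibre_cprob Y B y)\<^sup>2 \<partial>\<kappa> x) \<partial>M) - (\<integral>x. (\<integral>y. (fibre_cprob Y' B y)\<^sup>2 \<partial>\<kappa> x) \<partial>M)"
    by (intro Bochner_Integration.integral_diff ix) (use sq[OF Y] sq[OF Y'] in auto)
  finally show ?thesis unfolding integral_disintegrate[OF i(1)] integral_disintegrate[OF i(2)] integral_disintegrate[OF i(3)] .
qed

section \<open>Pinsker sets of the system and of its components\<close>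

text \<open>
  Entropy is a concave function of the measure, by the tangent inequality at the mean
  \<open>prob A = \<integral>x. measure (\<kappa> x) A \<partial>M\<close>.
\<close>

lemma
  assumes W: "simple_function M W"
  shows integrable_ent_\<kappa>: "integrable M (\<lambda>x. ent (\<kappa> x) W)"
    and integral_ent_\<kappa>_le: "(\<integral>x. ent (\<kappa> x) W \<partial>M) \<le> ent M W"
proof -
  let ?c = "\<lambda>v. {y \<in> space M. W y = v}"
  have c: "?c v \<in> sets M" for v by (rule simple_function_cell[OF W])
  have eq: "ent (\<kappa> x) W = (\<Sum>v\<in>W ` space M. eta (measure (\<kappa> x) (?c v)))" if "x \<in> space M" for x
    unfolding ent_def space_\<kappa>[OF that] ..
  have b: "\<bar>eta (measure (\<kappa> x) A)\<bar> \<le> 1" if "x \<in> space M" for x A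
    using eta_nonneg[OF measure_nonneg prob_space.prob_le_1[OF prob_space_\<kappa>[OF that]]]
      eta_le_1[OF measure_nonneg] by simp
  have i: "integrable M (\<lambda>x. eta (measure (\<kappa> x) (?c v)))" for v
    by (rule integrable_bounded[where B=1])
      (use b in \<open>auto intro!: measurable_compose[OF _ eta_measurable] kernel_measure_measurable c\<close>)
  have "integrable M (\<lambda>x. \<Sum>v\<in>W ` space M. eta (measure (\<kappa> x) (?c v)))"
    by (intro Bochner_Integration.integrable_sum i)
  then show "integrable M (\<lambda>x. ent (\<kappa> x) W)"
    using eq by (subst Bochner_Integration.integrable_cong[OF refl]) auto
  have le: "(\<integral>x. eta (measure (\<kappa> x) (?c v)) \<partial>M) \<le> eta (prob (?c v))" for v
  proof (cases "prob (?c v) = 0")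
    case True
    have m: "(\<lambda>x. measure (\<kappa> x) (?c v)) \<in> borel_measurable M" by (rule kernel_measure_measurable[OF c])
    have "integrable M (\<lambda>x. measure (\<kappa> x) (?c v))"
      by (rule integrable_bounded[where B=1, OF m]) (auto intro: prob_space.prob_le_1[OF prob_space_\<kappa>])
    from integral_nonneg_eq_0_iff_AE[OF this AE_I2[OF measure_nonneg]]
    have "AE x in M. measure (\<kappa> x) (?c v) = 0"
      unfolding measure_disintegrate[OF c, symmetric] using True by blast
    then have z: "AE x in M. eta (measure (\<kappa> x) (?c v)) = 0"
      by eventually_elim simp
    have "(\<integral>x. eta (measure (\<kappa> x) (?c v)) \<partial>M) = (\<integral>x. 0 \<partial>M)"
      by (rule integral_cong_AE[OF measurable_compose[OF m eta_measurable] _ z]) simp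
    with True show ?thesis by simp
  next
    case False
    then have s: "0 < prob (?c v)" by (simp add: zero_less_measure_iff)
    let ?s = "prob (?c v)"
    have m: "integrable M (\<lambda>x. measure (\<kappa> x) (?c v))"
      by (rule integrable_bounded[where B=1, OF kernel_measure_measurable[OF c]])
        (auto intro: prob_space.prob_le_1[OF prob_space_\<kappa>])
    have "(\<integral>x. eta (measure (\<kappa> x) (?c v)) \<partial>M) \<le> (\<integral>x. eta ?s - (ln ?s + 1) * (measure (\<kappa> x) (?c v) - ?s) \<partial>M)"
    proof (rule integral_mono[OF i])
      show "integrable M (\<lambda>x. eta ?s - (ln ?s + 1) * (measure (\<kappa> x) (?c v) - ?s))" using m by simp
      fix x assume x: "x \<in> space M"
      show "eta (measure (\<kappa> x) (?c v)) \<le> eta ?s - (ln ?s + 1) * (measure (\<kappa> x) (?c v) - ?s)"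
        using eta_tangent[OF s prob_le_1 measure_nonneg prob_space.prob_le_1[OF prob_space_\<kappa>[OF x]], of "?c v"]
          zero_le_power2[of "measure (\<kappa> x) (?c v) - ?s"] by linarith
    qed
    also have "\<dots> = eta ?s"
      using m measure_disintegrate[OF c[of v]] by (simp add: prob_space)
    finally show ?thesis .
  qed
  have "(\<integral>x. ent (\<kappa> x) W \<partial>M) = (\<integral>x. (\<Sum>v\<in>W ` space M. eta (measure (\<kappa> x) (?c v))) \<partial>M)"
    by (intro Bochner_Integration.integral_cong refl eq)
  also have "\<dots> = (\<Sum>v\<in>W ` space M. \<integral>x. eta (measure (\<kappa> x) (?c v)) \<partial>M)"
    by (intro Bochner_Integration.integral_sum i)
  also have "\<dots> \<le> ent M W" unfolding ent_def by (intro sum_mono le)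
  finally show "(\<integral>x. ent (\<kappa> x) W \<partial>M) \<le> ent M W" .
qed

text \<open>
  By concavity the mean entropy rate of the components is at most the entropy rate of the
  system.
\<close>

lemma pinsker_imp_pinsker_\<kappa>:
  assumes "A \<in> pinsker M T"
  shows "AE x in M. A \<in> pinsker (\<kappa> x) T"
proof -
  let ?E = "\<lambda>y. y \<in> A"
  let ?h = "\<lambda>x. stationary.entropy_rate (\<kappa> x) T ?E"
  let ?b = "\<lambda>m. block T ?E 0 m"
  have A: "A \<in> sets M" and h0: "entropy_rate ?E = 0" using assms by (auto simp: pinsker_eq)
  note E = simple_function_mem[OF A]
  have lim: "(\<lambda>m. ent (\<kappa> x) (?b m) / real m) \<longlonglongrightarrow> ?h x" if "x \<in> space M" for x
    by (rule stationary.entropy_rate_tendsto[OF stationary_\<kappa> simple_function_\<kappa>[OF _ E]]) (use that in auto)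
  have nonneg: "0 \<le> ?h x" if "x \<in> space M" for x
    by (rule stationary.entropy_rate_nonneg[OF stationary_\<kappa> simple_function_\<kappa>[OF _ E]]) (use that in auto)
  have le: "real m * ?h x \<le> ent (\<kappa> x) (?b m)" if "x \<in> space M" for x m
  proof -
    interpret k: stationary "\<kappa> x" T by (rule stationary_\<kappa>[OF that])
    show ?thesis using k.entropy_increment_ge[OF simple_function_\<kappa>[OF that E], of m 0] by simp
  qed
  have meas: "?h \<in> borel_measurable M"
    by (rule borel_measurable_LIMSEQ_real[OF lim])
      (auto intro!: borel_measurable_divide borel_measurable_integrable integrable_ent_\<kappa> simple_function_block E)
  have int: "integrable M ?h"
    by (rule Bochner_Integration.integrable_bound[OF integrable_ent_\<kappa>[OF simple_function_block[OF E, of 0 1]] meas])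
      (use le[of _ 1] nonneg in \<open>auto intro!: AE_I2 order_trans[OF _ abs_ge_self]\<close>)
  have "(\<integral>x. ?h x \<partial>M) \<le> 0"
  proof (rule LIMSEQ_le_const[OF entropy_rate_tendsto[OF E, unfolded h0]], intro exI allI impI)
    fix m :: nat assume m: "1 \<le> m"
    have "real m * (\<integral>x. ?h x \<partial>M) = (\<integral>x. real m * ?h x \<partial>M)" by simp
    also have "\<dots> \<le> (\<integral>x. ent (\<kappa> x) (?b m) \<partial>M)"
      by (intro integral_mono integrable_mult_right int integrable_ent_\<kappa> simple_function_block E le)
    also have "\<dots> \<le> ent M (?b m)" by (intro integral_ent_\<kappa>_le simple_function_block E)
    finally show "(\<integral>x. ?h x \<partial>M) \<le> ent M (?b m) / real m" using m by (simp add: pos_le_divide_eq mult.commute)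
  qed
  moreover have "0 \<le> (\<integral>x. ?h x \<partial>M)" by (intro integral_nonneg_AE AE_I2 nonneg)
  ultimately have "AE x in M. ?h x = 0"
    using integral_nonneg_eq_0_iff_AE[OF int AE_I2[OF nonneg]] by simp
  then show ?thesis using AE_space
    by eventually_elim (use A in \<open>simp add: stationary.pinsker_eq[OF stationary_\<kappa>] sets_\<kappa>\<close>)
qed

end

context ergodic_system begin

text \<open>
  Entropy zero on a component means that visits to \<open>A\<close> at times \<open>1, ...,
  m\<close> nearly determine \<open>A\<close>: the conditional probability \<open>F\<close> of
  \<open>A\<close> given these visits, computed in the component, tends to the indicator of
  \<open>A\<close>. The set \<open>F > 1/2\<close> depends on the visits and on the component,
  and on each of the finitely many cells of the visits the dependence on the component is an
  invariant set. Let \<open>Z\<close> record the membership in these invariant sets. Since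
  \<open>Z \<circ> T = Z\<close>, the values of the process \<open>(1_A, Z)\<close> at times
  \<open>1, ..., m\<close> determine \<open>Z\<close> and nearly determine \<open>A\<close>, so
  this process, and with it the process of visits to \<open>A\<close>, has small entropy rate.
\<close>

lemma pinsker_\<kappa>_imp_pinsker:
  assumes A: "A \<in> sets M" and AE_pinsker: "AE x in M. A \<in> pinsker (\<kappa> x) T"
  shows "A \<in> pinsker M T"
proof -
  let ?E = "\<lambda>y. y \<in> A"
  note E = simple_function_mem[OF A]
  let ?Y = "\<lambda>m. block T ?E 1 (m + 1)"
  note Y = simple_function_block[OF E]
  let ?D = "\<lambda>m. \<integral>y. (indicator A y - fibre_cprob (?Y m) A y)\<^sup>2 \<partial>M"
  let ?i = "\<lambda>m x. \<integral>y. (indicator A y - fibre_cprob (?Y m) A y)\<^sup>2 \<partial>\<kappa> x"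
  have ind: "(indicator A :: 'a \<Rightarrow> real) \<in> borel_measurable M" "\<And>y. 0 \<le> (indicator A y :: real)" "\<And>y. indicator A y \<le> (1 :: real)"
    using A by (auto simp: indicator_def)
  note F = fibre_cprob_measurable[OF Y A] fibre_cprob_nonneg fibre_cprob_le_1[OF Y]
  have sqm: "(\<lambda>y. (indicator A y - fibre_cprob (?Y m) A y)\<^sup>2) \<in> borel_measurable M" for m
    using ind(1) F(1)[of 1 "m + 1"] by measurable
  have sq1: "(indicator A y - fibre_cprob (?Y m) A y)\<^sup>2 \<le> 1" for y m
    by (intro sq_diff_le_1 ind F)
  have "(\<lambda>m. \<integral>x. ?i m x \<partial>M) \<longlonglongrightarrow> (\<integral>x. 0 \<partial>M)"
  proof (rule integral_dominated_convergence[where w="\<lambda>_. 1"])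
    show "AE x in M. (\<lambda>m. ?i m x) \<longlonglongrightarrow> 0"
      using AE_pinsker kernel_constant AE_space
    proof eventually_elim
      case (elim x)
      interpret k: stationary "\<kappa> x" T by (rule stationary_\<kappa>) fact
      have kE: "simple_function (\<kappa> x) ?E" by (rule simple_function_\<kappa>[OF elim(3) E])
      have h0: "k.entropy_rate ?E = 0" and kA: "A \<in> sets (\<kappa> x)" using elim(1) by (auto simp: k.pinsker_eq)
      let ?d = "\<lambda>m. ent (\<kappa> x) (block T ?E 0 (m + 1)) - ent (\<kappa> x) (block T ?E 0 m)"
      have d0: "?d \<longlonglongrightarrow> 0" using k.entropy_increment_tendsto[OF kE, of 1] h0 by simp
      have le: "?i m x \<le> ?d m" for m
      proof -
        have "?i m x = (\<integral>y. (indicator A y - cprob (\<kappa> x) (?Y m) A (?Y m y))\<^sup>2 \<partial>\<kappa> x)"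
        proof (rule integral_cong_AE)
          show "(\<lambda>y. (indicator A y - fibre_cprob (?Y m) A y)\<^sup>2) \<in> borel_measurable (\<kappa> x)"
            using sqm unfolding measurable_cong_sets[OF sets_\<kappa>[OF elim(3)] refl] .
          show "(\<lambda>y. (indicator A y - cprob (\<kappa> x) (?Y m) A (?Y m y))\<^sup>2) \<in> borel_measurable (\<kappa> x)"
            using k.cprob_comp_measurable[OF k.simple_function_block[OF kE], of 1 "m + 1" A] kA by measurable
          show "AE y in \<kappa> x. (indicator A y - fibre_cprob (?Y m) A y)\<^sup>2 = (indicator A y - cprob (\<kappa> x) (?Y m) A (?Y m y))\<^sup>2"
            using fibre_cprob_AE[OF elim(3,2), of "?Y m" A] by eventually_elim simp
        qed
        also have "\<dots> \<le> cent (\<kappa> x) ?E (?Y m)"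
          by (intro k.cent_mem_ge_residual kA k.simple_function_block kE)
        also have "\<dots> = ?d m" by (rule k.cent_block_1[OF kE])
        finally show ?thesis .
      qed
      show "(\<lambda>m. ?i m x) \<longlonglongrightarrow> 0"
        by (rule tendsto_sandwich[OF _ _ tendsto_const d0]) (use le in auto)
    qed
    show "AE x in M. norm (?i m x) \<le> 1" for m
      using AE_space
    proof eventually_elim
      case (elim x)
      interpret k: prob_space "\<kappa> x" by (rule prob_space_\<kappa>[OF elim])
      have "integrable (\<kappa> x) (\<lambda>y. (indicator A y - fibre_cprob (?Y m) A y)\<^sup>2)"
        using sqm sq1 by (intro k.integrable_bounded[where B=1]) (simp_all add: measurable_cong_sets[OF sets_\<kappa>[OF elim] refl])
      then have "?i m x \<le> (\<integral>y. 1 \<partial>\<kappa> x)" by (intro integral_mono sq1) auto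
      then show ?case by (simp add: k.prob_space)
    qed
  qed (use kernel_integral_measurable[OF sqm] in simp_all)
  moreover have "(\<integral>x. ?i m x \<partial>M) = ?D m" for m
    by (intro integral_disintegrate integrable_sq_diff ind F)
  ultimately have D0: "?D \<longlonglongrightarrow> 0" by simp
  have "entropy_rate ?E \<le> 0"
  proof (rule field_le_epsilon)
    fix \<epsilon> :: real assume "0 < \<epsilon>"
    then obtain \<delta> where \<delta>: "0 < \<delta>" "\<And>t. 0 \<le> t \<Longrightarrow> t < \<delta> \<Longrightarrow> eta t + eta (1 - t) < \<epsilon>"
      using binary_entropy_small[of \<epsilon>] by auto
    have "\<forall>\<^sub>F m in sequentially. ?D m < \<delta> / 4"
      using order_tendstoD(2)[OF D0, of "\<delta> / 4"] \<delta>(1) by simp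
    then have "\<forall>\<^sub>F m in sequentially. ?D m < \<delta> / 4 \<and> 1 \<le> m"
      using eventually_ge_at_top[of 1] by eventually_elim simp
    then obtain m where m: "?D m < \<delta> / 4" "1 \<le> m" by (auto simp: eventually_sequentially)
    let ?Ym = "?Y m"
    let ?c = "\<lambda>w. {y \<in> space M. ?Ym y = w}"
    have c: "?c w \<in> sets M" for w by (rule simple_function_cell[OF Y])
    let ?q = "\<lambda>B. real_cond_exp M \<I> (indicator B)"
    \<comment> \<open>Conditional expectations given \<open>\<I>\<close> instead of \<open>\<kappa>\<close>, because the former are strictly invariant.\<close>
    define J where "J w = {y \<in> space M. ?q (A \<inter> ?c w) y / ?q (?c w) y > 1/2}" for w
    have "J w \<in> sets \<I>" for w
    proof -
      have "{y \<in> space \<I>. ?q (A \<inter> ?c w) y / ?q (?c w) y > 1/2} \<in> sets \<I>" by measurable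
      then show ?thesis by (simp add: J_def)
    qed
    then have J: "J w \<in> sets M" "T -` J w \<inter> space M = J w" for w
      by (auto simp: sets_\<I> invariant_sets_def)
    let ?V = "?Ym ` space M"
    have fV: "finite ?V" by (rule simple_functionD(1)[OF Y])
    then obtain vs where vs: "set vs = ?V" using finite_list by blast
    define Z where "Z = itinerary (\<lambda>j. J (vs ! j)) (length vs)"
    have Z: "simple_function M Z" unfolding Z_def by (intro simple_function_itinerary J)
    have ZT: "Z (T y) = Z y" if "y \<in> space M" for y
    proof -
      have "T y \<in> J w \<longleftrightarrow> y \<in> J w" for w using J(2)[of w] that by blast
      then show ?thesis unfolding Z_def itinerary_eq_iff by simp
    qed
    define A' where "A' = {y \<in> space M. fibre_cprob ?Ym A y > 1/2}"
    define A'' where "A'' = {y \<in> space M. y \<in> J (?Ym y)}"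
    have A'm: "A' \<in> sets M" unfolding A'_def using F(1)[of 1 "m + 1"] by measurable
    have "A'' = (\<Union>w\<in>?V. J w \<inter> ?c w)" unfolding A''_def by auto
    moreover have "(\<Union>w\<in>?V. J w \<inter> ?c w) \<in> sets M"
      by (intro sets.finite_UN fV sets.Int J(1) c)
    ultimately have A''m: "A'' \<in> sets M" by simp
    have "prob (sym_diff A A') \<le> 4 * ?D m"
      unfolding A'_def by (intro prob_level_set F A)
    then have "prob (sym_diff A A') < \<delta>" using m(1) by linarith
    moreover have "prob (sym_diff A A'') = prob (sym_diff A A')"
    proof -
      have "AE y in M. \<forall>w\<in>?V. ?q (A \<inter> ?c w) y = measure (\<kappa> y) (A \<inter> ?c w) \<and> ?q (?c w) y = measure (\<kappa> y) (?c w)"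
      proof (rule AE_finite_allI[OF fV])
        have q: "AE y in M. ?q B y = measure (\<kappa> y) B" if B: "B \<in> sets M" for B
        proof -
          have "integrable M (indicator B :: 'a \<Rightarrow> real)" using B by (simp add: less_top[symmetric])
          from cond_exp_\<I>[OF this] AE_space show ?thesis
            by eventually_elim (use B in \<open>simp add: sets_\<kappa> space_\<kappa> Int_absorb2 sets.sets_into_space\<close>)
        qed
        show "AE y in M. ?q (A \<inter> ?c w) y = measure (\<kappa> y) (A \<inter> ?c w) \<and> ?q (?c w) y = measure (\<kappa> y) (?c w)" for w
          using q[OF sets.Int[OF A c[of w]]] q[OF c[of w]] by eventually_elim simp
      qed
      then have "AE y in M. y \<in> A'' \<longleftrightarrow> y \<in> A'" using AE_space
      proof eventually_elim
        case (elim y)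
        then have "?q (A \<inter> ?c (?Ym y)) y = measure (\<kappa> y) (A \<inter> ?c (?Ym y))" "?q (?c (?Ym y)) y = measure (\<kappa> y) (?c (?Ym y))" by auto
        then show ?case using elim(2) unfolding A''_def A'_def J_def fibre_cprob_def cprob_def
          by (simp add: space_\<kappa>[OF elim(2)])
      qed
      then show ?thesis using A A'm A''m by (intro finite_measure_eq_AE) auto
    qed
    ultimately have small: "prob (sym_diff A A'') < \<delta>" by simp
    let ?W = "\<lambda>y. (y \<in> A, Z y)"
    have W: "simple_function M ?W" by (intro simple_function_Pair E Z)
    let ?b = "block T ?W 1 (m + 1)"
    have cZ: "coarser M Z ?b"
    proof -
      have "coarser M (\<lambda>y. ?W ((T ^^ 1) y)) ?b" using m(2) by (intro coarser_block) auto
      then have cT: "coarser M (\<lambda>y. Z (T y)) ?b" by simp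
      show ?thesis
        unfolding coarser_def
      proof (intro ballI impI)
        fix y z assume y: "y \<in> space M" and z: "z \<in> space M" and eq: "?b y = ?b z"
        have "Z (T y) = Z (T z)" by (rule coarserD[OF cT y z eq])
        then show "Z y = Z z" using ZT[OF y] ZT[OF z] by simp
      qed
    qed
    have cA: "coarser M (\<lambda>y. y \<in> A'') ?b"
      unfolding coarser_def
    proof (intro ballI impI)
      fix y z assume y: "y \<in> space M" and z: "z \<in> space M" and eq: "?b y = ?b z"
      have "Z y = Z z" by (rule coarserD[OF cZ y z eq])
      then have Zeq: "y \<in> J (vs ! j) \<longleftrightarrow> z \<in> J (vs ! j)" if "j < length vs" for j
        using that unfolding Z_def itinerary_eq_iff by blast
      have Yeq: "?Ym y = ?Ym z" by (rule coarserD[OF coarser_block_Pair1 y z eq])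
      have "?Ym y \<in> set vs" unfolding vs using y by (rule imageI)
      then obtain j where j: "j < length vs" "vs ! j = ?Ym y" unfolding in_set_conv_nth by blast
      have "y \<in> J (?Ym y) \<longleftrightarrow> z \<in> J (?Ym y)" using Zeq[OF j(1)] unfolding j(2) .
      then show "(y \<in> A'') = (z \<in> A'')" unfolding A''_def using y z Yeq by simp
    qed
    have "entropy_rate ?E \<le> entropy_rate ?W"
      by (intro entropy_rate_mono E W) (auto intro: coarser_intros)
    also have "\<dots> \<le> ent M (block T ?W 0 (m + 1)) - ent M (block T ?W 0 m)"
      using entropy_rate_le[OF W, of m] by simp
    also have "\<dots> = cent M ?W ?b" by (rule cent_block_1[OF W, symmetric])
    also have "\<dots> \<le> cent M ?E ?b"
    proof (intro cent_mono_left W E simple_function_block)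
      have "coarser M ?E (\<lambda>y. (?E y, ?b y))" by (rule coarser_PairI1[OF coarser_refl])
      moreover have "coarser M Z (\<lambda>y. (?E y, ?b y))" by (rule coarser_PairI2[OF cZ])
      ultimately show "coarser M ?W (\<lambda>y. (?E y, ?b y))" by (simp only: coarser_Pair_iff)
    qed
    also have "\<dots> \<le> eta (prob (sym_diff A A'')) + eta (1 - prob (sym_diff A A''))"
      by (intro cent_mem_le_sym_diff A A''m simple_function_block W cA)
    also have "\<dots> < \<epsilon>" using \<delta>(2)[OF _ small] by simp
    finally show "entropy_rate ?E \<le> 0 + \<epsilon>" by simp
  qed
  then show ?thesis using A entropy_rate_nonneg[OF E] by (simp add: pinsker_eq)
qed

end

section \<open>The common sigma-algebra\<close>

context ergodic_system begin

text \<open>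
  A single measurable function that represents the tail conditional probability of
  \<open>B\<close> on almost every component: the limits are taken in the whole system and their
  null sets are passed on to the components.
\<close>

lemma tail_density_exists:
  assumes B: "B \<in> sets M"
  shows "\<exists>g. g \<in> borel_measurable M \<and> (\<forall>y. 0 \<le> g y \<and> g y \<le> 1) \<and>
    (AE x in M. stationary.tail_limit (\<kappa> x) T (itinerary gen k) B g)"
proof -
  let ?X = "itinerary gen k"
  have X: "simple_function M ?X" by (rule simple_function_itinerary[OF gen_sets])
  note bl = simple_function_block[OF X]
  obtain g e r s where g: "g \<in> borel_measurable M" "\<And>x. 0 \<le> g x" "\<And>x. g x \<le> 1"
    and e: "\<And>n. e n \<in> borel_measurable M" "\<And>n x. 0 \<le> e n x" "\<And>n x. e n x \<le> 1"
    and rs: "\<And>n. strict_mono (r n)" "strict_mono s"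
    and er: "\<And>n. AE y in M. (\<lambda>j. fibre_cprob (block T ?X n (r n j)) B y) \<longlonglongrightarrow> e n y"
    and gs: "AE y in M. (\<lambda>j. e (s j) y) \<longlonglongrightarrow> g y"
  proof (rule double_L2_limit[of "\<lambda>n m. fibre_cprob (block T ?X n m) B"])
    show "\<And>n m. fibre_cprob (block T ?X n m) B \<in> borel_measurable M"
      by (intro fibre_cprob_measurable bl B)
    show "\<And>n m m'. m \<le> m' \<Longrightarrow> (\<integral>x. (fibre_cprob (block T ?X n m') B x - fibre_cprob (block T ?X n m) B x)\<^sup>2 \<partial>M) =
       (\<integral>x. (fibre_cprob (block T ?X n m') B x)\<^sup>2 \<partial>M) - (\<integral>x. (fibre_cprob (block T ?X n m) B x)\<^sup>2 \<partial>M)"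
      by (intro fibre_pythagoras bl B coarser_block_mono) auto
    show "\<And>n n' m. n \<le> n' \<Longrightarrow> (\<integral>x. (fibre_cprob (block T ?X n m) B x - fibre_cprob (block T ?X n' m) B x)\<^sup>2 \<partial>M) =
       (\<integral>x. (fibre_cprob (block T ?X n m) B x)\<^sup>2 \<partial>M) - (\<integral>x. (fibre_cprob (block T ?X n' m) B x)\<^sup>2 \<partial>M)"
      by (intro fibre_pythagoras bl B coarser_block_mono) auto
  qed (auto intro: fibre_cprob_nonneg fibre_cprob_le_1 bl)
  have "AE y in M. (\<forall>n. (\<lambda>j. fibre_cprob (block T ?X n (r n j)) B y) \<longlonglongrightarrow> e n y) \<and> (\<lambda>j. e (s j) y) \<longlonglongrightarrow> g y"
    using er gs by (simp add: AE_all_countable)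
  from AE_disintegrate[OF this] kernel_constant AE_space
  have "AE x in M. stationary.tail_limit (\<kappa> x) T ?X B g"
  proof eventually_elim
    case (elim x)
    interpret k: stationary "\<kappa> x" T by (rule stationary_\<kappa>) fact
    have "AE y in \<kappa> x. (\<lambda>j. cprob (\<kappa> x) (block T ?X n (r n j)) B (block T ?X n (r n j) y)) \<longlonglongrightarrow> e n y" for n
      using elim(1,2) AE_space
    proof eventually_elim
      case (elim y)
      then have "(\<lambda>j. fibre_cprob (block T ?X n (r n j)) B y) \<longlonglongrightarrow> e n y" by blast
      then show ?case unfolding fibre_cprob_eq[OF \<open>x \<in> space M\<close> elim(3,2)] .
    qed
    moreover have "AE y in \<kappa> x. (\<lambda>j. e (s j) y) \<longlonglongrightarrow> g y" using elim(1) by eventually_elim blast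
    moreover have "e n \<in> borel_measurable (\<kappa> x)" for n
      using e(1) unfolding measurable_cong_sets[OF sets_\<kappa>[OF elim(3)] refl] .
    ultimately show ?case unfolding k.tail_limit_def using e(2,3) rs by blast
  qed
  with g show ?thesis by blast
qed

definition tail_density :: "nat \<Rightarrow> 'a set \<Rightarrow> 'a \<Rightarrow> real" where
  "tail_density k B = (SOME g. g \<in> borel_measurable M \<and> (\<forall>y. 0 \<le> g y \<and> g y \<le> 1) \<and>
    (AE x in M. stationary.tail_limit (\<kappa> x) T (itinerary gen k) B g))"

lemma tail_density:
  assumes B: "B \<in> sets M"
  shows "tail_density k B \<in> borel_measurable M" "0 \<le> tail_density k B y" "tail_density k B y \<le> 1"
    "AE x in M. stationary.tail_limit (\<kappa> x) T (itinerary gen k) B (tail_density k B)"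
  using someI_ex[OF tail_density_exists[OF B]] unfolding tail_density_def by blast+

lemma AE_tail_limit:
  "AE x in M. \<forall>k. \<forall>B\<in>cyl k. stationary.tail_limit (\<kappa> x) T (itinerary gen k) B (tail_density k B)"
proof -
  have "AE x in M. \<forall>B\<in>cyl k. stationary.tail_limit (\<kappa> x) T (itinerary gen k) B (tail_density k B)" for k
    by (rule AE_finite_allI[OF finite_cylinders]) (use tail_density(4) cyl_sets in blast)
  then show ?thesis by (simp add: AE_all_countable)
qed

text \<open>
  The sets in the first family recover all Pinsker sets of the components. Those in the second
  family are trivial on almost every component, but they make \<open>\<kappa>\<close>
  measurable, so that the generated sigma-algebra contains the invariant sets up to null sets,
  which is what makes conditioning in the system agree with conditioning in the components.
\<close>

definition pinsker_sets :: "'a set set" where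
  "pinsker_sets =
     (\<Union>k. (\<lambda>B. {y \<in> space M. tail_density k B y > 1/2}) ` cyl k) \<union>
     (\<Union>B\<in>(\<Union>k. cyl k). range (\<lambda>q. {y \<in> space M. measure (\<kappa> y) B > real_of_rat q}))"

definition pinsker_seq :: "nat \<Rightarrow> 'a set" where
  "pinsker_seq = from_nat_into (insert {} pinsker_sets)"

definition \<C> :: "'a measure" where
  "\<C> = sigma (space M) (range pinsker_seq)"

lemma range_pinsker_seq: "range pinsker_seq = insert {} pinsker_sets"
proof -
  have "countable pinsker_sets" unfolding pinsker_sets_def
    using countable_cylinders[of "space M" gen]
    by (intro countable_Un countable_UN countable_image) (auto intro: countable_finite finite_cylinders)
  then show ?thesis unfolding pinsker_seq_def by (intro range_from_nat_into) auto
qed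

lemma pinsker_seq_sets: "range pinsker_seq \<subseteq> sets M"
proof -
  have "{y \<in> space M. tail_density k B y > 1/2} \<in> sets M" if "B \<in> cyl k" for k B
  proof -
    have "B \<in> sets M" using that cyl_sets by blast
    then show ?thesis using tail_density(1)[of B k] by measurable
  qed
  moreover have "{y \<in> space M. measure (\<kappa> y) B > real_of_rat q} \<in> sets M" if "B \<in> cyl k" for k B q
  proof -
    have "B \<in> sets M" using that cyl_sets by blast
    then show ?thesis using kernel_measure_measurable[of B] by measurable
  qed
  ultimately show ?thesis unfolding range_pinsker_seq pinsker_sets_def by auto
qed

lemma pinsker_seq_Pow: "range pinsker_seq \<subseteq> Pow (space M)"
  using pinsker_seq_sets sets.sets_into_space by blast

lemma space_\<C> [simp]: "space \<C> = space M" and sets_\<C>: "sets \<C> = sigma_sets (space M) (range pinsker_seq)"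
  using pinsker_seq_Pow by (auto simp: \<C>_def)

lemma subalgebra_\<C>: "subalgebra M \<C>"
  unfolding subalgebra_def sets_\<C>
  using sets.sigma_sets_subset[OF pinsker_seq_sets] by simp

lemma countably_generated_\<C>: "countably_generated \<C>"
  unfolding countably_generated_def
  using pinsker_seq_Pow sets_\<C> by (intro exI[of _ "range pinsker_seq"]) simp

sublocale C: finite_measure_subalgebra M \<C>
  by unfold_locales (rule subalgebra_\<C>)

lemma subalgebra_\<kappa>_\<C>: "x \<in> space M \<Longrightarrow> subalgebra (\<kappa> x) \<C>"
  using subalgebra_\<C> by (simp add: subalgebra_def sets_\<kappa> space_\<kappa>)

text \<open>
  The generators are level sets of tail conditional probabilities, or, up to \<open>\<kappa>
  x\<close>-null sets, empty or everything; and the Pinsker sets form a sigma-algebra.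
\<close>

lemma \<C>_subset_pinsker_\<kappa>: "AE x in M. sets \<C> \<subseteq> pinsker (\<kappa> x) T"
proof -
  show ?thesis using AE_tail_limit kernel_constant AE_space
  proof eventually_elim
    case (elim x)
    interpret k: stationary "\<kappa> x" T by (rule stationary_\<kappa>) fact
    interpret P: sigma_algebra "space M" "pinsker (\<kappa> x) T"
      using k.pinsker_sigma_algebra unfolding space_\<kappa>[OF elim(3)] .
    have 1: "{y \<in> space M. tail_density k B y > 1/2} \<in> pinsker (\<kappa> x) T" if B: "B \<in> cyl k" for k B
    proof -
      have Bm: "B \<in> sets M" using B cyl_sets by blast
      have "{y \<in> space (\<kappa> x). tail_density k B y > 1/2} \<in> pinsker (\<kappa> x) T"
      proof (rule k.tail_limit_level_in_pinsker)
        show "simple_function (\<kappa> x) (itinerary gen k)"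
          by (rule simple_function_itinerary) (simp add: sets_\<kappa>[OF elim(3)] gen_sets)
        show "tail_density k B \<in> borel_measurable (\<kappa> x)"
          using tail_density(1)[OF Bm] unfolding measurable_cong_sets[OF sets_\<kappa>[OF elim(3)] refl] .
        show "k.tail_limit (itinerary gen k) B (tail_density k B)" using elim(1) B by blast
      qed
      then show ?thesis unfolding space_\<kappa>[OF elim(3)] .
    qed
    have 2: "{y \<in> space M. measure (\<kappa> y) B > real_of_rat q} \<in> pinsker (\<kappa> x) T" (is "?S \<in> _") if B: "B \<in> cyl k" for k B q
    proof -
      have Bm: "B \<in> sets M" using B cyl_sets by blast
      define S' where "S' = (if measure (\<kappa> x) B > real_of_rat q then space M else {})"
      have S': "S' \<in> pinsker (\<kappa> x) T" unfolding S'_def by simp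
      have Sm: "?S \<in> sets (\<kappa> x)"
        using kernel_measure_measurable[OF Bm] unfolding sets_\<kappa>[OF elim(3)] by measurable
      have S'm: "S' \<in> sets (\<kappa> x)" unfolding S'_def sets_\<kappa>[OF elim(3)] by simp
      have ae: "AE y in \<kappa> x. y \<in> sym_diff ?S S' \<longleftrightarrow> y \<in> {}"
        using elim(2) AE_space
      proof eventually_elim
        case (elim y)
        then show ?case unfolding S'_def space_\<kappa>[OF \<open>x \<in> space M\<close>] by auto
      qed
      have "k.prob (sym_diff ?S S') = k.prob {}"
        by (rule k.finite_measure_eq_AE[OF ae]) (use Sm S'm in auto)
      then have "k.prob (sym_diff ?S S') = 0" by simp
      then have "?S \<in> approximable (\<kappa> x) (pinsker (\<kappa> x) T)"
        using Sm S' unfolding approximable_def by (intro CollectI conjI allI impI bexI[of _ S']) auto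
      then show ?thesis using k.approximable_pinsker by blast
    qed
    have "range pinsker_seq \<subseteq> pinsker (\<kappa> x) T"
      unfolding range_pinsker_seq pinsker_sets_def using 1 2 by auto
    then show ?case unfolding sets_\<C> by (rule P.sigma_sets_subset)
  qed
qed

text \<open>
  A Pinsker set of a component is close to some cylinder \<open>B\<close>, hence to the tail
  conditional probability of \<open>B\<close>, and hence to the generator obtained by rounding
  it at \<open>1/2\<close>.
\<close>

lemma pinsker_\<kappa>_subset_\<C>:
  "AE x in M. \<forall>A\<in>pinsker (\<kappa> x) T. \<exists>D\<in>sets \<C>. sym_diff A D \<in> null_sets (\<kappa> x)"
proof -
  show ?thesis using AE_tail_limit AE_space
  proof eventually_elim
    case (elim x)
    interpret k: stationary "\<kappa> x" T by (rule stationary_\<kappa>) fact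
    show ?case
    proof
      fix A assume A: "A \<in> pinsker (\<kappa> x) T"
      then have Ax: "A \<in> sets (\<kappa> x)" by (simp add: k.pinsker_eq)
      then have Am: "A \<in> sets M" by (simp add: sets_\<kappa>[OF elim(2)])
      show "\<exists>D\<in>sets \<C>. sym_diff A D \<in> null_sets (\<kappa> x)"
      proof (rule k.approximable_imp_eq_mod_null[OF subalgebra_\<kappa>_\<C>[OF elim(2)] Ax])
        fix \<epsilon> :: real assume "0 < \<epsilon>"
        \<comment> \<open>\<open>24 = 4 * 3 * 2\<close>: rounding, the three-term triangle inequality, and the two summands of the bound.\<close>
        then have e24: "0 < \<epsilon> / 24" by simp
        obtain \<delta> where \<delta>: "0 < \<delta>" "\<And>t. 0 \<le> t \<Longrightarrow> t < \<delta> \<Longrightarrow> eta t + eta (1 - t) < \<epsilon> / 24"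
          using binary_entropy_small[OF e24] by auto
        have "A \<in> approximable (\<kappa> x) (\<Union>k. cyl k)"
          by (rule approximable_cyl[OF prob_space_\<kappa>[OF elim(2)] sets_\<kappa>[OF elim(2)] Am])
        moreover have "0 < min \<delta> (\<epsilon> / 24)" using \<delta>(1) e24 by simp
        ultimately obtain B k where B: "B \<in> cyl k" "k.prob (sym_diff A B) < min \<delta> (\<epsilon> / 24)"
          unfolding approximable_def by blast
        have Bm: "B \<in> sets M" using B(1) cyl_sets by blast
        let ?g = "tail_density k B" and ?d = "k.prob (sym_diff A B)"
        have gm: "?g \<in> borel_measurable (\<kappa> x)"
          using tail_density(1)[OF Bm] unfolding measurable_cong_sets[OF sets_\<kappa>[OF elim(2)] refl] .
        have "(\<integral>y. (indicator A y - ?g y)\<^sup>2 \<partial>\<kappa> x) \<le> 3 * (eta ?d + eta (1 - ?d) + ?d)"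
        proof (rule k.tail_limit_close_to_pinsker[OF _ A _ _ gm])
          show "simple_function (\<kappa> x) (itinerary gen k)"
            by (rule simple_function_itinerary) (simp add: sets_\<kappa>[OF elim(2)] gen_sets)
          show "B \<in> sets (\<kappa> x)" using Bm by (simp add: sets_\<kappa>[OF elim(2)])
          show "coarser (\<kappa> x) (\<lambda>y. y \<in> B) (itinerary gen k)"
            using B(1) unfolding cylinders_def coarser_def space_\<kappa>[OF elim(2)] by blast
          show "k.tail_limit (itinerary gen k) B ?g" using elim(1) B(1) by blast
        qed
        also have "\<dots> < 3 * (\<epsilon> / 24 + \<epsilon> / 24)"
          using \<delta>(2)[of ?d] B(2) by (intro mult_strict_left_mono add_strict_mono) auto
        finally have "4 * (\<integral>y. (indicator A y - ?g y)\<^sup>2 \<partial>\<kappa> x) < \<epsilon>" by simp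
        with k.prob_level_set[OF gm tail_density(2)[OF Bm] tail_density(3)[OF Bm] Ax]
        have "k.prob (sym_diff A {y \<in> space M. ?g y > 1/2}) < \<epsilon>"
          unfolding space_\<kappa>[OF elim(2)] by (rule le_less_trans)
        moreover have "{y \<in> space M. ?g y > 1/2} \<in> sets \<C>"
        proof -
          have "{y \<in> space M. ?g y > 1/2} \<in> range pinsker_seq"
            unfolding range_pinsker_seq pinsker_sets_def using B(1) by blast
          then show ?thesis unfolding sets_\<C> by (rule sigma_sets.Basic)
        qed
        ultimately show "\<exists>D\<in>sets \<C>. k.prob (sym_diff A D) < \<epsilon>" by blast
      qed
    qed
  qed
qed

lemma kernel_\<C>: "\<kappa> \<in> \<C> \<rightarrow>\<^sub>M prob_algebra M"
proof (rule measurable_prob_algebra_generated[OF sets_eq_cyl Int_stable_cylinders])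
  show "(\<Union>k. cyl k) \<subseteq> Pow (space M)" by (auto simp: cylinders_def)
  fix B assume B: "B \<in> (\<Union>k. cyl k)"
  have "(\<lambda>y. measure (\<kappa> y) B) \<in> borel_measurable \<C>"
    unfolding borel_measurable_iff_greater
  proof
    fix a :: real
    have "{y \<in> space M. measure (\<kappa> y) B > real_of_rat q} \<in> sets \<C>" for q
    proof -
      have "{y \<in> space M. measure (\<kappa> y) B > real_of_rat q} \<in> range pinsker_seq"
        unfolding range_pinsker_seq pinsker_sets_def using B by blast
      then show ?thesis unfolding sets_\<C> by (rule sigma_sets.Basic)
    qed
    then have "(\<Union>q\<in>{q. a < real_of_rat q}. {y \<in> space M. measure (\<kappa> y) B > real_of_rat q}) \<in> sets \<C>"
      by (intro sets.countable_UN') auto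
    also have "(\<Union>q\<in>{q. a < real_of_rat q}. {y \<in> space M. measure (\<kappa> y) B > real_of_rat q}) =
      {y \<in> space \<C>. a < measure (\<kappa> y) B}"
      using of_rat_dense by (fastforce intro: less_trans)
    finally show "{y \<in> space \<C>. a < measure (\<kappa> y) B} \<in> sets \<C>" .
  qed
  then have "(\<lambda>y. ennreal (measure (\<kappa> y) B)) \<in> borel_measurable \<C>" by measurable
  also have "?this \<longleftrightarrow> (\<lambda>y. emeasure (\<kappa> y) B) \<in> borel_measurable \<C>"
    by (intro measurable_cong) (simp add: finite_measure.emeasure_eq_measure[OF prob_space.finite_measure[OF prob_space_\<kappa>]])
  finally show "(\<lambda>y. emeasure (\<kappa> y) B) \<in> borel_measurable \<C>" .
qed (auto simp: prob_space_\<kappa> sets_\<kappa>)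

section \<open>Conditional expectations on the components\<close>

text \<open>
  Almost every component gives mass one or zero to an invariant set \<open>J\<close>, according
  to whether its base point lies in \<open>J\<close>, so \<open>J\<close> can be read off from
  \<open>\<kappa>\<close>.
\<close>

lemma invariant_set_in_\<C>:
  assumes J: "J \<in> sets \<I>"
  obtains J' where "J' \<in> sets \<C>" "AE y in M. y \<in> J \<longleftrightarrow> y \<in> J'"
proof
  have Jm: "J \<in> sets M" using J subalgebra_\<I> by (auto simp: subalgebra_def)
  have "(\<lambda>y. measure (\<kappa> y) J) \<in> borel_measurable \<C>"
    using measurable_compose[OF kernel_\<C> measurable_measure_prob_algebra[OF Jm]] .
  then have "{y \<in> space \<C>. measure (\<kappa> y) J > 1/2} \<in> sets \<C>" by measurable
  then show "{y \<in> space M. measure (\<kappa> y) J > 1/2} \<in> sets \<C>" by simp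
  have int: "integrable M (indicator J :: 'a \<Rightarrow> real)" using Jm by (simp add: less_top[symmetric])
  have "AE y in M. real_cond_exp M \<I> (indicator J) y = indicator J y"
    by (rule I.real_cond_exp_F_meas[OF int]) (use J in simp)
  with cond_exp_\<I>[OF int] AE_space
  show "AE y in M. y \<in> J \<longleftrightarrow> y \<in> {y \<in> space M. measure (\<kappa> y) J > 1/2}"
  proof eventually_elim
    case (elim y)
    have "(\<integral>z. indicator J z \<partial>\<kappa> y) = measure (\<kappa> y) J"
      using Jm by (simp add: sets_\<kappa>[OF elim(2)] space_\<kappa>[OF elim(2)] Int_absorb2 sets.sets_into_space)
    with elim(1,3) have "measure (\<kappa> y) J = indicator J y" by simp
    with elim(2) show ?case by (cases "y \<in> J") auto
  qed
qed

text \<open>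
  Let \<open>G\<close> be the conditional expectation in the system. For \<open>D\<close> in
  \<open>\<C>\<close> and invariant \<open>J\<close>, the set \<open>J \<inter> D\<close> is in
  \<open>\<C>\<close> up to a null set, so \<open>f\<close> and \<open>G\<close> have the same
  integral over it. As \<open>J\<close> is arbitrary, the integrals of \<open>f\<close> and
  \<open>G\<close> over \<open>D\<close> agree on almost every component. Countably many such
  \<open>D\<close> generate \<open>\<C>\<close>, and so \<open>G\<close> has the defining
  property of the conditional expectation on almost every component.
\<close>

lemma cond_exp_fibre:
  assumes f: "integrable M f"
  shows "AE x in M. AE y in \<kappa> x. real_cond_exp M \<C> f y = real_cond_exp (\<kappa> x) \<C> f y"
proof -
  let ?G = "real_cond_exp M \<C> f"
  have G: "integrable M ?G" by (rule C.real_cond_exp_int(1)[OF f])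
  let ?P = "\<Union>k. cylinders (space M) pinsker_seq k"
  have sets_P: "sets \<C> = sigma_sets (space M) ?P"
    unfolding sets_\<C> by (rule sigma_sets_cylinders[OF pinsker_seq_Pow, symmetric])
  have P: "?P \<subseteq> Pow (space M)" by (auto simp: cylinders_def)
  have one: "AE x in M. (LINT y:D|\<kappa> x. f y) = (LINT y:D|\<kappa> x. ?G y)" if D: "D \<in> ?P" for D
  proof -
    have DC: "D \<in> sets \<C>" unfolding sets_P using D by (rule sigma_sets.Basic)
    then have Dm: "D \<in> sets M" using subalgebra_\<C> by (auto simp: subalgebra_def)
    have iD: "integrable M (\<lambda>y. indicator D y *\<^sub>R h y)" if "integrable M h" for h :: "'a \<Rightarrow> real"
      by (rule integrable_mult_indicator[OF Dm that])
    have "AE x in M. real_cond_exp M \<I> (\<lambda>y. indicator D y *\<^sub>R f y) x = real_cond_exp M \<I> (\<lambda>y. indicator D y *\<^sub>R ?G y) x"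
    proof (rule I.real_cond_exp_charact[OF _ iD[OF f]])
      fix J assume J: "J \<in> sets \<I>"
      then have Jm: "J \<in> sets M" using subalgebra_\<I> by (auto simp: subalgebra_def)
      obtain J' where J': "J' \<in> sets \<C>" "AE y in M. y \<in> J \<longleftrightarrow> y \<in> J'" by (rule invariant_set_in_\<C>[OF J])
      have J'm: "J' \<in> sets M" using J'(1) subalgebra_\<C> by (auto simp: subalgebra_def)
      have sw: "(LINT y:J|M. indicator D y *\<^sub>R h y) = (LINT y:J' \<inter> D|M. h y)" if h: "integrable M h" for h :: "'a \<Rightarrow> real"
        unfolding set_lebesgue_integral_def
      proof (rule integral_cong_AE)
        show "(\<lambda>y. indicator J y *\<^sub>R indicator D y *\<^sub>R h y) \<in> borel_measurable M"
          "(\<lambda>y. indicator (J' \<inter> D) y *\<^sub>R h y) \<in> borel_measurable M"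
          using h Jm J'm Dm by measurable
        show "AE y in M. indicator J y *\<^sub>R indicator D y *\<^sub>R h y = indicator (J' \<inter> D) y *\<^sub>R h y"
          using J'(2) by eventually_elim (auto simp: indicator_def)
      qed
      have "(LINT y:J|M. indicator D y *\<^sub>R f y) = (LINT y:J' \<inter> D|M. f y)" by (rule sw[OF f])
      also have "\<dots> = (LINT y:J' \<inter> D|M. ?G y)"
        by (rule C.real_cond_exp_intA[OF f]) (use J' DC in auto)
      also have "\<dots> = (LINT y:J|M. indicator D y *\<^sub>R ?G y)" by (rule sw[OF G, symmetric])
      also have "\<dots> = (LINT y:J|M. real_cond_exp M \<I> (\<lambda>y. indicator D y *\<^sub>R ?G y) y)"
        by (rule I.real_cond_exp_intA[OF iD[OF G] J])
      finally show "(LINT y:J|M. indicator D y *\<^sub>R f y) = (LINT y:J|M. real_cond_exp M \<I> (\<lambda>y. indicator D y *\<^sub>R ?G y) y)" .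
    qed (rule I.real_cond_exp_int(1)[OF iD[OF G]], rule borel_measurable_cond_exp)
    with cond_exp_\<I>[OF iD[OF f]] cond_exp_\<I>[OF iD[OF G]] show ?thesis
      unfolding set_lebesgue_integral_def by eventually_elim simp
  qed
  have "AE x in M. \<forall>D\<in>?P. (LINT y:D|\<kappa> x. f y) = (LINT y:D|\<kappa> x. ?G y)"
    unfolding AE_ball_countable[OF countable_cylinders] using one by blast
  then show ?thesis using integrable_disintegrate[OF f] integrable_disintegrate[OF G] AE_space
  proof eventually_elim
    case (elim x)
    interpret k: prob_space "\<kappa> x" by (rule prob_space_\<kappa>) fact
    interpret kC: finite_measure_subalgebra "\<kappa> x" \<C>
      by unfold_locales (rule subalgebra_\<kappa>_\<C>[OF elim(4)])
    have Cm: "D \<in> sets (\<kappa> x)" if "D \<in> sets \<C>" for D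
      using that subalgebra_\<kappa>_\<C>[OF elim(4)] by (auto simp: subalgebra_def)
    have "(LINT y:D|\<kappa> x. f y) = (LINT y:D|\<kappa> x. ?G y)" if "D \<in> sigma_sets (space M) ?P" for D
      using Int_stable_cylinders P that
    proof (induction rule: sigma_sets_induct_disjoint)
      case (basic A)
      then show ?case using elim(1) by blast
    next
      case empty
      show ?case by (simp add: set_lebesgue_integral_def)
    next
      case (compl A)
      have A: "A \<in> sets (\<kappa> x)" using compl(1) Cm unfolding sets_P by blast
      have "(LINT y:(space M - A)|\<kappa> x. h y) = (LINT y:space M|\<kappa> x. h y) - (LINT y:A|\<kappa> x. h y)"
        if h: "integrable (\<kappa> x) h" for h :: "'a \<Rightarrow> real"
      proof -
        have "(LINT y:space M|\<kappa> x. h y) - (LINT y:A|\<kappa> x. h y) =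
          (\<integral>y. indicator (space M) y *\<^sub>R h y - indicator A y *\<^sub>R h y \<partial>\<kappa> x)"
          unfolding set_lebesgue_integral_def
          by (intro Bochner_Integration.integral_diff[symmetric] integrable_mult_indicator h A) (simp add: sets_\<kappa>[OF elim(4)])
        also have "\<dots> = (LINT y:(space M - A)|\<kappa> x. h y)"
          unfolding set_lebesgue_integral_def
          using sets.sets_into_space[OF A]
          by (intro Bochner_Integration.integral_cong refl) (auto simp: indicator_def space_\<kappa>[OF elim(4)])
        finally show ?thesis by simp
      qed
      moreover have "(LINT y:space M|\<kappa> x. f y) = (LINT y:space M|\<kappa> x. ?G y)"
        by (rule bspec[OF elim(1)]) (auto simp: cylinders_def)
      ultimately show ?case using elim(2,3) compl(2) by simp
    next
      case (union A)
      have A: "A i \<in> sets (\<kappa> x)" for i using union(2) Cm unfolding sets_P by blast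
      have "(LINT y:(\<Union>i. A i)|\<kappa> x. h y) = (\<Sum>i. LINT y:A i|\<kappa> x. h y)"
        if h: "integrable (\<kappa> x) h" for h :: "'a \<Rightarrow> real"
      proof (rule lebesgue_integral_countable_add)
        show "set_integrable (\<kappa> x) (\<Union>i. A i) h"
          unfolding set_integrable_def using A by (intro integrable_mult_indicator h) auto
      qed (use A union(1) in \<open>auto simp: disjoint_family_on_def\<close>)
      then show ?case using elim union by simp
    qed
    then have "AE y in \<kappa> x. real_cond_exp (\<kappa> x) \<C> f y = ?G y"
      using elim by (intro kC.real_cond_exp_charact) (auto simp: sets_P)
    then show ?case by eventually_elim simp
  qed
qed

text \<open>
  On almost every component \<open>A\<close> is a Pinsker set, hence in \<open>\<C>\<close> up
  to a null set, and it equals its own conditional expectation there;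
  \<open>cond_exp_fibre\<close> glues these statements together.
\<close>

lemma cond_exp_indicator_pinsker:
  assumes A: "A \<in> pinsker M T"
  shows "AE y in M. real_cond_exp M \<C> (indicator A) y = indicator A y"
proof -
  have Am: "A \<in> sets M" using A by (simp add: pinsker_eq)
  have int: "integrable M (indicator A :: 'a \<Rightarrow> real)" using Am by (simp add: less_top[symmetric])
  have "AE x in M. AE y in \<kappa> x. real_cond_exp M \<C> (indicator A) y = indicator A y"
    using cond_exp_fibre[OF int] pinsker_imp_pinsker_\<kappa>[OF A] pinsker_\<kappa>_subset_\<C> AE_space
  proof eventually_elim
    case (elim x)
    interpret k: prob_space "\<kappa> x" by (rule prob_space_\<kappa>) fact
    interpret kC: finite_measure_subalgebra "\<kappa> x" \<C>
      by unfold_locales (rule subalgebra_\<kappa>_\<C>[OF elim(4)])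
    obtain D where D: "D \<in> sets \<C>" "sym_diff A D \<in> null_sets (\<kappa> x)" using elim(2,3) by blast
    have Dm: "D \<in> sets (\<kappa> x)" using D(1) subalgebra_\<kappa>_\<C>[OF elim(4)] by (auto simp: subalgebra_def)
    have Ax: "A \<in> sets (\<kappa> x)" using Am by (simp add: sets_\<kappa>[OF elim(4)])
    have eq: "AE y in \<kappa> x. indicator A y = (indicator D y :: real)"
      using AE_not_in[OF D(2)] by eventually_elim (auto simp: indicator_def)
    have 1: "AE y in \<kappa> x. real_cond_exp (\<kappa> x) \<C> (indicator A) y = real_cond_exp (\<kappa> x) \<C> (indicator D) y"
      by (rule kC.real_cond_exp_cong[OF eq]) (use Ax Dm in auto)
    have 2: "AE y in \<kappa> x. real_cond_exp (\<kappa> x) \<C> (indicator D) y = indicator D y"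
      by (rule kC.real_cond_exp_F_meas) (use D(1) Dm in \<open>auto simp: less_top[symmetric]\<close>)
    show ?case using elim(1) eq 1 2 by eventually_elim simp
  qed
  then show ?thesis
    using Am by (subst AE_disintegrate_pred) auto
qed

end

theorem proposition10p1:
  fixes M :: "'a measure" and T :: "'a \<Rightarrow> 'a" and \<kappa> :: "'a \<Rightarrow> 'a measure"
  assumes "invertible_mps M T"
    and "ergodic_decomposition M T \<kappa>"
  shows "\<exists>C :: 'a measure.
    subalgebra M C \<and> countably_generated C \<and>
    eq_mod M (pinsker M T) (sets C) \<and>
    (AE x in M. eq_mod (\<kappa> x) (pinsker (\<kappa> x) T) (sets C)) \<and>
    (\<forall>f :: 'a \<Rightarrow> real. integrable M f \<longrightarrow>
       (AE x in M. AE y in \<kappa> x. real_cond_exp M C f y = real_cond_exp (\<kappa> x) C f y) \<and>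
       (\<forall>G. cond_exp_versions M \<kappa> C f G \<longrightarrow>
          (AE x in M. real_cond_exp M C f x = G (\<kappa> x) x)))"
proof -
  interpret ergodic_system M T \<kappa> by unfold_locales fact+
  have C_pinsker: "sets \<C> \<subseteq> pinsker M T"
  proof
    fix D assume D: "D \<in> sets \<C>"
    then have "D \<in> sets M" using subalgebra_\<C> by (auto simp: subalgebra_def)
    moreover have "AE x in M. D \<in> pinsker (\<kappa> x) T" using \<C>_subset_pinsker_\<kappa> by eventually_elim (use D in blast)
    ultimately show "D \<in> pinsker M T" by (rule pinsker_\<kappa>_imp_pinsker)
  qed
  have eqM: "eq_mod M (pinsker M T) (sets \<C>)"
    unfolding eq_mod_def
  proof (intro conjI ballI)
    fix A assume A: "A \<in> pinsker M T"
    then have Am: "A \<in> sets M" by (simp add: pinsker_eq)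
    let ?D = "{y \<in> space M. real_cond_exp M \<C> (indicator A) y > 1/2}"
    have "{y \<in> space \<C>. real_cond_exp M \<C> (indicator A) y > 1/2} \<in> sets \<C>" by measurable
    then have D: "?D \<in> sets \<C>" by simp
    then have Dm: "?D \<in> sets M" using subalgebra_\<C> by (auto simp: subalgebra_def)
    have "AE y in M. y \<notin> sym_diff A ?D"
      using cond_exp_indicator_pinsker[OF A] AE_space by eventually_elim (auto simp: indicator_def split: if_splits)
    then have "sym_diff A ?D \<in> null_sets M" using Am Dm by (subst AE_iff_null_sets) auto
    with D show "\<exists>B\<in>sets \<C>. sym_diff A B \<in> null_sets M" by blast
  next
    fix B assume "B \<in> sets \<C>"
    then show "\<exists>A\<in>pinsker M T. sym_diff A B \<in> null_sets M" using C_pinsker by (intro bexI[of _ B]) auto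
  qed
  have eq\<kappa>: "AE x in M. eq_mod (\<kappa> x) (pinsker (\<kappa> x) T) (sets \<C>)"
    using \<C>_subset_pinsker_\<kappa> pinsker_\<kappa>_subset_\<C>
  proof eventually_elim
    case (elim x)
    show ?case unfolding eq_mod_def
    proof (intro conjI ballI)
      fix B assume "B \<in> sets \<C>"
      then show "\<exists>A\<in>pinsker (\<kappa> x) T. sym_diff A B \<in> null_sets (\<kappa> x)" using elim(1) by (intro bexI[of _ B]) auto
    qed (use elim(2) in blast)
  qed
  have versions: "AE x in M. real_cond_exp M \<C> f x = G (\<kappa> x) x"
    if f: "integrable M f" and G: "cond_exp_versions M \<kappa> \<C> f G" for f G
  proof -
    have Gm: "(\<lambda>(\<nu>, y). G \<nu> y) \<in> borel_measurable (prob_algebra M \<Otimes>\<^sub>M M)"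
      and Gv: "AE x in M. AE y in \<kappa> x. G (\<kappa> x) y = real_cond_exp (\<kappa> x) \<C> f y"
      using G by (auto simp: cond_exp_versions_def)
    have [measurable]: "(\<lambda>y. G (\<kappa> y) y) \<in> borel_measurable M"
      using measurable_compose[OF measurable_Pair[OF kernel measurable_ident_sets[OF refl]] Gm] by simp
    \<comment> \<open>\<open>G (\<kappa> y) y\<close> does not mention \<open>x\<close>, so the exceptional sets in the components form one null set of \<open>M\<close>.\<close>
    have "AE x in M. AE y in \<kappa> x. real_cond_exp M \<C> f y = G (\<kappa> y) y"
      using cond_exp_fibre[OF f] Gv kernel_constant
    proof eventually_elim
      case (elim x)
      then show ?case by eventually_elim simp
    qed
    then show ?thesis by (subst AE_disintegrate_pred) auto
  qed
  show ?thesis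
    by (intro exI[of _ \<C>] conjI allI impI subalgebra_\<C> countably_generated_\<C> eqM eq\<kappa> cond_exp_fibre versions)
qed

end
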